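(* Let $A$, $B$, $C$ be $n$-by-$n$ matrices, $n$ a power of 2, with $A$ and $B$ upper triangular and having no common eigenvalue, and let $R$ be the solution of the Sylvester equation $AR-RB=-C$. If $n$-by-$n$ matrices can be multiplied in $O(n^{\omega+\eta})$ operations with $\omega+\eta>2$, then the recursive algorithm $SylR(A,B,C)$ performs $O(n^{\omega+\eta})$ arithmetic operations. Moreover, if the matrix multiplication used is stable, then to first order in $\varepsilon$ the normwise error $err(n)$ in the solution $R$ computed by $SylR(A,B,C)$ satisfies $$ err(n)\le O\left(n^{1+\log_2 3}\,\mu(n/2)\,\varepsilon\,\|R\|\left(\frac{\|A\|+\|B\|}{\mathrm{sep}(A,B)}\right)^{1+\log_2 n}\right), $$ so that $SylR$ is a logarithmically stable algorithm for the Sylvester equation.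
   Context: $\mathrm{sep}(A,B)=\sigma_{\min}(I\otimes A-B^T\otimes I)=\min_{\|R\|_F=1}\|AR-RB\|_F$. Arithmetic is floating point with machine epsilon $\varepsilon$. Stable matrix multiplication means that the computed product of $n$-by-$n$ matrices satisfies $\|C_{comp}-A\cdot B\|\le\mu(n)\varepsilon\|A\|\,\|B\|+O(\varepsilon^2)$ with $\mu(n)$ bounded by a polynomial in $n$. Algorithm $R=SylR(A,B,C)$: if $n=1$ return $R=-C/(A-B)$. Otherwise partition $A,B,C,R$ into $\frac n2$-by-$\frac n2$ blocks $A_{ij},B_{ij},C_{ij},R_{ij}$ ($A_{21}=B_{21}=0$) and compute in order (a) $R_{21}=SylR(A_{22},B_{11},C_{21})$; (b) $R_{11}=SylR(A_{11},B_{11},C_{11}+A_{12}R_{21})$; (c) $R_{22}=SylR(A_{22},B_{22},C_{22}-R_{21}B_{12})$; (d) $R_{12}=SylR(A_{11},B_{22},C_{12}-R_{11}B_{12}+A_{12}R_{22})$; where all products are computed by the given matrix multiplication algorithm. Logarithmic stability: an algorithm for computing $f(x)$, with $x$ of size $n$, is logarithmically stable if its relative error is $O(\varepsilon)\,\kappa_f(x)^{\chi(n)}+O(\varepsilon^2)$ with $\chi(n)\ge1$ bounded by a polynomial in $\log n$ ($O(\cdot)$ may hide polynomial factors in $n$), where $\kappa_f(x)$ is the condition number of the problem; for the Sylvester equation the condition number is that of the linear system $(I\otimes A-B^T\otimes I)\,\mathrm{vec}(R)=-\mathrm{vec}(C)$, and a conventional algorithm has error $O(\varepsilon\|R\|\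frac{\|A\|+\|B\|}{\mathrm{sep}(A,B)})$.
   Formalization: The stability factor μ(n) is assumed nondecreasing and at least 1 (μ(1/2) for n=1 is read as μ(0)); without this the error bound fails, e.g. for exact products with μ=0, since additions are also rounded. *)

theory Defs
  imports
    "Jordan_Normal_Form.Char_Poly"
    "Jordan_Normal_Form.Gauss_Jordan_Elimination"
begin

(* The scalar type is any real normed field, i.e. the reals or the complex numbers. *)

section \<open>Norms, separation and condition number\<close>

definition vec_norm2 :: "'a::real_normed_field vec \<Rightarrow> real" where
  "vec_norm2 v = sqrt (\<Sum>i<dim_vec v. (norm (v $ i))\<^sup>2)"

definition frob_norm :: "'a::real_normed_field mat \<Rightarrow> real" where
  "frob_norm X = sqrt (\<Sum>i<dim_row X. \<Sum>j<dim_col X. (norm (X $$ (i, j)))\<^sup>2)"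

definition op_norm2 :: "'a::real_normed_field mat \<Rightarrow> real" where
  "op_norm2 M = Sup {vec_norm2 (M *\<^sub>v v) | v. v \<in> carrier_vec (dim_col M) \<and> vec_norm2 v = 1}"

definition cond2 :: "'a::real_normed_field mat \<Rightarrow> real" where
  "cond2 M = op_norm2 M * op_norm2 (the (mat_inverse M))"

definition kronecker :: "'a::times mat \<Rightarrow> 'a mat \<Rightarrow> 'a mat" where
  "kronecker X Y = mat (dim_row X * dim_row Y) (dim_col X * dim_col Y)
     (\<lambda>(i, j). X $$ (i div dim_row Y, j div dim_col Y) * Y $$ (i mod dim_row Y, j mod dim_col Y))"

(* With vec stacking columns, this is the matrix of R |-> A R - R B. *)
definition sylvester_matrix :: "'a::real_normed_field mat \<Rightarrow> 'a mat \<Rightarrow> 'a mat" where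
  "sylvester_matrix A B =
     kronecker (1\<^sub>m (dim_row B)) A - kronecker (transpose_mat B) (1\<^sub>m (dim_row A))"

definition sep :: "'a::real_normed_field mat \<Rightarrow> 'a mat \<Rightarrow> real" where
  "sep A B = Inf {frob_norm (A * R - R * B) | R.
     R \<in> carrier_mat (dim_row A) (dim_row B) \<and> frob_norm R = 1}"

section \<open>Sylvester equations with triangular coefficients\<close>

definition sylvester_inputs :: "nat \<Rightarrow> ('a::real_normed_field mat \<times> 'a mat \<times> 'a mat) set" where
  "sylvester_inputs n = {(A, B, C). (\<exists>k. n = 2 ^ k) \<and>
     A \<in> carrier_mat n n \<and> B \<in> carrier_mat n n \<and> C \<in> carrier_mat n n \<and>
     upper_triangular A \<and> upper_triangular B \<and>
     \<not> (\<exists>z. eigenvalue A z \<and> eigenvalue B z)}"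

definition is_sylvester_solution ::
  "'a::real_normed_field mat \<Rightarrow> 'a mat \<Rightarrow> 'a mat \<Rightarrow> 'a mat \<Rightarrow> bool" where
  "is_sylvester_solution A B C R \<longleftrightarrow>
     R \<in> carrier_mat (dim_row A) (dim_row B) \<and> A * R - R * B = - C"

definition sylvester_solution ::
  "'a::real_normed_field mat \<Rightarrow> 'a mat \<Rightarrow> 'a mat \<Rightarrow> 'a mat" where
  "sylvester_solution A B C = (THE R. is_sylvester_solution A B C R)"

section \<open>Floating-point arithmetic and matrix multiplication\<close>

(* mm returns the computed product together with the number of arithmetic operations used. *)
record 'a arith =
  fadd :: "'a \<Rightarrow> 'a \<Rightarrow> 'a"
  fsub :: "'a \<Rightarrow> 'a \<Rightarrow> 'a"
  fdiv :: "'a \<Rightarrow> 'a \<Rightarrow> 'a"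
  mm :: "'a mat \<Rightarrow> 'a mat \<Rightarrow> 'a mat \<times> nat"

(* The standard model: each operation is exact up to a relative error of at most eps. *)
definition fp_arithmetic :: "real \<Rightarrow> 'a::real_normed_field arith \<Rightarrow> bool" where
  "fp_arithmetic \<epsilon> F \<longleftrightarrow> (\<forall>x y.
     (\<exists>\<delta>. norm \<delta> \<le> \<epsilon> \<and> fadd F x y = (x + y) * (1 + \<delta>)) \<and>
     (\<exists>\<delta>. norm \<delta> \<le> \<epsilon> \<and> fsub F x y = (x - y) * (1 + \<delta>)) \<and>
     (y \<noteq> 0 \<longrightarrow> (\<exists>\<delta>. norm \<delta> \<le> \<epsilon> \<and> fdiv F x y = (x / y) * (1 + \<delta>))))"

definition mm_cost_bound :: "'a::real_normed_field arith \<Rightarrow> real \<Rightarrow> real \<Rightarrow> bool" where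
  "mm_cost_bound F c \<gamma> \<longleftrightarrow> (\<forall>n\<ge>1. \<forall>X \<in> carrier_mat n n. \<forall>Y \<in> carrier_mat n n.
     fst (mm F X Y) \<in> carrier_mat n n \<and> real (snd (mm F X Y)) \<le> c * real n powr \<gamma>)"

(* ar is a family of arithmetics indexed by the machine epsilon. The O(eps^2) term is only
   required to be uniform over factors of bounded norm. As an error bound, mu may be enlarged,
   so it is normalised to be nondecreasing and at least 1 (one rounding error); the bound would
   fail for a mu that vanishes or is larger for smaller sizes, since SylR also rounds its
   additions and multiplies at all smaller sizes. *)
definition stable_mm :: "(real \<Rightarrow> 'a::real_normed_field arith) \<Rightarrow> (nat \<Rightarrow> real) \<Rightarrow> bool" where
  "stable_mm ar \<mu> \<longleftrightarrow>
     mono \<mu> \<and> (\<forall>n. 1 \<le> \<mu> n) \<and> (\<exists>p :: real poly. \<forall>n\<ge>1. \<mu> n \<le> poly p (real n)) \<and>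
     (\<forall>n\<ge>1. \<forall>b. \<exists>K. \<forall>\<^sub>F \<epsilon> in at_right 0. \<forall>X \<in> carrier_mat n n. \<forall>Y \<in> carrier_mat n n.
        frob_norm X \<le> b \<longrightarrow> frob_norm Y \<le> b \<longrightarrow>
        fst (mm (ar \<epsilon>) X Y) \<in> carrier_mat n n \<and>
        frob_norm (fst (mm (ar \<epsilon>) X Y) - X * Y)
          \<le> \<mu> n * \<epsilon> * frob_norm X * frob_norm Y + K * \<epsilon>\<^sup>2)"

definition madd :: "'a arith \<Rightarrow> 'a mat \<Rightarrow> 'a mat \<Rightarrow> 'a mat \<times> nat" where
  "madd F X Y = (mat (dim_row X) (dim_col X) (\<lambda>ij. fadd F (X $$ ij) (Y $$ ij)),
     dim_row X * dim_col X)"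

definition msub :: "'a arith \<Rightarrow> 'a mat \<Rightarrow> 'a mat \<Rightarrow> 'a mat \<times> nat" where
  "msub F X Y = (mat (dim_row X) (dim_col X) (\<lambda>ij. fsub F (X $$ ij) (Y $$ ij)),
     dim_row X * dim_col X)"

section \<open>The recursive algorithm\<close>

(* Returns the computed solution and the operation count; the sign change at size 1 is exact
   but counted. *)
fun SylR :: "'a::real_normed_field arith \<Rightarrow> nat \<Rightarrow> 'a mat \<Rightarrow> 'a mat \<Rightarrow> 'a mat \<Rightarrow> 'a mat \<times> nat" where
  "SylR F n A B C =
    (if n \<le> 1 then
       (mat 1 1 (\<lambda>_. fdiv F (- C $$ (0, 0)) (fsub F (A $$ (0, 0)) (B $$ (0, 0)))), 3)
     else
       let m = n div 2;
         (A11, A12, A21, A22) = split_block A m m;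
         (B11, B12, B21, B22) = split_block B m m;
         (C11, C12, C21, C22) = split_block C m m;
         (R21, t1) = SylR F m A22 B11 C21;
         (P1, t2) = mm F A12 R21;
         (D11, t3) = madd F C11 P1;
         (R11, t4) = SylR F m A11 B11 D11;
         (P2, t5) = mm F R21 B12;
         (D22, t6) = msub F C22 P2;
         (R22, t7) = SylR F m A22 B22 D22;
         (P3, t8) = mm F R11 B12;
         (P4, t9) = mm F A12 R22;
         (S, t10) = msub F C12 P3;
         (D12, t11) = madd F S P4;
         (R12, t12) = SylR F m A11 B22 D12
       in (four_block_mat R11 R12 R21 R22,
           t1 + t2 + t3 + t4 + t5 + t6 + t7 + t8 + t9 + t10 + t11 + t12))"

declare SylR.simps [simp del]

section \<open>Logarithmic stability\<close>

(* X n: the inputs of size n; f: the exact solution; kappa: the condition number;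
   alg eps x: the result computed with machine epsilon eps. The polynomial p is the factor hidden
   in O(eps); the constant K of the O(eps^2) term may depend on the input. *)
definition logarithmically_stable ::
  "(nat \<Rightarrow> 'x set) \<Rightarrow> ('x \<Rightarrow> 'a::real_normed_field mat) \<Rightarrow> ('x \<Rightarrow> real) \<Rightarrow> (real \<Rightarrow> 'x \<Rightarrow> 'a mat) \<Rightarrow> bool"
  where
  "logarithmically_stable X f \<kappa> alg \<longleftrightarrow>
     (\<exists>(p :: real poly) (q :: real poly) (\<chi> :: nat \<Rightarrow> real).
        (\<forall>n\<ge>1. 1 \<le> \<chi> n \<and> \<chi> n \<le> poly q (log 2 (real n))) \<and>
        (\<forall>n\<ge>1. \<forall>x \<in> X n. frob_norm (f x) \<noteq> 0 \<longrightarrow>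
           (\<exists>K. \<forall>\<^sub>F \<epsilon> in at_right 0.
              frob_norm (alg \<epsilon> x - f x) / frob_norm (f x)
                \<le> poly p (real n) * \<epsilon> * \<kappa> x powr \<chi> n + K * \<epsilon>\<^sup>2)))"

end

theory Submission
  imports Defs "HOL-Analysis.L2_Norm"
begin

text \<open>
  Let \<open>\<parallel>X\<parallel> \<le> g \<parallel>A X - X B\<parallel>\<close> and \<open>\<parallel>A X - X B\<parallel> \<le> L \<parallel>X\<parallel>\<close> for all \<open>X\<close>, in the Frobenius norm, and put
  \<open>\<kappa> = g L\<close>, which is at least 1. If the coefficients are split into blocks of size \<open>h\<close>, then the
  four pairs of diagonal blocks that occur in the recursive calls inherit both bounds
  (\<open>bounds_blocks\<close>), and the off-diagonal blocks have norm at most \<open>h L\<close> (\<open>off_diagonal_bound\<close>).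

  The error is controlled through the residual. Every recursive call is given a right-hand side formed
  from blocks that were computed before. Therefore each block of the residual \<open>A X - X B + C\<close> of the
  computed \<open>X\<close> consists of the residual of a single call and of the rounding errors made in forming
  its right-hand side; the errors of the earlier blocks do not occur in it. If the calls have relative
  error \<open>e \<epsilon>\<close>, then the residual has norm at most \<open>(4 L e + 13 \<mu>(h) h L) \<epsilon> \<parallel>R\<parallel>\<close> to first order, and
  inverting the operator once gives the relative error \<open>(4 \<kappa> e + 13 \<mu>(h) h \<kappa>) \<epsilon>\<close> for twice the size
  (\<open>SylR_accuracy_step\<close>). Induction yields \<open>7 \<cdot> 6\<^sup>k \<mu>(n/2) \<kappa>\<^sup>k\<^sup>+\<^sup>1 \<epsilon>\<close> for \<open>n = 2\<^sup>k\<close> (\<open>SylR_accuracy_bound\<close>),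
  where \<open>6\<^sup>k\<close> is the power \<open>1 + log\<^sub>2 3\<close> of \<open>n\<close>.

  With \<open>g = 1 / sep A B\<close> and \<open>L = \<parallel>A\<parallel> + \<parallel>B\<parallel>\<close> (\<open>sylvester_bounds_sep\<close>) this is the error bound. With the
  spectral norms of the Kronecker matrix and of its inverse (\<open>sylvester_bounds_op_norm2\<close>), \<open>\<kappa>\<close> is the
  condition number of the linear system, which gives logarithmic stability. The two differ: for
  \<open>A = a I\<close> and \<open>B = b I\<close> with \<open>a\<close> close to \<open>b\<close> the condition number is 1, but the quotient of
  \<open>\<parallel>A\<parallel> + \<parallel>B\<parallel>\<close> by \<open>sep A B\<close> is huge. Stability does not follow from the error bound, and it is essential
  that the induction measures the coefficients by \<open>L\<close> alone. That \<open>sep A B\<close> is positive and that the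
  Kronecker matrix is invertible rests on the trivial kernel of the operator (\<open>sylvester_op_kernel\<close>).

  The operation count is the solution of \<open>T(2h) \<le> 4 T(h) + 4 (\<bar>c\<bar> + 1) h\<^sup>\<gamma>\<close> with \<open>\<gamma> > 2\<close> (\<open>SylR_cost\<close>).
\<close>

section \<open>Frobenius norm\<close>

lemma vec_norm2_L2_set: "vec_norm2 v = L2_set (\<lambda>i. norm (v $ i)) {..<dim_vec v}"
  by (simp add: vec_norm2_def L2_set_def)

lemma frob_norm_L2_set:
  "frob_norm X = L2_set (\<lambda>(i, j). norm (X $$ (i, j))) ({..<dim_row X} \<times> {..<dim_col X})"
  by (simp add: frob_norm_def L2_set_def sum.cartesian_product case_prod_unfold)

lemma frob_norm_nonneg [simp]: "0 \<le> frob_norm X"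
  by (simp add: frob_norm_L2_set)

lemma norm_le_frob_norm:
  assumes "i < dim_row X" "j < dim_col X"
  shows "norm (X $$ (i, j)) \<le> frob_norm X"
  unfolding frob_norm_L2_set
  using member_le_L2_set[of "{..<dim_row X} \<times> {..<dim_col X}" "(i, j)" "\<lambda>(i, j). norm (X $$ (i, j))"]
    assms by auto

lemma frob_norm_zero [simp]: "frob_norm (0\<^sub>m r c) = 0"
  by (simp add: frob_norm_def)

lemma frob_norm_mono:
  assumes X: "X \<in> carrier_mat r c" and Y: "Y \<in> carrier_mat r c" and t: "0 \<le> t"
    and le: "\<And>i j. i < r \<Longrightarrow> j < c \<Longrightarrow> norm (X $$ (i, j)) \<le> t * norm (Y $$ (i, j))"
  shows "frob_norm X \<le> t * frob_norm Y"
proof -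
  have "frob_norm X = L2_set (\<lambda>(i, j). norm (X $$ (i, j))) ({..<r} \<times> {..<c})"
    using X by (simp add: frob_norm_L2_set)
  also have "\<dots> \<le> L2_set (\<lambda>ij. t * (case ij of (i, j) \<Rightarrow> norm (Y $$ (i, j)))) ({..<r} \<times> {..<c})"
    by (rule L2_set_mono) (use le in auto)
  also have "\<dots> = t * frob_norm Y"
    using Y t by (simp add: frob_norm_L2_set L2_set_right_distrib)
  finally show ?thesis .
qed

lemma frob_norm_add:
  assumes X: "X \<in> carrier_mat r c" and Y: "Y \<in> carrier_mat r c"
  shows "frob_norm (X + Y) \<le> frob_norm X + frob_norm Y"
proof -
  let ?S = "{..<r} \<times> {..<c}"
  have "frob_norm (X + Y) = L2_set (\<lambda>ij. norm ((X + Y) $$ ij)) ?S"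
    using Y by (simp add: frob_norm_L2_set case_prod_unfold)
  also have "\<dots> \<le> L2_set (\<lambda>ij. norm (X $$ ij) + norm (Y $$ ij)) ?S"
    by (rule L2_set_mono) (use X Y in \<open>auto intro!: norm_triangle_ineq\<close>)
  also have "\<dots> \<le> L2_set (\<lambda>ij. norm (X $$ ij)) ?S + L2_set (\<lambda>ij. norm (Y $$ ij)) ?S"
    by (rule L2_set_triangle_ineq)
  finally show ?thesis
    using X Y by (simp add: frob_norm_L2_set case_prod_unfold)
qed

lemma frob_norm_uminus [simp]: "frob_norm (- X) = frob_norm X"
  by (simp add: frob_norm_def)

lemma frob_norm_diff:
  assumes X: "X \<in> carrier_mat r c" and Y: "Y \<in> carrier_mat r c"
  shows "frob_norm (X - Y) \<le> frob_norm X + frob_norm Y"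
proof -
  have "X - Y = X + (- Y)" using X Y by auto
  then show ?thesis using frob_norm_add[of X r c "- Y"] X Y by auto
qed

lemma frob_norm_smult: "frob_norm (a \<cdot>\<^sub>m X) = norm a * frob_norm X"
proof -
  have "frob_norm (a \<cdot>\<^sub>m X) = L2_set (\<lambda>ij. norm a * norm (X $$ ij)) ({..<dim_row X} \<times> {..<dim_col X})"
    by (auto simp: frob_norm_L2_set norm_mult intro!: L2_set_cong)
  then show ?thesis
    by (simp add: L2_set_right_distrib[symmetric] frob_norm_L2_set case_prod_unfold)
qed

lemma norm_scalar_prod_le:
  fixes v :: "'a::real_normed_field vec"
  assumes "dim_vec v = dim_vec w"
  shows "norm (v \<bullet> w) \<le> vec_norm2 v * vec_norm2 w"
proof -
  have "norm (v \<bullet> w) \<le> (\<Sum>i<dim_vec w. \<bar>norm (v $ i)\<bar> * \<bar>norm (w $ i)\<bar>)"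
    unfolding scalar_prod_def lessThan_atLeast0 by (rule order_trans[OF norm_sum]) (simp add: norm_mult)
  also have "\<dots> \<le> vec_norm2 v * vec_norm2 w"
    using L2_set_mult_ineq[of "\<lambda>i. norm (v $ i)" "\<lambda>i. norm (w $ i)" "{..<dim_vec w}"] assms
    by (simp add: vec_norm2_L2_set)
  finally show ?thesis .
qed

lemma frob_norm_rows: "frob_norm X = L2_set (\<lambda>i. vec_norm2 (row X i)) {..<dim_row X}"
  by (simp add: frob_norm_def L2_set_def vec_norm2_def sum_nonneg)

lemma frob_norm_cols: "frob_norm X = L2_set (\<lambda>j. vec_norm2 (col X j)) {..<dim_col X}"
proof -
  have "frob_norm X = sqrt (\<Sum>j<dim_col X. \<Sum>i<dim_row X. (norm (X $$ (i, j)))\<^sup>2)"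
    unfolding frob_norm_def by (subst sum.swap) simp
  then show ?thesis by (simp add: L2_set_def vec_norm2_def sum_nonneg)
qed

lemma vec_norm2_nonneg [simp]: "0 \<le> vec_norm2 v"
  by (simp add: vec_norm2_L2_set)

lemma vec_norm2_mult_mat_vec:
  assumes "dim_vec v = dim_col X"
  shows "vec_norm2 (X *\<^sub>v v) \<le> frob_norm X * vec_norm2 v"
proof -
  have "vec_norm2 (X *\<^sub>v v) = L2_set (\<lambda>i. norm (row X i \<bullet> v)) {..<dim_row X}"
    by (auto simp: vec_norm2_L2_set intro!: L2_set_cong)
  also have "\<dots> \<le> L2_set (\<lambda>i. vec_norm2 (row X i) * vec_norm2 v) {..<dim_row X}"
    by (rule L2_set_mono) (use assms in \<open>auto intro!: norm_scalar_prod_le\<close>)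
  also have "\<dots> = frob_norm X * vec_norm2 v"
    by (simp add: L2_set_left_distrib[symmetric] frob_norm_rows)
  finally show ?thesis .
qed

lemma frob_norm_mult:
  assumes "dim_col X = dim_row Y"
  shows "frob_norm (X * Y) \<le> frob_norm X * frob_norm Y"
proof -
  have "frob_norm (X * Y) = L2_set (\<lambda>j. vec_norm2 (X *\<^sub>v col Y j)) {..<dim_col Y}"
    by (auto simp: frob_norm_cols intro!: L2_set_cong arg_cong[of _ _ vec_norm2])
  also have "\<dots> \<le> L2_set (\<lambda>j. frob_norm X * vec_norm2 (col Y j)) {..<dim_col Y}"
    by (rule L2_set_mono) (use assms in \<open>auto intro!: vec_norm2_mult_mat_vec\<close>)
  also have "\<dots> = frob_norm X * frob_norm Y"
    by (simp add: L2_set_right_distrib[symmetric] frob_norm_cols)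
  finally show ?thesis .
qed

lemma frob_norm_le_dim:
  assumes X: "X \<in> carrier_mat n n" and "0 \<le> a"
    and le: "\<And>i j. i < n \<Longrightarrow> j < n \<Longrightarrow> norm (X $$ (i, j)) \<le> a"
  shows "frob_norm X \<le> real n * a"
proof -
  have "frob_norm X \<le> L2_set (\<lambda>_. a) ({..<n} \<times> {..<n})"
    unfolding frob_norm_L2_set using X by (auto intro!: L2_set_mono le)
  then show ?thesis using \<open>0 \<le> a\<close> by (simp add: L2_set_constant real_sqrt_mult_self card_cartesian_product)
qed

subsection \<open>Blocks\<close>

lemma sum_lessThan_add:
  fixes f :: "nat \<Rightarrow> 'b::comm_monoid_add"
  shows "(\<Sum>i<m + k. f i) = (\<Sum>i<m. f i) + (\<Sum>i<k. f (i + m))"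
proof -
  have "(\<Sum>i<m + k. f i) = (\<Sum>i<m. f i) + (\<Sum>i\<in>{m..<m+k}. f i)"
    by (subst sum.union_disjoint[symmetric]) (auto intro!: sum.cong)
  also have "(\<Sum>i\<in>{m..<m+k}. f i) = (\<Sum>i<k. f (i + m))"
    using sum.shift_bounds_nat_ivl[of f 0 m k] by (simp add: atLeast0LessThan add.commute)
  finally show ?thesis .
qed

lemma frob_norm_four_block:
  assumes "P \<in> carrier_mat m m" "Q \<in> carrier_mat m k" "S \<in> carrier_mat k m" "T \<in> carrier_mat k k"
  shows "(frob_norm (four_block_mat P Q S T))\<^sup>2 =
    (frob_norm P)\<^sup>2 + (frob_norm Q)\<^sup>2 + (frob_norm S)\<^sup>2 + (frob_norm T)\<^sup>2"
proof -
  have nn: "0 \<le> (\<Sum>i<a. \<Sum>j<b. (norm (Z $$ (i, j)))\<^sup>2)" for a b and Z :: "'a mat"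
    by (intro sum_nonneg) auto
  show ?thesis
    using assms unfolding frob_norm_def
    by (simp add: nn real_sqrt_pow2 sum_lessThan_add sum.distrib)
qed

lemma frob_norm_block_le:
  assumes "P \<in> carrier_mat m m" "Q \<in> carrier_mat m k" "S \<in> carrier_mat k m" "T \<in> carrier_mat k k"
  shows "frob_norm P \<le> frob_norm (four_block_mat P Q S T)"
    "frob_norm Q \<le> frob_norm (four_block_mat P Q S T)"
    "frob_norm S \<le> frob_norm (four_block_mat P Q S T)"
    "frob_norm T \<le> frob_norm (four_block_mat P Q S T)"
  by (rule power2_le_imp_le; simp add: frob_norm_four_block[OF assms])+

lemma frob_norm_four_block_le:
  assumes "P \<in> carrier_mat m m" "Q \<in> carrier_mat m k" "S \<in> carrier_mat k m" "T \<in> carrier_mat k k"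
  shows "frob_norm (four_block_mat P Q S T) \<le> frob_norm P + frob_norm Q + frob_norm S + frob_norm T"
proof (rule power2_le_imp_le)
  have "a\<^sup>2 + b\<^sup>2 + c\<^sup>2 + d\<^sup>2 \<le> (a + b + c + d)\<^sup>2"
    if "0 \<le> a" "0 \<le> b" "0 \<le> c" "0 \<le> d" for a b c d :: real
    using that by (simp add: power2_eq_square algebra_simps)
  then show "(frob_norm (four_block_mat P Q S T))\<^sup>2 \<le>
      (frob_norm P + frob_norm Q + frob_norm S + frob_norm T)\<^sup>2"
    unfolding frob_norm_four_block[OF assms] by simp
qed simp

section \<open>The Sylvester operator\<close>

abbreviation sylvester_op :: "'a::real_normed_field mat \<Rightarrow> 'a mat \<Rightarrow> 'a mat \<Rightarrow> 'a mat" where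
  "sylvester_op A B X \<equiv> A * X - X * B"

definition triangular_pair :: "nat \<Rightarrow> 'a::real_normed_field mat \<Rightarrow> 'a mat \<Rightarrow> bool" where
  "triangular_pair n A B \<longleftrightarrow> A \<in> carrier_mat n n \<and> B \<in> carrier_mat n n \<and>
     upper_triangular A \<and> upper_triangular B \<and> (\<forall>i<n. \<forall>j<n. A $$ (i, i) \<noteq> B $$ (j, j))"

lemma triangular_pairD:
  assumes "triangular_pair n A B"
  shows "A \<in> carrier_mat n n" "B \<in> carrier_mat n n" "upper_triangular A" "upper_triangular B"
    "\<And>i j. i < n \<Longrightarrow> j < n \<Longrightarrow> A $$ (i, i) \<noteq> B $$ (j, j)"
  using assms by (auto simp: triangular_pair_def)

text \<open>The diagonal entries of a triangular matrix are eigenvalues over the scalar field itself, so that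
  triangular matrices without a common eigenvalue have disjoint diagonals, over the reals as well.\<close>

lemma triangular_pair_inputs:
  assumes "(A, B, C) \<in> sylvester_inputs n"
  shows "triangular_pair n A B"
proof -
  have ev: "eigenvalue T (T $$ (i, i))"
    if "T \<in> carrier_mat n n" "upper_triangular T" "i < n" for T :: "'a mat" and i
  proof -
    have "T $$ (i, i) \<in> set (diag_mat T)" using that by (auto simp: diag_mat_def)
    then have "poly (char_poly T) (T $$ (i, i)) = 0"
      unfolding char_poly_upper_triangular[OF that(1,2)]
      by (auto simp: poly_prod_list prod_list_zero_iff image_iff)
    then show ?thesis using eigenvalue_root_char_poly[OF that(1)] by simp
  qed
  show ?thesis
    using assms ev[of A] ev[of B] unfolding sylvester_inputs_def triangular_pair_def by fastforce
qed

lemma sylvester_op_diff: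
  assumes "A \<in> carrier_mat n n" "B \<in> carrier_mat n n" "X \<in> carrier_mat n n" "Y \<in> carrier_mat n n"
  shows "sylvester_op A B (X - Y) = sylvester_op A B X - sylvester_op A B Y"
proof -
  have 1: "A * (X - Y) = A * X - A * Y" "(X - Y) * B = X * B - Y * B"
    using assms by (auto simp: mult_minus_distrib_mat minus_mult_distrib_mat)
  show ?thesis unfolding 1 by (rule eq_matI) (use assms in auto)
qed

lemma sylvester_op_carrier:
  assumes "A \<in> carrier_mat n n" "B \<in> carrier_mat n n" "X \<in> carrier_mat n n"
  shows "sylvester_op A B X \<in> carrier_mat n n"
  using assms by (intro minus_carrier_mat mult_carrier_mat)

lemma sylvester_op_smult:
  assumes "A \<in> carrier_mat n n" "B \<in> carrier_mat n n" "X \<in> carrier_mat n n"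
  shows "sylvester_op A B (a \<cdot>\<^sub>m X) = a \<cdot>\<^sub>m sylvester_op A B X"
  unfolding mult_smult_distrib[OF assms(1,3)] mult_smult_assoc_mat[OF assms(3,2)]
  by (rule eq_matI) (use assms in \<open>auto simp: algebra_simps\<close>)

text \<open>In the first nonzero column \<open>j\<close> of a solution \<open>X\<close> of \<open>A X = X B\<close>, let \<open>i\<close> be the row of the lowest
  nonzero entry. Triangularity removes every other term of entry \<open>(i, j)\<close> of both products and leaves
  \<open>A\<close>'s diagonal entry \<open>i\<close> equal to \<open>B\<close>'s diagonal entry \<open>j\<close>.\<close>

lemma sylvester_op_kernel:
  assumes T: "triangular_pair n A B" and X: "X \<in> carrier_mat n n"
    and eq: "sylvester_op A B X = 0\<^sub>m n n"
  shows "X = 0\<^sub>m n n"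
proof (rule ccontr)
  note [simp] = triangular_pairD(1,2)[OF T, THEN carrier_matD(1)]
    triangular_pairD(1,2)[OF T, THEN carrier_matD(2)] X[THEN carrier_matD(1)] X[THEN carrier_matD(2)]
  assume "X \<noteq> 0\<^sub>m n n"
  then obtain i0 j0 where "i0 < n" "j0 < n" "X $$ (i0, j0) \<noteq> 0"
    using eq_matI[of "0\<^sub>m n n" X] by force
  define j where "j = (LEAST j. j < n \<and> (\<exists>i<n. X $$ (i, j) \<noteq> 0))"
  have j: "j < n \<and> (\<exists>i<n. X $$ (i, j) \<noteq> 0)"
    unfolding j_def by (rule LeastI[of _ j0]) (use \<open>i0 < n\<close> \<open>j0 < n\<close> \<open>X $$ (i0, j0) \<noteq> 0\<close> in auto)
  have left: "X $$ (i, k) = 0" if "k < j" "i < n" for i k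
    using not_less_Least[OF that(1)[unfolded j_def]] that j by auto
  let ?P = "\<lambda>i. i < n \<and> X $$ (i, j) \<noteq> 0"
  define i where "i = (GREATEST i. ?P i)"
  have i: "?P i"
    unfolding i_def by (rule GreatestI_ex_nat[of ?P n]) (use j in auto)
  have below: "X $$ (k, j) = 0" if "i < k" "k < n" for k
    using Greatest_le_nat[of ?P k n] that unfolding i_def by auto
  have "(A * X) $$ (i, j) = (\<Sum>k\<in>{0..<n}. A $$ (i, k) * X $$ (k, j))"
    using i j by (simp add: scalar_prod_def)
  also have "\<dots> = (\<Sum>k\<in>{i}. A $$ (i, k) * X $$ (k, j))"
    by (rule sum.mono_neutral_right)
      (use i below upper_triangularD[OF triangular_pairD(3)[OF T], of _ i] in \<open>auto simp: neq_iff\<close>)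
  finally have 1: "(A * X) $$ (i, j) = A $$ (i, i) * X $$ (i, j)" by simp
  have "(X * B) $$ (i, j) = (\<Sum>k\<in>{0..<n}. X $$ (i, k) * B $$ (k, j))"
    using i j by (simp add: scalar_prod_def)
  also have "\<dots> = (\<Sum>k\<in>{j}. X $$ (i, k) * B $$ (k, j))"
    by (rule sum.mono_neutral_right)
      (use i j left upper_triangularD[OF triangular_pairD(4)[OF T], of j] in \<open>auto simp: neq_iff\<close>)
  finally have 2: "(X * B) $$ (i, j) = X $$ (i, j) * B $$ (j, j)" by simp
  have "sylvester_op A B X $$ (i, j) = 0" unfolding eq using i j by simp
  then have "A $$ (i, i) * X $$ (i, j) = X $$ (i, j) * B $$ (j, j)"
    using i j 1 2 by simp
  then show False using triangular_pairD(5)[OF T, of i j] i j by simp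
qed

lemma sylvester_op_inj:
  assumes T: "triangular_pair n A B" and X: "X \<in> carrier_mat n n" and Y: "Y \<in> carrier_mat n n"
    and eq: "sylvester_op A B X = sylvester_op A B Y"
  shows "X = Y"
proof -
  note AB = triangular_pairD(1,2)[OF T]
  have "sylvester_op A B (X - Y) = 0\<^sub>m n n"
    unfolding sylvester_op_diff[OF AB X Y] eq by (rule eq_matI) (use AB X Y in auto)
  from sylvester_op_kernel[OF T _ this] have "X - Y = 0\<^sub>m n n" using Y by (simp add: minus_carrier_mat)
  then have d: "(X - Y) $$ (i, j) = 0" if "i < n" "j < n" for i j using that by simp
  show ?thesis by (rule eq_matI) (use d X Y in auto)
qed

subsection \<open>Vectorisation\<close>

definition vec_mat :: "nat \<Rightarrow> 'a mat \<Rightarrow> 'a vec" where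
  "vec_mat n X = vec (n * n) (\<lambda>p. X $$ (p mod n, p div n))"

definition unvec_mat :: "nat \<Rightarrow> 'a vec \<Rightarrow> 'a mat" where
  "unvec_mat n v = mat n n (\<lambda>(i, j). v $ (j * n + i))"

lemma div_mod_less_square:
  assumes "p < n * n"
  shows "p div n < n" "p mod n < (n::nat)"
  using assms by (auto simp: less_mult_imp_div_less intro!: mod_less_divisor gr0I)

lemma pair_less_square:
  assumes "i < n" "j < n"
  shows "j * n + i < n * (n::nat)"
proof -
  have "j * n + i < Suc j * n" using assms by simp
  also have "\<dots> \<le> n * n" using assms by (intro mult_le_mono) auto
  finally show ?thesis .
qed

lemma sum_square:
  fixes f :: "nat \<Rightarrow> nat \<Rightarrow> 'b::comm_monoid_add"
  shows "(\<Sum>p<n * n. f (p mod n) (p div n)) = (\<Sum>i<n. \<Sum>j<n. f i j)"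
proof -
  have "(\<Sum>p<n * n. f (p mod n) (p div n)) = (\<Sum>(i, j)\<in>{..<n} \<times> {..<n}. f i j)"
    by (rule sum.reindex_bij_witness[of _ "\<lambda>(i, j). j * n + i" "\<lambda>p. (p mod n, p div n)"])
      (auto simp: div_mod_less_square pair_less_square)
  then show ?thesis by (simp add: sum.cartesian_product)
qed

lemma vec_mat_carrier [simp]: "vec_mat n X \<in> carrier_vec (n * n)"
  by (simp add: vec_mat_def)

lemma unvec_mat_carrier [simp]: "unvec_mat n v \<in> carrier_mat n n"
  by (simp add: unvec_mat_def)

lemma vec_unvec_mat:
  assumes "v \<in> carrier_vec (n * n)"
  shows "vec_mat n (unvec_mat n v) = v"
  by (rule eq_vecI) (use assms in \<open>auto simp: vec_mat_def unvec_mat_def div_mod_less_square\<close>)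

lemma unvec_vec_mat:
  assumes "X \<in> carrier_mat n n"
  shows "unvec_mat n (vec_mat n X) = X"
  by (rule eq_matI) (use assms in \<open>auto simp: vec_mat_def unvec_mat_def pair_less_square\<close>)

lemma vec_norm2_vec_mat:
  assumes "X \<in> carrier_mat n n"
  shows "vec_norm2 (vec_mat n X) = frob_norm X"
  using assms sum_square[of "\<lambda>i j. (norm (X $$ (i, j)))\<^sup>2" n]
  by (simp add: vec_norm2_def frob_norm_def vec_mat_def)

lemma sylvester_matrix_carrier:
  assumes "A \<in> carrier_mat n n" "B \<in> carrier_mat n n"
  shows "sylvester_matrix A B \<in> carrier_mat (n * n) (n * n)"
  using assms by (auto simp: sylvester_matrix_def kronecker_def)

lemma sylvester_matrix_index:
  assumes A: "A \<in> carrier_mat n n" and B: "B \<in> carrier_mat n n" and p: "p < n * n" and q: "q < n * n"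
  shows "sylvester_matrix A B $$ (p, q) =
    (if q div n = p div n then A $$ (p mod n, q mod n) else 0)
    - (if q mod n = p mod n then B $$ (q div n, p div n) else 0)"
  using assms div_mod_less_square[OF p] div_mod_less_square[OF q]
  by (auto simp: sylvester_matrix_def kronecker_def)

text \<open>Stacking columns is an isometry from the Frobenius to the Euclidean norm. Hence invertibility of
  the operator and its two extreme norms can be read off the Kronecker matrix.\<close>

lemma sylvester_matrix_mult_vec:
  assumes A: "A \<in> carrier_mat n n" and B: "B \<in> carrier_mat n n" and X: "X \<in> carrier_mat n n"
  shows "sylvester_matrix A B *\<^sub>v vec_mat n X = vec_mat n (sylvester_op A B X)"
proof (rule eq_vecI)
  note M = sylvester_matrix_carrier[OF A B]
  fix p assume "p < dim_vec (vec_mat n (sylvester_op A B X))"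
  then have p: "p < n * n" by (simp add: vec_mat_def)
  let ?i = "p mod n" and ?j = "p div n"
  have ij: "?i < n" "?j < n" using div_mod_less_square[OF p] by auto
  have "(sylvester_matrix A B *\<^sub>v vec_mat n X) $ p
      = (\<Sum>q<n * n. sylvester_matrix A B $$ (p, q) * X $$ (q mod n, q div n))"
    using M p by (simp add: scalar_prod_def vec_mat_def lessThan_atLeast0)
  also have "\<dots> = (\<Sum>q<n * n. ((if q div n = ?j then A $$ (?i, q mod n) else 0)
      - (if q mod n = ?i then B $$ (q div n, ?j) else 0)) * X $$ (q mod n, q div n))"
    by (intro sum.cong refl) (use p in \<open>simp add: sylvester_matrix_index[OF A B]\<close>)
  also have "\<dots> = (\<Sum>k<n. \<Sum>l<n. ((if l = ?j then A $$ (?i, k) else 0)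
      - (if k = ?i then B $$ (l, ?j) else 0)) * X $$ (k, l))"
    by (rule sum_square)
  also have "\<dots> = (\<Sum>k<n. \<Sum>l<n. (if l = ?j then A $$ (?i, k) * X $$ (k, l) else 0))
      - (\<Sum>k<n. \<Sum>l<n. (if k = ?i then X $$ (k, l) * B $$ (l, ?j) else 0))"
    unfolding sum_subtractf[symmetric] by (intro sum.cong refl) (simp add: algebra_simps)
  also have "(\<Sum>k<n. \<Sum>l<n. (if l = ?j then A $$ (?i, k) * X $$ (k, l) else 0))
      = (\<Sum>k<n. A $$ (?i, k) * X $$ (k, ?j))"
    using ij by simp
  also have "(\<Sum>k<n. \<Sum>l<n. (if k = ?i then X $$ (k, l) * B $$ (l, ?j) else 0))
      = (\<Sum>l<n. X $$ (?i, l) * B $$ (l, ?j))"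
    by (subst sum.swap) (use ij in simp)
  also have "(\<Sum>k<n. A $$ (?i, k) * X $$ (k, ?j)) - (\<Sum>l<n. X $$ (?i, l) * B $$ (l, ?j))
      = vec_mat n (sylvester_op A B X) $ p"
    using A B X p ij by (simp add: vec_mat_def scalar_prod_def lessThan_atLeast0)
  finally show "(sylvester_matrix A B *\<^sub>v vec_mat n X) $ p = vec_mat n (sylvester_op A B X) $ p" .
qed (use sylvester_matrix_carrier[OF A B] in \<open>simp add: vec_mat_def\<close>)

lemma sylvester_matrix_inverse:
  assumes T: "triangular_pair n A B"
  obtains N where "mat_inverse (sylvester_matrix A B) = Some N" "N \<in> carrier_mat (n * n) (n * n)"
    "sylvester_matrix A B * N = 1\<^sub>m (n * n)" "N * sylvester_matrix A B = 1\<^sub>m (n * n)"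
proof -
  note AB = triangular_pairD(1,2)[OF T]
  note M = sylvester_matrix_carrier[OF AB]
  have "det (sylvester_matrix A B) \<noteq> 0"
  proof
    assume "det (sylvester_matrix A B) = 0"
    then obtain v where v: "v \<in> carrier_vec (n * n)" "v \<noteq> 0\<^sub>v (n * n)"
        "sylvester_matrix A B *\<^sub>v v = 0\<^sub>v (n * n)"
      unfolding det_0_iff_vec_prod_zero_field[OF M] by auto
    define X where "X = unvec_mat n v"
    have X: "X \<in> carrier_mat n n" "vec_mat n X = v" using v by (auto simp: X_def vec_unvec_mat)
    have "vec_mat n (sylvester_op A B X) = 0\<^sub>v (n * n)"
      using sylvester_matrix_mult_vec[OF AB X(1)] X(2) v(3) by simp
    then have "sylvester_op A B X = unvec_mat n (0\<^sub>v (n * n))"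
      using unvec_vec_mat[OF sylvester_op_carrier[OF AB X(1)]] by simp
    also have "\<dots> = 0\<^sub>m n n"
      by (rule eq_matI) (auto simp: unvec_mat_def pair_less_square)
    finally have "X = 0\<^sub>m n n" by (rule sylvester_op_kernel[OF T X(1)])
    then have "v = vec_mat n (0\<^sub>m n n)" using X by simp
    also have "\<dots> = 0\<^sub>v (n * n)"
      by (rule eq_vecI) (auto simp: vec_mat_def div_mod_less_square)
    finally show False using v by simp
  qed
  then have "sylvester_matrix A B \<in> Units (ring_mat TYPE('a) (n * n) ())"
    by (rule det_non_zero_imp_unit[OF M])
  then obtain N where "mat_inverse (sylvester_matrix A B) = Some N"
    using mat_inverse(1)[OF M, where b = "()"] by (cases "mat_inverse (sylvester_matrix A B)") auto
  with mat_inverse(2)[OF M this] show thesis using that by blast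
qed

lemma sylvester_op_surj:
  assumes T: "triangular_pair n A B" and Y: "Y \<in> carrier_mat n n"
  obtains X where "X \<in> carrier_mat n n" "sylvester_op A B X = Y"
proof -
  note AB = triangular_pairD(1,2)[OF T]
  obtain N where N: "N \<in> carrier_mat (n * n) (n * n)" "sylvester_matrix A B * N = 1\<^sub>m (n * n)"
    using sylvester_matrix_inverse[OF T] by metis
  define X where "X = unvec_mat n (N *\<^sub>v vec_mat n Y)"
  have X: "X \<in> carrier_mat n n" "vec_mat n X = N *\<^sub>v vec_mat n Y"
    using N by (auto simp: X_def intro!: vec_unvec_mat mult_mat_vec_carrier)
  have "vec_mat n (sylvester_op A B X) = sylvester_matrix A B *\<^sub>v (N *\<^sub>v vec_mat n Y)"
    using sylvester_matrix_mult_vec[OF AB X(1)] X(2) by simp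
  also have "\<dots> = (sylvester_matrix A B * N) *\<^sub>v vec_mat n Y"
    by (rule assoc_mult_mat_vec[symmetric, OF sylvester_matrix_carrier[OF AB] N(1)]) simp
  also have "\<dots> = vec_mat n Y" using N by (simp add: one_mult_mat_vec[of _ "n * n"])
  finally have "vec_mat n (sylvester_op A B X) = vec_mat n Y" .
  then have "unvec_mat n (vec_mat n (sylvester_op A B X)) = unvec_mat n (vec_mat n Y)"
    by (rule arg_cong)
  then have "sylvester_op A B X = Y"
    by (simp only: unvec_vec_mat[OF sylvester_op_carrier[OF AB X(1)]] unvec_vec_mat[OF Y])
  with X(1) show thesis by (rule that)
qed

subsection \<open>Two-sided bounds of the operator\<close>

text \<open>The best constants are the norms of the inverse operator and of the operator, so that \<open>g * L\<close> is an
  upper bound of its condition number. The error analysis uses nothing else about the size of the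
  coefficients, and can therefore be specialised both to \<open>sep\<close> and to \<open>cond2\<close>.\<close>

definition sylvester_bounds :: "nat \<Rightarrow> 'a::real_normed_field mat \<Rightarrow> 'a mat \<Rightarrow> real \<Rightarrow> real \<Rightarrow> bool" where
  "sylvester_bounds n A B g L \<longleftrightarrow> (\<forall>X \<in> carrier_mat n n.
     frob_norm X \<le> g * frob_norm (sylvester_op A B X) \<and> frob_norm (sylvester_op A B X) \<le> L * frob_norm X)"

lemma sylvester_boundsD:
  assumes "sylvester_bounds n A B g L" "X \<in> carrier_mat n n"
  shows "frob_norm X \<le> g * frob_norm (sylvester_op A B X)"
    "frob_norm (sylvester_op A B X) \<le> L * frob_norm X"
  using assms by (auto simp: sylvester_bounds_def)

lemma exists_frob_norm_1:
  assumes "1 \<le> n"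
  obtains X :: "'a::real_normed_field mat" where "X \<in> carrier_mat n n" "frob_norm X = 1"
proof -
  let ?X = "mat n n (\<lambda>ij. if ij = (0, 0) then 1 else 0) :: 'a mat"
  have "(\<Sum>i<n. \<Sum>j<n. (norm (?X $$ (i, j)))\<^sup>2) = (\<Sum>i<n. \<Sum>j<n. if j = 0 then if i = 0 then 1 else 0 else 0)"
    by (intro sum.cong refl) auto
  also have "\<dots> = 1" using assms by simp
  finally have "frob_norm ?X = 1" by (simp add: frob_norm_def)
  then show thesis using that[of ?X] by simp
qed

lemma sylvester_bounds_pos:
  assumes b: "sylvester_bounds n A B g L" and n: "1 \<le> n"
  shows "0 < g" "0 < L" "1 \<le> g * L"
proof -
  obtain X :: "'a mat" where X: "X \<in> carrier_mat n n" "frob_norm X = 1"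
    using exists_frob_norm_1[OF n] .
  let ?t = "frob_norm (sylvester_op A B X)"
  have 1: "1 \<le> g * ?t" "?t \<le> L" using sylvester_boundsD[OF b X(1)] X(2) by auto
  have "0 < g * ?t" using 1 by linarith
  then show g: "0 < g" using frob_norm_nonneg[of "sylvester_op A B X"]
    by (auto simp: zero_less_mult_iff)
  show "0 < L" using \<open>0 < g * ?t\<close> g 1 by (simp add: zero_less_mult_iff)
  show "1 \<le> g * L" using 1 g mult_left_mono[of ?t L g] by linarith
qed

lemma vec_norm2_mult_le_op_norm2:
  assumes v: "v \<in> carrier_vec (dim_col M)"
  shows "vec_norm2 (M *\<^sub>v v) \<le> op_norm2 M * vec_norm2 v"
proof -
  have scale: "vec_norm2 (a \<cdot>\<^sub>v w) = norm a * vec_norm2 w" for a :: 'a and w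
    unfolding vec_norm2_L2_set by (auto simp: norm_mult L2_set_right_distrib intro!: L2_set_cong)
  show ?thesis
  proof (cases "vec_norm2 v = 0")
    case True
    then show ?thesis using vec_norm2_mult_mat_vec[of v M] v by auto
  next
    case False
    then have pos: "0 < vec_norm2 v" using vec_norm2_nonneg[of v] by linarith
    define a :: 'a where "a = of_real (1 / vec_norm2 v)"
    let ?S = "{vec_norm2 (M *\<^sub>v w) | w. w \<in> carrier_vec (dim_col M) \<and> vec_norm2 w = 1}"
    have "vec_norm2 (M *\<^sub>v (a \<cdot>\<^sub>v v)) \<in> ?S"
      using v pos by (auto simp: scale a_def norm_divide intro!: exI[of _ "a \<cdot>\<^sub>v v"])
    moreover have "bdd_above ?S"
    proof (rule bdd_aboveI[of _ "frob_norm M"])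
      fix x assume "x \<in> ?S"
      then obtain w where "x = vec_norm2 (M *\<^sub>v w)" "w \<in> carrier_vec (dim_col M)" "vec_norm2 w = 1"
        by blast
      then show "x \<le> frob_norm M" using vec_norm2_mult_mat_vec[of w M] by simp
    qed
    ultimately have "vec_norm2 (M *\<^sub>v (a \<cdot>\<^sub>v v)) \<le> op_norm2 M"
      unfolding op_norm2_def by (rule cSup_upper)
    moreover have "M *\<^sub>v (a \<cdot>\<^sub>v v) = a \<cdot>\<^sub>v (M *\<^sub>v v)"
      using mult_mat_vec[of M "dim_row M" "dim_col M" v a] v by auto
    ultimately show ?thesis using pos by (simp add: scale a_def norm_divide field_simps)
  qed
qed

lemma sylvester_bounds_op_norm2:
  assumes T: "triangular_pair n A B"
  shows "sylvester_bounds n A B (op_norm2 (the (mat_inverse (sylvester_matrix A B))))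
    (op_norm2 (sylvester_matrix A B))"
  unfolding sylvester_bounds_def
proof (intro ballI conjI)
  note AB = triangular_pairD(1,2)[OF T]
  let ?M = "sylvester_matrix A B"
  note M = sylvester_matrix_carrier[OF AB]
  obtain N where N: "mat_inverse ?M = Some N" "N \<in> carrier_mat (n * n) (n * n)"
    "?M * N = 1\<^sub>m (n * n)" "N * ?M = 1\<^sub>m (n * n)"
    using sylvester_matrix_inverse[OF T] by metis
  fix X :: "'a mat" assume X: "X \<in> carrier_mat n n"
  note S = sylvester_op_carrier[OF AB X]
  note MX = sylvester_matrix_mult_vec[OF AB X]
  have "N *\<^sub>v (?M *\<^sub>v vec_mat n X) = (N * ?M) *\<^sub>v vec_mat n X"
    by (rule assoc_mult_mat_vec[symmetric, OF N(2) M]) simp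
  then have "N *\<^sub>v vec_mat n (sylvester_op A B X) = vec_mat n X"
    using N(4) by (simp add: MX one_mult_mat_vec[of _ "n * n"])
  then show "frob_norm X \<le> op_norm2 (the (mat_inverse ?M)) * frob_norm (sylvester_op A B X)"
    using vec_norm2_mult_le_op_norm2[of "vec_mat n (sylvester_op A B X)" N] N(1,2)
    by (simp add: vec_norm2_vec_mat[OF X] vec_norm2_vec_mat[OF S])
  show "frob_norm (sylvester_op A B X) \<le> op_norm2 ?M * frob_norm X"
    using vec_norm2_mult_le_op_norm2[of "vec_mat n X" ?M] M
    by (simp add: MX vec_norm2_vec_mat[OF X] vec_norm2_vec_mat[OF S])
qed

text \<open>As an infimum, \<open>sep\<close> is a lower bound by homogeneity; that it does not vanish is seen from the
  finite norm of the inverse Kronecker matrix.\<close>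

lemma sylvester_bounds_sep:
  assumes T: "triangular_pair n A B" and n: "1 \<le> n"
  shows "sylvester_bounds n A B (1 / sep A B) (frob_norm A + frob_norm B)"
proof -
  note AB = triangular_pairD(1,2)[OF T]
  note ABd = AB[THEN carrier_matD(1)] AB[THEN carrier_matD(2)]
  let ?S = "{frob_norm (A * R - R * B) | R. R \<in> carrier_mat (dim_row A) (dim_row B) \<and> frob_norm R = 1}"
  obtain g L where gL: "sylvester_bounds n A B g L" using sylvester_bounds_op_norm2[OF T] by blast
  note pos = sylvester_bounds_pos[OF gL n]
  have "1 / g \<le> sep A B"
    unfolding sep_def
  proof (rule cInf_greatest)
    obtain X :: "'a mat" where X: "X \<in> carrier_mat n n" "frob_norm X = 1"
      using exists_frob_norm_1[OF n] .
    have "frob_norm (A * X - X * B) \<in> ?S"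
      unfolding mem_Collect_eq by (rule exI[of _ X]) (use ABd X in simp)
    then show "?S \<noteq> {}" by blast
    fix x assume "x \<in> ?S"
    then obtain R where R: "x = frob_norm (sylvester_op A B R)" "R \<in> carrier_mat n n" "frob_norm R = 1"
      using ABd by auto
    show "1 / g \<le> x"
      using sylvester_boundsD(1)[OF gL R(2)] R pos by (simp add: field_simps)
  qed
  moreover have "0 < 1 / g" using pos by simp
  ultimately have sep: "0 < sep A B" by linarith
  have low: "sep A B * frob_norm X \<le> frob_norm (sylvester_op A B X)" if X: "X \<in> carrier_mat n n" for X
  proof (cases "frob_norm X = 0")
    case False
    then have fX: "0 < frob_norm X" using frob_norm_nonneg[of X] by linarith
    define a :: 'a where "a = of_real (1 / frob_norm X)"
    have "frob_norm (sylvester_op A B (a \<cdot>\<^sub>m X)) \<in> ?S"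
      using fX X ABd by (auto simp: frob_norm_smult a_def norm_divide intro!: exI[of _ "a \<cdot>\<^sub>m X"])
    moreover have "bdd_below ?S" by (rule bdd_belowI[of _ 0]) auto
    ultimately have "sep A B \<le> frob_norm (sylvester_op A B (a \<cdot>\<^sub>m X))"
      unfolding sep_def by (rule cInf_lower)
    then show ?thesis using fX
      by (simp add: sylvester_op_smult[OF AB X] frob_norm_smult a_def norm_divide field_simps)
  qed simp
  show ?thesis
    unfolding sylvester_bounds_def
  proof (intro ballI conjI)
    fix X :: "'a mat" assume X: "X \<in> carrier_mat n n"
    show "frob_norm X \<le> 1 / sep A B * frob_norm (sylvester_op A B X)"
      using low[OF X] sep by (simp add: field_simps)
    have "frob_norm (sylvester_op A B X) \<le> frob_norm (A * X) + frob_norm (X * B)"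
      by (rule frob_norm_diff[of _ n n]) (use AB X in auto)
    also have "\<dots> \<le> frob_norm A * frob_norm X + frob_norm X * frob_norm B"
      by (intro add_mono frob_norm_mult) (use ABd X in auto)
    finally show "frob_norm (sylvester_op A B X) \<le> (frob_norm A + frob_norm B) * frob_norm X"
      by (simp add: algebra_simps)
  qed
qed

subsection \<open>Diagonal blocks\<close>

lemma frob_norm_one: "frob_norm (1\<^sub>m h :: 'a::real_normed_field mat) \<le> real h"
  using frob_norm_le_dim[of "1\<^sub>m h :: 'a mat" h 1] by simp

lemma four_block_mat_eqD:
  assumes eq: "four_block_mat P Q S T = four_block_mat P' Q' S' T'"
    and c: "P \<in> carrier_mat h h" "Q \<in> carrier_mat h h" "S \<in> carrier_mat h h" "T \<in> carrier_mat h h"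
    and c': "P' \<in> carrier_mat h h" "Q' \<in> carrier_mat h h" "S' \<in> carrier_mat h h" "T' \<in> carrier_mat h h"
  shows "P = P'" "Q = Q'" "S = S'" "T = T'"
proof -
  have e: "four_block_mat P Q S T $$ (i, j) = four_block_mat P' Q' S' T' $$ (i, j)" for i j
    using eq by simp
  show "P = P'"
  proof (rule eq_matI)
    fix i j assume "i < dim_row P'" "j < dim_col P'"
    then show "P $$ (i, j) = P' $$ (i, j)" using c c' e[of i j] by auto
  qed (use c c' in auto)
  show "Q = Q'"
  proof (rule eq_matI)
    fix i j assume "i < dim_row Q'" "j < dim_col Q'"
    then show "Q $$ (i, j) = Q' $$ (i, j)" using c c' e[of i "j + h"] by auto
  qed (use c c' in auto)
  show "S = S'"
  proof (rule eq_matI)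
    fix i j assume "i < dim_row S'" "j < dim_col S'"
    then show "S $$ (i, j) = S' $$ (i, j)" using c c' e[of "i + h" j] by auto
  qed (use c c' in auto)
  show "T = T'"
  proof (rule eq_matI)
    fix i j assume "i < dim_row T'" "j < dim_col T'"
    then show "T $$ (i, j) = T' $$ (i, j)" using c c' e[of "i + h" "j + h"] by auto
  qed (use c c' in auto)
qed

lemma four_block_mat_cases:
  assumes "X \<in> carrier_mat (h + h) (h + h)"
  obtains P Q S T where "X = four_block_mat P Q S T"
    "P \<in> carrier_mat h h" "Q \<in> carrier_mat h h" "S \<in> carrier_mat h h" "T \<in> carrier_mat h h"
proof -
  obtain P Q S T where "split_block X h h = (P, Q, S, T)" by (metis prod_cases4)
  from split_block[OF this, of h h] assms show thesis using that by auto
qed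

locale split_pair =
  fixes h :: nat and A11 A12 A22 B11 B12 B22 :: "'a::real_normed_field mat"
  assumes h_pos: "0 < h"
    and carriers [simp]:
      "A11 \<in> carrier_mat h h" "A12 \<in> carrier_mat h h" "A22 \<in> carrier_mat h h"
      "B11 \<in> carrier_mat h h" "B12 \<in> carrier_mat h h" "B22 \<in> carrier_mat h h"
    and pair: "triangular_pair (h + h) (four_block_mat A11 A12 (0\<^sub>m h h) A22)
      (four_block_mat B11 B12 (0\<^sub>m h h) B22)"
begin

abbreviation "A \<equiv> four_block_mat A11 A12 (0\<^sub>m h h) A22"
abbreviation "B \<equiv> four_block_mat B11 B12 (0\<^sub>m h h) B22"

lemmas dims [simp] = carriers[THEN carrier_matD(1)] carriers[THEN carrier_matD(2)]

lemma diag_blocks: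
  "triangular_pair h A11 B11" "triangular_pair h A11 B22"
  "triangular_pair h A22 B11" "triangular_pair h A22 B22"
proof -
  have ut: "upper_triangular P" "upper_triangular S"
    if ut: "upper_triangular (four_block_mat P Q (0\<^sub>m h h) S)"
      and c: "P \<in> carrier_mat h h" "S \<in> carrier_mat h h" for P Q S :: "'a mat"
  proof -
    show "upper_triangular P"
    proof (rule upper_triangularI)
      fix i j assume "j < i" "i < dim_row P"
      then show "P $$ (i, j) = 0" using upper_triangularD[OF ut, of j i] c by auto
    qed
    show "upper_triangular S"
    proof (rule upper_triangularI)
      fix i j assume "j < i" "i < dim_row S"
      then show "S $$ (i, j) = 0" using upper_triangularD[OF ut, of "j + h" "i + h"] c by auto
    qed
  qed
  note pD = triangular_pairD[OF pair]
  have ne: "A $$ (i, i) \<noteq> B $$ (j, j)" if "i < h + h" "j < h + h" for i j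
    using pD(5) that by blast
  have "A11 $$ (i, i) \<noteq> B11 $$ (j, j)" "A11 $$ (i, i) \<noteq> B22 $$ (j, j)"
    "A22 $$ (i, i) \<noteq> B11 $$ (j, j)" "A22 $$ (i, i) \<noteq> B22 $$ (j, j)" if "i < h" "j < h" for i j
    using ne[of i j] ne[of i "j + h"] ne[of "i + h" j] ne[of "i + h" "j + h"] that by auto
  then show "triangular_pair h A11 B11" "triangular_pair h A11 B22"
      "triangular_pair h A22 B11" "triangular_pair h A22 B22"
    using ut[OF pD(3)] ut[OF pD(4)] by (auto simp: triangular_pair_def)
qed

lemma sylvester_op_blocks:
  assumes "X11 \<in> carrier_mat h h" "X12 \<in> carrier_mat h h" "X21 \<in> carrier_mat h h" "X22 \<in> carrier_mat h h"
  shows "sylvester_op A B (four_block_mat X11 X12 X21 X22) = four_block_mat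
    (A11 * X11 + A12 * X21 - X11 * B11) (A11 * X12 + A12 * X22 - (X11 * B12 + X12 * B22))
    (A22 * X21 - X21 * B11) (A22 * X22 - (X21 * B12 + X22 * B22))"
proof -
  have 1: "A * four_block_mat X11 X12 X21 X22 = four_block_mat (A11 * X11 + A12 * X21)
      (A11 * X12 + A12 * X22) (A22 * X21) (A22 * X22)"
    using assms by (subst mult_four_block_mat[of _ h h _ h _ h _ _ h _ h]) (auto simp: left_mult_zero_mat[of _ h])
  have 2: "four_block_mat X11 X12 X21 X22 * B = four_block_mat (X11 * B11) (X11 * B12 + X12 * B22)
      (X21 * B11) (X21 * B12 + X22 * B22)"
    using assms by (subst mult_four_block_mat[of _ h h _ h _ h _ _ h _ h]) (auto simp: right_mult_zero_mat[of _ h])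
  show ?thesis unfolding 1 2 by (rule eq_matI) (use assms in auto)
qed

lemma sylvester_op_blocks_eqD:
  assumes "X11 \<in> carrier_mat h h" "X12 \<in> carrier_mat h h" "X21 \<in> carrier_mat h h" "X22 \<in> carrier_mat h h"
    and "Y11 \<in> carrier_mat h h" "Y12 \<in> carrier_mat h h" "Y21 \<in> carrier_mat h h" "Y22 \<in> carrier_mat h h"
    and eq: "sylvester_op A B (four_block_mat X11 X12 X21 X22) = four_block_mat Y11 Y12 Y21 Y22"
  shows "sylvester_op A22 B11 X21 = Y21"
    "sylvester_op A11 B11 X11 = Y11 - A12 * X21"
    "sylvester_op A22 B22 X22 = Y22 + X21 * B12"
    "sylvester_op A11 B22 X12 = Y12 + X11 * B12 - A12 * X22"
proof -
  have c: "A11 * X11 + A12 * X21 - X11 * B11 \<in> carrier_mat h h"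
      "A11 * X12 + A12 * X22 - (X11 * B12 + X12 * B22) \<in> carrier_mat h h"
      "A22 * X21 - X21 * B11 \<in> carrier_mat h h"
      "A22 * X22 - (X21 * B12 + X22 * B22) \<in> carrier_mat h h"
    by (rule minus_carrier_mat add_carrier_mat; use assms in auto)+
  have "A11 * X11 + A12 * X21 - X11 * B11 = Y11"
      "A11 * X12 + A12 * X22 - (X11 * B12 + X12 * B22) = Y12"
      "A22 * X21 - X21 * B11 = Y21" "A22 * X22 - (X21 * B12 + X22 * B22) = Y22"
    using four_block_mat_eqD[OF eq[unfolded sylvester_op_blocks[OF assms(1-4)]] c assms(5-8)] by simp_all
  note e = this[symmetric]
  show "sylvester_op A22 B11 X21 = Y21" using e by simp
  show "sylvester_op A11 B11 X11 = Y11 - A12 * X21"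
    unfolding e(1) by (rule eq_matI) (use assms in auto)
  show "sylvester_op A22 B22 X22 = Y22 + X21 * B12"
    unfolding e(4) by (rule eq_matI) (use assms in auto)
  show "sylvester_op A11 B22 X12 = Y12 + X11 * B12 - A12 * X22"
    unfolding e(2) by (rule eq_matI) (use assms in auto)
qed

lemma solve_blocks:
  assumes b: "sylvester_bounds (h + h) A B g L"
    and Y: "Y11 \<in> carrier_mat h h" "Y12 \<in> carrier_mat h h" "Y21 \<in> carrier_mat h h" "Y22 \<in> carrier_mat h h"
  obtains X11 X12 X21 X22 where
    "X11 \<in> carrier_mat h h" "X12 \<in> carrier_mat h h" "X21 \<in> carrier_mat h h" "X22 \<in> carrier_mat h h"
    "sylvester_op A22 B11 X21 = Y21"
    "sylvester_op A11 B11 X11 = Y11 - A12 * X21"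
    "sylvester_op A22 B22 X22 = Y22 + X21 * B12"
    "sylvester_op A11 B22 X12 = Y12 + X11 * B12 - A12 * X22"
    "frob_norm (four_block_mat X11 X12 X21 X22) \<le> g * (frob_norm Y11 + frob_norm Y12 + frob_norm Y21 + frob_norm Y22)"
proof -
  obtain X where X: "X \<in> carrier_mat (h + h) (h + h)" and eq: "sylvester_op A B X = four_block_mat Y11 Y12 Y21 Y22"
    using sylvester_op_surj[OF pair, of "four_block_mat Y11 Y12 Y21 Y22"] Y by auto
  obtain X11 X12 X21 X22 where Xb: "X = four_block_mat X11 X12 X21 X22" and
    c: "X11 \<in> carrier_mat h h" "X12 \<in> carrier_mat h h" "X21 \<in> carrier_mat h h" "X22 \<in> carrier_mat h h"
    using four_block_mat_cases[OF X] .
  have g: "0 \<le> g" using sylvester_bounds_pos(1)[OF b] h_pos by simp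
  have "frob_norm X \<le> g * frob_norm (four_block_mat Y11 Y12 Y21 Y22)"
    using sylvester_boundsD(1)[OF b X] eq by simp
  also have "\<dots> \<le> g * (frob_norm Y11 + frob_norm Y12 + frob_norm Y21 + frob_norm Y22)"
    by (rule mult_left_mono[OF frob_norm_four_block_le g]) (use Y in auto)
  finally show thesis
    by (intro that[OF c sylvester_op_blocks_eqD[OF c Y eq[unfolded Xb]]]) (simp_all add: Xb)
qed

text \<open>In the order 21, then 11 and 22, then 12, the operator is block triangular and its diagonal blocks
  are the four small Sylvester operators. The inverse is block triangular too, with the inverses of the
  small operators on its diagonal, so no small inverse is larger than the whole one.\<close>

lemma bounds_blocks:
  assumes b: "sylvester_bounds (h + h) A B g L"
  shows "sylvester_bounds h A11 B11 g L" "sylvester_bounds h A11 B22 g L"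
    "sylvester_bounds h A22 B11 g L" "sylvester_bounds h A22 B22 g L"
proof -
  let ?O = "0\<^sub>m h h :: 'a mat"
  have O[simp]: "?O \<in> carrier_mat h h" by simp
  have z [simp]: "Z + ?O = Z" "?O + Z = Z" "Z - ?O = Z" "?O * Z = ?O" "Z * ?O = ?O"
    if "Z \<in> carrier_mat h h" for Z :: "'a mat"
    using that by (auto simp: right_add_zero_mat left_add_zero_mat)
  have z0: "Z = ?O" if "triangular_pair h P Q" "sylvester_op P Q Z = ?O" "Z \<in> carrier_mat h h" for P Q Z :: "'a mat"
    using sylvester_op_kernel[OF that(1,3,2)] .
  have op [simp]: "sylvester_op P Q X \<in> carrier_mat h h"
    if "P \<in> carrier_mat h h" "Q \<in> carrier_mat h h" "X \<in> carrier_mat h h" for P Q X :: "'a mat"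
    using that by auto
  note blk = frob_norm_block_le[of _ h _ h]
  \<comment> \<open>Lower bounds: a right-hand side supported in one block has a solution whose entry in that block
    solves the small equation, since the blocks solved for earlier vanish.\<close>
  have l21: "frob_norm X \<le> g * frob_norm (sylvester_op A22 B11 X)" if X: "X \<in> carrier_mat h h" for X
  proof -
    obtain X11 X12 X21 X22 where s: "X11 \<in> carrier_mat h h" "X12 \<in> carrier_mat h h"
        "X21 \<in> carrier_mat h h" "X22 \<in> carrier_mat h h"
        "sylvester_op A22 B11 X21 = sylvester_op A22 B11 X"
        "frob_norm (four_block_mat X11 X12 X21 X22) \<le> g * frob_norm (sylvester_op A22 B11 X)"
      by (rule solve_blocks[OF b O O op[OF carriers(3,4) X] O]) auto
    have "X21 = X" by (rule sylvester_op_inj[OF diag_blocks(3) s(3) X s(5)])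
    then show ?thesis using blk(3)[OF s(1-4)] s(6) by simp
  qed
  have l11: "frob_norm X \<le> g * frob_norm (sylvester_op A11 B11 X)" if X: "X \<in> carrier_mat h h" for X
  proof -
    obtain X11 X12 X21 X22 where s: "X11 \<in> carrier_mat h h" "X12 \<in> carrier_mat h h"
        "X21 \<in> carrier_mat h h" "X22 \<in> carrier_mat h h"
        "sylvester_op A22 B11 X21 = ?O"
        "sylvester_op A11 B11 X11 = sylvester_op A11 B11 X - A12 * X21"
        "frob_norm (four_block_mat X11 X12 X21 X22) \<le> g * frob_norm (sylvester_op A11 B11 X)"
      by (rule solve_blocks[OF b op[OF carriers(1,4) X] O O O]) auto
    have "X21 = ?O" by (rule z0[OF diag_blocks(3) s(5,3)])
    with s(6) have "sylvester_op A11 B11 X11 = sylvester_op A11 B11 X" using X by simp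
    then have "X11 = X" by (rule sylvester_op_inj[OF diag_blocks(1) s(1) X])
    then show ?thesis using blk(1)[OF s(1-4)] s(7) by simp
  qed
  have l22: "frob_norm X \<le> g * frob_norm (sylvester_op A22 B22 X)" if X: "X \<in> carrier_mat h h" for X
  proof -
    obtain X11 X12 X21 X22 where s: "X11 \<in> carrier_mat h h" "X12 \<in> carrier_mat h h"
        "X21 \<in> carrier_mat h h" "X22 \<in> carrier_mat h h"
        "sylvester_op A22 B11 X21 = ?O"
        "sylvester_op A22 B22 X22 = sylvester_op A22 B22 X + X21 * B12"
        "frob_norm (four_block_mat X11 X12 X21 X22) \<le> g * frob_norm (sylvester_op A22 B22 X)"
      by (rule solve_blocks[OF b O O O op[OF carriers(3,6) X]]) auto
    have "X21 = ?O" by (rule z0[OF diag_blocks(3) s(5,3)])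
    with s(6) have "sylvester_op A22 B22 X22 = sylvester_op A22 B22 X" using X by simp
    then have "X22 = X" by (rule sylvester_op_inj[OF diag_blocks(4) s(4) X])
    then show ?thesis using blk(4)[OF s(1-4)] s(7) by simp
  qed
  have l12: "frob_norm X \<le> g * frob_norm (sylvester_op A11 B22 X)" if X: "X \<in> carrier_mat h h" for X
  proof -
    obtain X11 X12 X21 X22 where s: "X11 \<in> carrier_mat h h" "X12 \<in> carrier_mat h h"
        "X21 \<in> carrier_mat h h" "X22 \<in> carrier_mat h h"
        "sylvester_op A22 B11 X21 = ?O"
        "sylvester_op A11 B11 X11 = ?O - A12 * X21"
        "sylvester_op A22 B22 X22 = ?O + X21 * B12"
        "sylvester_op A11 B22 X12 = sylvester_op A11 B22 X + X11 * B12 - A12 * X22"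
        "frob_norm (four_block_mat X11 X12 X21 X22) \<le> g * frob_norm (sylvester_op A11 B22 X)"
      by (rule solve_blocks[OF b O op[OF carriers(1,6) X] O O]) auto
    have 21: "X21 = ?O" by (rule z0[OF diag_blocks(3) s(5,3)])
    have 11: "X11 = ?O" by (rule z0[OF diag_blocks(1) _ s(1)]) (use s(6) 21 in simp)
    have 22: "X22 = ?O" by (rule z0[OF diag_blocks(4) _ s(4)]) (use s(7) 21 in simp)
    have "sylvester_op A11 B22 X12 = sylvester_op A11 B22 X" using s(8) 11 22 X by simp
    then have "X12 = X" by (rule sylvester_op_inj[OF diag_blocks(2) s(2) X])
    then show ?thesis using blk(2)[OF s(1-4)] s(9) by simp
  qed
  have up: "frob_norm (sylvester_op A B (four_block_mat X11 X12 X21 X22))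
      \<le> L * frob_norm (four_block_mat X11 X12 X21 X22)"
    if "X11 \<in> carrier_mat h h" "X12 \<in> carrier_mat h h" "X21 \<in> carrier_mat h h" "X22 \<in> carrier_mat h h"
    for X11 X12 X21 X22
    using sylvester_boundsD(2)[OF b] that by auto
  have fr: "frob_norm (four_block_mat X ?O ?O ?O) = frob_norm X"
    "frob_norm (four_block_mat ?O X ?O ?O) = frob_norm X"
    "frob_norm (four_block_mat ?O ?O X ?O) = frob_norm X"
    "frob_norm (four_block_mat ?O ?O ?O X) = frob_norm X" if X: "X \<in> carrier_mat h h" for X
    using frob_norm_four_block_le[OF X O O O] frob_norm_four_block_le[OF O X O O]
      frob_norm_four_block_le[OF O O X O] frob_norm_four_block_le[OF O O O X]
      blk(1)[OF X O O O] blk(2)[OF O X O O] blk(3)[OF O O X O] blk(4)[OF O O O X] by simp_all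
  have u: "frob_norm (sylvester_op A11 B11 X) \<le> L * frob_norm X"
    "frob_norm (sylvester_op A11 B22 X) \<le> L * frob_norm X"
    "frob_norm (sylvester_op A22 B11 X) \<le> L * frob_norm X"
    "frob_norm (sylvester_op A22 B22 X) \<le> L * frob_norm X" if X: "X \<in> carrier_mat h h" for X
  proof -
    note c = mult_carrier_mat[OF carriers(1) X] mult_carrier_mat[OF carriers(2) X]
      mult_carrier_mat[OF carriers(3) X] mult_carrier_mat[OF X carriers(4)]
      mult_carrier_mat[OF X carriers(5)] mult_carrier_mat[OF X carriers(6)]
    have "frob_norm (sylvester_op A11 B11 X) \<le> frob_norm (sylvester_op A B (four_block_mat X ?O ?O ?O))"
      unfolding sylvester_op_blocks[OF X O O O] using c X
      by (intro order_trans[OF _ blk(1)]) (auto intro!: minus_carrier_mat)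
    then show "frob_norm (sylvester_op A11 B11 X) \<le> L * frob_norm X"
      using up[OF X O O O] fr(1)[OF X] by simp
    have "frob_norm (sylvester_op A11 B22 X) \<le> frob_norm (sylvester_op A B (four_block_mat ?O X ?O ?O))"
      unfolding sylvester_op_blocks[OF O X O O] using c X
      by (intro order_trans[OF _ blk(2)]) (auto intro!: minus_carrier_mat)
    then show "frob_norm (sylvester_op A11 B22 X) \<le> L * frob_norm X"
      using up[OF O X O O] fr(2)[OF X] by simp
    have "frob_norm (sylvester_op A22 B11 X) \<le> frob_norm (sylvester_op A B (four_block_mat ?O ?O X ?O))"
      unfolding sylvester_op_blocks[OF O O X O] using c X
      by (intro order_trans[OF _ blk(3)]) (auto intro!: minus_carrier_mat)
    then show "frob_norm (sylvester_op A22 B11 X) \<le> L * frob_norm X"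
      using up[OF O O X O] fr(3)[OF X] by simp
    have "frob_norm (sylvester_op A22 B22 X) \<le> frob_norm (sylvester_op A B (four_block_mat ?O ?O ?O X))"
      unfolding sylvester_op_blocks[OF O O O X] using c X
      by (intro order_trans[OF _ blk(4)]) (auto intro!: minus_carrier_mat)
    then show "frob_norm (sylvester_op A22 B22 X) \<le> L * frob_norm X"
      using up[OF O O O X] fr(4)[OF X] by simp
  qed
  show "sylvester_bounds h A11 B11 g L" "sylvester_bounds h A11 B22 g L"
    "sylvester_bounds h A22 B11 g L" "sylvester_bounds h A22 B22 g L"
    unfolding sylvester_bounds_def using l11 l12 l21 l22 u by auto
qed

text \<open>Applied to the matrix whose only nonzero block is the identity in position 21, the operator yields
  \<open>A12\<close> and \<open>- B12\<close> as two of its blocks. Unlike the norms of \<open>A\<close> and \<open>B\<close>, the bound \<open>L\<close> does not change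
  when both are shifted by the same multiple of the identity. This is why the error can be bounded by
  \<open>cond2\<close>, which may be far smaller than the quotient of the norms by \<open>sep\<close>.\<close>

lemma off_diagonal_bound:
  assumes b: "sylvester_bounds (h + h) A B g L"
  shows "frob_norm A12 \<le> real h * L" "frob_norm B12 \<le> real h * L"
proof -
  let ?O = "0\<^sub>m h h :: 'a mat" and ?I = "1\<^sub>m h :: 'a mat"
  have c: "?O \<in> carrier_mat h h" "?I \<in> carrier_mat h h" by auto
  let ?J = "four_block_mat ?O ?O ?I ?O"
  have e: "sylvester_op A B ?J = four_block_mat A12 ?O (A22 - B11) (- B12)"
    unfolding sylvester_op_blocks[OF c(1,1,2,1)] by (rule cong_four_block_mat) auto
  have "frob_norm A12 \<le> frob_norm (sylvester_op A B ?J)" "frob_norm (- B12) \<le> frob_norm (sylvester_op A B ?J)"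
    unfolding e by (rule frob_norm_block_le[of _ h _ h]; auto)+
  moreover have "frob_norm (sylvester_op A B ?J) \<le> L * frob_norm ?J"
    by (rule sylvester_boundsD(2)[OF b]) auto
  moreover have "L * frob_norm ?J \<le> L * real h"
  proof -
    have "frob_norm ?J \<le> real h"
      using frob_norm_four_block_le[OF c(1,1,2,1)] frob_norm_one[of h, where 'a = 'a] by simp
    then show ?thesis using sylvester_bounds_pos(2)[OF b] h_pos by (intro mult_left_mono) auto
  qed
  ultimately show "frob_norm A12 \<le> real h * L" "frob_norm B12 \<le> real h * L"
    by (simp_all add: mult.commute)
qed

end

lemma triangular_pair_split:
  assumes T: "triangular_pair (h + h) A B" and h: "0 < h"
    and A: "split_block A h h = (A11, A12, A21, A22)" and B: "split_block B h h = (B11, B12, B21, B22)"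
  shows "split_pair h A11 A12 A22 B11 B12 B22"
    "A = four_block_mat A11 A12 (0\<^sub>m h h) A22" "B = four_block_mat B11 B12 (0\<^sub>m h h) B22"
proof -
  note AB = triangular_pairD[OF T]
  have sA: "A11 \<in> carrier_mat h h" "A12 \<in> carrier_mat h h" "A21 \<in> carrier_mat h h" "A22 \<in> carrier_mat h h"
      "A = four_block_mat A11 A12 A21 A22"
    by (rule split_block[OF A]; use AB in auto)+
  have sB: "B11 \<in> carrier_mat h h" "B12 \<in> carrier_mat h h" "B21 \<in> carrier_mat h h" "B22 \<in> carrier_mat h h"
      "B = four_block_mat B11 B12 B21 B22"
    by (rule split_block[OF B]; use AB in auto)+
  have "A21 = 0\<^sub>m h h"
  proof (rule eq_matI)
    fix i j assume "i < dim_row (0\<^sub>m h h)" "j < dim_col (0\<^sub>m h h)"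
    then have "A21 $$ (i, j) = A $$ (i + h, j)" "j < i + h" "i < h" "j < h"
      using A AB(1) by (auto simp: split_block_def Let_def)
    then show "A21 $$ (i, j) = 0\<^sub>m h h $$ (i, j)" using upper_triangularD[OF AB(3), of j "i + h"] AB(1) by auto
  qed (use sA in auto)
  moreover have "B21 = 0\<^sub>m h h"
  proof (rule eq_matI)
    fix i j assume "i < dim_row (0\<^sub>m h h)" "j < dim_col (0\<^sub>m h h)"
    then have "B21 $$ (i, j) = B $$ (i + h, j)" "j < i + h" "i < h" "j < h"
      using B AB(2) by (auto simp: split_block_def Let_def)
    then show "B21 $$ (i, j) = 0\<^sub>m h h $$ (i, j)" using upper_triangularD[OF AB(4), of j "i + h"] AB(2) by auto
  qed (use sB in auto)
  ultimately show eqs: "A = four_block_mat A11 A12 (0\<^sub>m h h) A22" "B = four_block_mat B11 B12 (0\<^sub>m h h) B22"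
    using sA sB by auto
  show "split_pair h A11 A12 A22 B11 B12 B22"
    by unfold_locales (use sA sB T eqs h in auto)
qed

section \<open>Estimates to leading order in the machine epsilon\<close>

text \<open>The estimate \<open>f \<le> c \<epsilon>\<^sup>p r + O(\<epsilon>\<^sup>p\<^sup>+\<^sup>1)\<close> as \<open>\<epsilon>\<close> decreases to 0. Sizes of computed matrices are
  estimated with \<open>p = 0\<close>, errors with \<open>p = 1\<close>, both relative to the norm \<open>r\<close> of the exact solution.\<close>

definition leading_le :: "nat \<Rightarrow> (real \<Rightarrow> real) \<Rightarrow> (real \<Rightarrow> real) \<Rightarrow> real \<Rightarrow> bool" where
  "leading_le p r f c \<longleftrightarrow>
     (\<exists>K. \<forall>\<^sub>F \<epsilon> in at_right 0. f \<epsilon> \<le> c * \<epsilon> ^ p * r \<epsilon> + K * \<epsilon> ^ Suc p)"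

lemma eventually_at_right_pos: "\<forall>\<^sub>F \<epsilon> in at_right 0. 0 < \<epsilon> \<and> \<epsilon> < (1/2 :: real)"
  unfolding eventually_at_right_field by (intro exI[of _ "1/2"]) auto

lemma leading_leI:
  assumes "\<forall>\<^sub>F \<epsilon> in at_right 0. f \<epsilon> \<le> c * \<epsilon> ^ p * r \<epsilon> + K * \<epsilon> ^ Suc p"
  shows "leading_le p r f c"
  using assms unfolding leading_le_def by blast

lemma leading_le_exact:
  assumes "\<And>\<epsilon>. f \<epsilon> \<le> c * r \<epsilon>"
  shows "leading_le 0 r f c"
  by (rule leading_leI[of _ _ _ _ 0]) (use assms in simp)

lemma leading_le_mono:
  assumes f: "leading_le p r f c" and le: "\<forall>\<^sub>F \<epsilon> in at_right 0. f' \<epsilon> \<le> f \<epsilon>"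
    and c: "c \<le> c'" and r: "\<And>\<epsilon>. 0 \<le> r \<epsilon>"
  shows "leading_le p r f' c'"
proof -
  obtain K where "\<forall>\<^sub>F \<epsilon> in at_right 0. f \<epsilon> \<le> c * \<epsilon> ^ p * r \<epsilon> + K * \<epsilon> ^ Suc p"
    using f by (auto simp: leading_le_def)
  then have "\<forall>\<^sub>F \<epsilon> in at_right 0. f' \<epsilon> \<le> c' * \<epsilon> ^ p * r \<epsilon> + K * \<epsilon> ^ Suc p"
    using le eventually_at_right_pos
  proof eventually_elim
    case (elim \<epsilon>)
    have "c * \<epsilon> ^ p * r \<epsilon> \<le> c' * \<epsilon> ^ p * r \<epsilon>"
      using elim c r[of \<epsilon>] by (intro mult_right_mono) auto
    then show ?case using elim by linarith
  qed
  then show ?thesis by (rule leading_leI)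
qed

lemma leading_le_add:
  assumes "leading_le p r f c" "leading_le p r f' c'"
  shows "leading_le p r (\<lambda>\<epsilon>. f \<epsilon> + f' \<epsilon>) (c + c')"
proof -
  obtain K where 1: "\<forall>\<^sub>F \<epsilon> in at_right 0. f \<epsilon> \<le> c * \<epsilon> ^ p * r \<epsilon> + K * \<epsilon> ^ Suc p"
    using assms by (auto simp: leading_le_def)
  obtain K' where 2: "\<forall>\<^sub>F \<epsilon> in at_right 0. f' \<epsilon> \<le> c' * \<epsilon> ^ p * r \<epsilon> + K' * \<epsilon> ^ Suc p"
    using assms by (auto simp: leading_le_def)
  from 1 2 show ?thesis
    by (intro leading_leI[of _ _ _ _ "K + K'"], eventually_elim) (simp add: algebra_simps)
qed

lemma leading_le_scale:
  assumes "leading_le p r f c" "0 \<le> d"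
  shows "leading_le p r (\<lambda>\<epsilon>. d * f \<epsilon>) (d * c)"
proof -
  obtain K where 1: "\<forall>\<^sub>F \<epsilon> in at_right 0. f \<epsilon> \<le> c * \<epsilon> ^ p * r \<epsilon> + K * \<epsilon> ^ Suc p"
    using assms by (auto simp: leading_le_def)
  then show ?thesis
  proof (intro leading_leI[of _ _ _ _ "d * K"], eventually_elim)
    case (elim \<epsilon>)
    show ?case using mult_left_mono[OF elim(2) \<open>0 \<le> d\<close>] by (simp add: algebra_simps)
  qed
qed

lemma leading_le_eps:
  assumes "leading_le p r f c"
  shows "leading_le (Suc p) r (\<lambda>\<epsilon>. \<epsilon> * f \<epsilon>) c"
proof -
  obtain K where 1: "\<forall>\<^sub>F \<epsilon> in at_right 0. f \<epsilon> \<le> c * \<epsilon> ^ p * r \<epsilon> + K * \<epsilon> ^ Suc p"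
    using assms by (auto simp: leading_le_def)
  then show ?thesis using eventually_at_right_pos
  proof (intro leading_leI[of _ _ _ _ K], eventually_elim)
    case (elim \<epsilon>)
    have "\<epsilon> * f \<epsilon> \<le> \<epsilon> * (c * \<epsilon> ^ p * r \<epsilon> + K * \<epsilon> ^ Suc p)"
      using elim by (intro mult_left_mono) auto
    then show ?case by (simp add: algebra_simps)
  qed
qed

text \<open>Errors are invisible to leading order in estimates of size: a computed matrix may be replaced by
  the exact one whenever another factor \<open>\<epsilon>\<close> is present.\<close>

lemma leading_le_drop:
  assumes "leading_le 1 r f c" and b: "\<forall>\<^sub>F \<epsilon> in at_right 0. r \<epsilon> \<le> b" and r: "\<And>\<epsilon>. 0 \<le> r \<epsilon>"
  shows "leading_le 0 r f 0"
proof -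
  obtain K where 1: "\<forall>\<^sub>F \<epsilon> in at_right 0. f \<epsilon> \<le> c * \<epsilon> * r \<epsilon> + K * \<epsilon>\<^sup>2"
    using assms by (auto simp: leading_le_def power2_eq_square)
  then show ?thesis using b eventually_at_right_pos
  proof (intro leading_leI[of _ _ _ _ "\<bar>c\<bar> * b + \<bar>K\<bar>"], eventually_elim)
    case (elim \<epsilon>)
    have "c * \<epsilon> * r \<epsilon> \<le> \<bar>c\<bar> * \<epsilon> * b"
      using elim r[of \<epsilon>] by (intro mult_mono) auto
    moreover have "K * \<epsilon>\<^sup>2 \<le> \<bar>K\<bar> * \<epsilon>"
    proof (rule mult_mono)
      show "\<epsilon>\<^sup>2 \<le> \<epsilon>"
        unfolding power2_eq_square using elim by (intro mult_left_le) auto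
    qed auto
    ultimately have "f \<epsilon> \<le> \<bar>c\<bar> * \<epsilon> * b + \<bar>K\<bar> * \<epsilon>" using elim by linarith
    then show ?case by (simp add: algebra_simps)
  qed
qed

text \<open>Converts an estimate relative to \<open>s\<close>, the solution of a perturbed equation, into one relative to \<open>r\<close>.\<close>

lemma leading_le_trans:
  assumes f: "leading_le p s f c" and s: "leading_le 0 r s d" and "0 \<le> c"
  shows "leading_le p r f (c * d)"
proof -
  obtain K where 1: "\<forall>\<^sub>F \<epsilon> in at_right 0. f \<epsilon> \<le> c * \<epsilon> ^ p * s \<epsilon> + K * \<epsilon> ^ Suc p"
    using f by (auto simp: leading_le_def)
  obtain K' where 2: "\<forall>\<^sub>F \<epsilon> in at_right 0. s \<epsilon> \<le> d * r \<epsilon> + K' * \<epsilon>"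
    using s by (auto simp: leading_le_def)
  from 1 2 eventually_at_right_pos show ?thesis
  proof (intro leading_leI[of _ _ _ _ "c * K' + K"], eventually_elim)
    case (elim \<epsilon>)
    have "c * \<epsilon> ^ p * s \<epsilon> \<le> c * \<epsilon> ^ p * (d * r \<epsilon> + K' * \<epsilon>)"
      using elim \<open>0 \<le> c\<close> by (intro mult_left_mono) auto
    then show ?case using elim by (simp add: algebra_simps)
  qed
qed

lemma leading_le_bounded:
  assumes "leading_le 0 r f c" and b: "\<forall>\<^sub>F \<epsilon> in at_right 0. r \<epsilon> \<le> b" and r: "\<And>\<epsilon>. 0 \<le> r \<epsilon>"
  obtains b' where "\<forall>\<^sub>F \<epsilon> in at_right 0. f \<epsilon> \<le> b'"
proof -
  obtain K where 1: "\<forall>\<^sub>F \<epsilon> in at_right 0. f \<epsilon> \<le> c * r \<epsilon> + K * \<epsilon>"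
    using assms by (auto simp: leading_le_def)
  then have "\<forall>\<^sub>F \<epsilon> in at_right 0. f \<epsilon> \<le> \<bar>c\<bar> * b + \<bar>K\<bar>" using b eventually_at_right_pos
  proof eventually_elim
    case (elim \<epsilon>)
    have "c * r \<epsilon> \<le> \<bar>c\<bar> * b" using elim r[of \<epsilon>] by (intro mult_mono) auto
    moreover have "K * \<epsilon> \<le> \<bar>K\<bar> * 1" using elim by (intro mult_mono) auto
    ultimately show ?case using elim by linarith
  qed
  then show thesis by (rule that)
qed

section \<open>Rounding errors of the matrix operations\<close>

lemma fst_madd_carrier: "X \<in> carrier_mat m n \<Longrightarrow> fst (madd F X Y) \<in> carrier_mat m n"
  by (auto simp: madd_def)

lemma fst_msub_carrier: "X \<in> carrier_mat m n \<Longrightarrow> fst (msub F X Y) \<in> carrier_mat m n"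
  by (auto simp: msub_def)

lemma madd_error:
  assumes F: "fp_arithmetic \<epsilon> F" and e: "0 \<le> \<epsilon>" and X: "X \<in> carrier_mat m n" and Y: "Y \<in> carrier_mat m n"
  shows "frob_norm (fst (madd F X Y) - (X + Y)) \<le> \<epsilon> * frob_norm (X + Y)"
proof (rule frob_norm_mono)
  fix i j assume "i < m" "j < n"
  obtain \<delta> where d: "norm \<delta> \<le> \<epsilon>" "fadd F (X $$ (i, j)) (Y $$ (i, j)) = (X $$ (i, j) + Y $$ (i, j)) * (1 + \<delta>)"
    using F unfolding fp_arithmetic_def by blast
  have "(fst (madd F X Y) - (X + Y)) $$ (i, j) = (X + Y) $$ (i, j) * \<delta>"
    using \<open>i < m\<close> \<open>j < n\<close> X Y d(2) by (simp add: madd_def algebra_simps)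
  then show "norm ((fst (madd F X Y) - (X + Y)) $$ (i, j)) \<le> \<epsilon> * norm ((X + Y) $$ (i, j))"
    using mult_right_mono[OF d(1), of "norm ((X + Y) $$ (i, j))"] by (simp add: norm_mult mult.commute)
qed (use X Y e in \<open>auto intro!: minus_carrier_mat\<close>)

lemma msub_error:
  assumes F: "fp_arithmetic \<epsilon> F" and e: "0 \<le> \<epsilon>" and X: "X \<in> carrier_mat m n" and Y: "Y \<in> carrier_mat m n"
  shows "frob_norm (fst (msub F X Y) - (X - Y)) \<le> \<epsilon> * frob_norm (X - Y)"
proof (rule frob_norm_mono)
  fix i j assume "i < m" "j < n"
  obtain \<delta> where d: "norm \<delta> \<le> \<epsilon>" "fsub F (X $$ (i, j)) (Y $$ (i, j)) = (X $$ (i, j) - Y $$ (i, j)) * (1 + \<delta>)"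
    using F unfolding fp_arithmetic_def by blast
  have "(fst (msub F X Y) - (X - Y)) $$ (i, j) = (X - Y) $$ (i, j) * \<delta>"
    using \<open>i < m\<close> \<open>j < n\<close> X Y d(2) by (simp add: msub_def algebra_simps)
  then show "norm ((fst (msub F X Y) - (X - Y)) $$ (i, j)) \<le> \<epsilon> * norm ((X - Y) $$ (i, j))"
    using mult_right_mono[OF d(1), of "norm ((X - Y) $$ (i, j))"] by (simp add: norm_mult mult.commute)
qed (use X Y e in \<open>auto intro!: minus_carrier_mat\<close>)

lemma mm_error:
  assumes st: "stable_mm ar \<mu>" and h: "1 \<le> h"
    and r: "\<And>\<epsilon>. 0 \<le> r \<epsilon>" and b: "\<forall>\<^sub>F \<epsilon> in at_right 0. r \<epsilon> \<le> b"
    and X: "\<And>\<epsilon>. X \<epsilon> \<in> carrier_mat h h" and Y: "\<And>\<epsilon>. Y \<epsilon> \<in> carrier_mat h h"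
    and Xb: "\<forall>\<^sub>F \<epsilon> in at_right 0. frob_norm (X \<epsilon>) \<le> b'" and Yb: "\<forall>\<^sub>F \<epsilon> in at_right 0. frob_norm (Y \<epsilon>) \<le> b'"
    and XY: "leading_le 0 r (\<lambda>\<epsilon>. frob_norm (X \<epsilon>) * frob_norm (Y \<epsilon>)) c"
  shows "\<forall>\<^sub>F \<epsilon> in at_right 0. fst (mm (ar \<epsilon>) (X \<epsilon>) (Y \<epsilon>)) \<in> carrier_mat h h"
    and "leading_le 1 r (\<lambda>\<epsilon>. frob_norm (fst (mm (ar \<epsilon>) (X \<epsilon>) (Y \<epsilon>)) - X \<epsilon> * Y \<epsilon>)) (\<mu> h * c)"
proof -
  have mu: "1 \<le> \<mu> h" using st by (simp add: stable_mm_def)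
  obtain K where K: "\<forall>\<^sub>F \<epsilon> in at_right 0. \<forall>X \<in> carrier_mat h h. \<forall>Y \<in> carrier_mat h h.
        frob_norm X \<le> b' \<longrightarrow> frob_norm Y \<le> b' \<longrightarrow>
        fst (mm (ar \<epsilon>) X Y) \<in> carrier_mat h h \<and>
        frob_norm (fst (mm (ar \<epsilon>) X Y) - X * Y) \<le> \<mu> h * \<epsilon> * frob_norm X * frob_norm Y + K * \<epsilon>\<^sup>2"
    using st h unfolding stable_mm_def by blast
  have ev: "\<forall>\<^sub>F \<epsilon> in at_right 0. fst (mm (ar \<epsilon>) (X \<epsilon>) (Y \<epsilon>)) \<in> carrier_mat h h \<and>
     frob_norm (fst (mm (ar \<epsilon>) (X \<epsilon>) (Y \<epsilon>)) - X \<epsilon> * Y \<epsilon>)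
       \<le> \<mu> h * \<epsilon> * frob_norm (X \<epsilon>) * frob_norm (Y \<epsilon>) + K * \<epsilon>\<^sup>2"
    using K Xb Yb by eventually_elim (use X Y in blast)
  then show "\<forall>\<^sub>F \<epsilon> in at_right 0. fst (mm (ar \<epsilon>) (X \<epsilon>) (Y \<epsilon>)) \<in> carrier_mat h h"
    by eventually_elim simp
  have "leading_le 1 r (\<lambda>\<epsilon>. \<mu> h * (\<epsilon> * (frob_norm (X \<epsilon>) * frob_norm (Y \<epsilon>)))) (\<mu> h * c)"
    using leading_le_scale[OF leading_le_eps[OF XY], of "\<mu> h"] mu by simp
  moreover have "leading_le 1 r (\<lambda>\<epsilon>. K * \<epsilon>\<^sup>2) 0"
    by (rule leading_leI[of _ _ _ _ K]) (simp add: power2_eq_square)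
  ultimately have "leading_le 1 r (\<lambda>\<epsilon>. \<mu> h * (\<epsilon> * (frob_norm (X \<epsilon>) * frob_norm (Y \<epsilon>))) + K * \<epsilon>\<^sup>2) (\<mu> h * c + 0)"
    by (rule leading_le_add)
  then show "leading_le 1 r (\<lambda>\<epsilon>. frob_norm (fst (mm (ar \<epsilon>) (X \<epsilon>) (Y \<epsilon>)) - X \<epsilon> * Y \<epsilon>)) (\<mu> h * c)"
    by (rule leading_le_mono) (use ev r in \<open>auto elim!: eventually_mono simp: algebra_simps\<close>)
qed

section \<open>Unfolding the algorithm\<close>

lemma fst_SylR_1:
  "fst (SylR F 1 A B C) = mat 1 1 (\<lambda>_. fdiv F (- C $$ (0, 0)) (fsub F (A $$ (0, 0)) (B $$ (0, 0))))"
  by (subst SylR.simps) simp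

lemma snd_SylR_1: "snd (SylR F 1 A B C) = 3"
  by (subst SylR.simps) simp

lemma SylR_blocks:
  fixes F :: "'a::real_normed_field arith"
  assumes h: "0 < h" and A: "split_block A h h = (A11, A12, A21, A22)"
    and B: "split_block B h h = (B11, B12, B21, B22)" and C: "split_block C h h = (C11, C12, C21, C22)"
  defines "S21 \<equiv> SylR F h A22 B11 C21"
  defines "P1 \<equiv> mm F A12 (fst S21)"
  defines "D11 \<equiv> madd F C11 (fst P1)"
  defines "S11 \<equiv> SylR F h A11 B11 (fst D11)"
  defines "P2 \<equiv> mm F (fst S21) B12"
  defines "D22 \<equiv> msub F C22 (fst P2)"
  defines "S22 \<equiv> SylR F h A22 B22 (fst D22)"
  defines "P3 \<equiv> mm F (fst S11) B12"
  defines "P4 \<equiv> mm F A12 (fst S22)"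
  defines "S \<equiv> msub F C12 (fst P3)"
  defines "D12 \<equiv> madd F (fst S) (fst P4)"
  defines "S12 \<equiv> SylR F h A11 B22 (fst D12)"
  shows "SylR F (h + h) A B C = (four_block_mat (fst S11) (fst S12) (fst S21) (fst S22),
    snd S21 + snd P1 + snd D11 + snd S11 + snd P2 + snd D22 + snd S22 + snd P3 + snd P4 + snd S + snd D12 + snd S12)"
proof -
  have "(h + h) div 2 = h" "\<not> h + h \<le> 1" using h by auto
  then show ?thesis
    by (subst SylR.simps)
      (simp add: A B C Let_def case_prod_unfold S21_def P1_def D11_def S11_def P2_def D22_def S22_def
        P3_def P4_def S_def D12_def S12_def)
qed

lemma fst_SylR_carrier: "fst (SylR F (2 ^ k) A B C) \<in> carrier_mat (2 ^ k) (2 ^ k)"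
proof (induction k arbitrary: A B C)
  case 0
  then show ?case by (simp add: fst_SylR_1[simplified])
next
  case (Suc k)
  let ?h = "2 ^ k :: nat"
  obtain A11 A12 A21 A22 where A: "split_block A ?h ?h = (A11, A12, A21, A22)" by (metis prod_cases4)
  obtain B11 B12 B21 B22 where B: "split_block B ?h ?h = (B11, B12, B21, B22)" by (metis prod_cases4)
  obtain C11 C12 C21 C22 where C: "split_block C ?h ?h = (C11, C12, C21, C22)" by (metis prod_cases4)
  have hh: "(2::nat) ^ Suc k = ?h + ?h" by simp
  show ?case
    unfolding hh SylR_blocks[OF zero_less_power[OF zero_less_numeral] A B C] fst_conv
    by (rule four_block_carrier_mat) (rule Suc.IH)+
qed

section \<open>Operation count\<close>

text \<open>Four recursive calls, four products and four sums of half the size give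
  \<open>T(2h) \<le> 4 T(h) + 4 (\<bar>c\<bar> + 1) h\<^sup>\<gamma>\<close>. The second condition on \<open>K\<close> makes \<open>4 K + 4 (\<bar>c\<bar> + 1) \<le> K 2\<^sup>\<gamma>\<close>,
  which is possible because \<open>\<gamma> > 2\<close>.\<close>

lemma SylR_cost:
  fixes F :: "'a::real_normed_field arith"
  assumes F: "mm_cost_bound F c \<gamma>" and \<gamma>: "2 < \<gamma>"
    and K: "3 \<le> K" "(4 * \<bar>c\<bar> + 4) / (2 powr \<gamma> - 4) \<le> K"
    and "A \<in> carrier_mat (2 ^ k) (2 ^ k)" "B \<in> carrier_mat (2 ^ k) (2 ^ k)" "C \<in> carrier_mat (2 ^ k) (2 ^ k)"
  shows "real (snd (SylR F (2 ^ k) A B C)) \<le> K * real (2 ^ k) powr \<gamma>"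
  using assms(5-)
proof (induction k arbitrary: A B C)
  case 0
  then show ?case using K by (simp add: snd_SylR_1[simplified])
next
  case (Suc k)
  let ?h = "2 ^ k :: nat"
  have hh: "(2::nat) ^ Suc k = ?h + ?h" by simp
  obtain A11 A12 A21 A22 where A: "split_block A ?h ?h = (A11, A12, A21, A22)" by (metis prod_cases4)
  obtain B11 B12 B21 B22 where B: "split_block B ?h ?h = (B11, B12, B21, B22)" by (metis prod_cases4)
  obtain C11 C12 C21 C22 where C: "split_block C ?h ?h = (C11, C12, C21, C22)" by (metis prod_cases4)
  note cA = split_block(1-4)[OF A, of ?h ?h] and cB = split_block(1-4)[OF B, of ?h ?h]
    and cC = split_block(1-4)[OF C, of ?h ?h]
  have c: "A11 \<in> carrier_mat ?h ?h" "A12 \<in> carrier_mat ?h ?h" "A22 \<in> carrier_mat ?h ?h"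
    "B11 \<in> carrier_mat ?h ?h" "B12 \<in> carrier_mat ?h ?h" "B22 \<in> carrier_mat ?h ?h"
    "C11 \<in> carrier_mat ?h ?h" "C12 \<in> carrier_mat ?h ?h" "C21 \<in> carrier_mat ?h ?h" "C22 \<in> carrier_mat ?h ?h"
    using cA cB cC Suc.prems by auto
  let ?t = "real ?h powr \<gamma>"
  have sq: "real (?h * ?h) \<le> ?t"
  proof -
    have "real (?h * ?h) = real ?h powr 2" by (simp add: power2_eq_square)
    also have "\<dots> \<le> ?t" using \<gamma> by (intro powr_mono) auto
    finally show ?thesis .
  qed
  have mmb: "real (snd (mm F X Y)) \<le> \<bar>c\<bar> * ?t" if "X \<in> carrier_mat ?h ?h" "Y \<in> carrier_mat ?h ?h" for X Y :: "'a mat"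
  proof -
    have "1 \<le> ?h" by simp
    from F[unfolded mm_cost_bound_def, rule_format, OF this that]
    have "real (snd (mm F X Y)) \<le> c * ?t" by blast
    also have "\<dots> \<le> \<bar>c\<bar> * ?t" by (intro mult_right_mono) auto
    finally show ?thesis .
  qed
  have maddb: "real (snd (madd F X Y)) \<le> ?t" if "X \<in> carrier_mat ?h ?h" for X Y :: "'a mat"
    using sq that by (simp add: madd_def)
  have msubb: "real (snd (msub F X Y)) \<le> ?t" if "X \<in> carrier_mat ?h ?h" for X Y :: "'a mat"
    using sq that by (simp add: msub_def)
  have "real (snd (SylR F (?h + ?h) A B C)) \<le> 4 * (K * ?t) + 4 * (\<bar>c\<bar> * ?t) + 4 * ?t"
    unfolding SylR_blocks[OF zero_less_power[OF zero_less_numeral] A B C, of F] snd_conv of_nat_add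
    by (smt (verit) c Suc.IH mmb maddb msubb fst_SylR_carrier fst_madd_carrier fst_msub_carrier)
  also have "\<dots> = (4 * K + (4 * \<bar>c\<bar> + 4)) * ?t" by (simp add: algebra_simps)
  also have "\<dots> \<le> (K * 2 powr \<gamma>) * ?t"
  proof (intro mult_right_mono)
    have "(4::real) = 2 powr 2" by simp
    also have "\<dots> < 2 powr \<gamma>" using \<gamma> by (intro powr_less_mono) auto
    finally show "4 * K + (4 * \<bar>c\<bar> + 4) \<le> K * 2 powr \<gamma>"
      using K(2) by (simp add: field_simps)
  qed simp
  also have "\<dots> = K * real (2 ^ Suc k) powr \<gamma>" by (simp add: powr_mult)
  finally show ?case unfolding hh .
qed

section \<open>Error analysis of the recursion\<close>

text \<open>The data is a family indexed by the machine epsilon, because the right-hand sides that reach the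
  recursive calls carry rounding errors. For a bounded family the \<open>O(\<epsilon>\<^sup>2)\<close> term has one constant, which is
  the uniformity over bounded data that the induction requires.\<close>

definition SylR_accuracy ::
  "(real \<Rightarrow> 'a::real_normed_field arith) \<Rightarrow> nat \<Rightarrow> 'a mat \<Rightarrow> 'a mat \<Rightarrow> real \<Rightarrow> bool" where
  "SylR_accuracy ar n A B e \<longleftrightarrow> (\<forall>R C b.
     (\<forall>\<epsilon>. R \<epsilon> \<in> carrier_mat n n \<and> C \<epsilon> \<in> carrier_mat n n \<and> sylvester_op A B (R \<epsilon>) = - C \<epsilon>) \<longrightarrow>
     (\<forall>\<^sub>F \<epsilon> in at_right 0. frob_norm (R \<epsilon>) \<le> b) \<longrightarrow>
     leading_le 1 (\<lambda>\<epsilon>. frob_norm (R \<epsilon>))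
       (\<lambda>\<epsilon>. frob_norm (fst (SylR (ar \<epsilon>) n A B (C \<epsilon>)) - R \<epsilon>)) e)"

lemma SylR_accuracy_mono:
  fixes A :: "'a::real_normed_field mat"
  assumes "SylR_accuracy ar n A B e" "e \<le> e'"
  shows "SylR_accuracy ar n A B e'"
  unfolding SylR_accuracy_def
proof (intro allI impI)
  fix R C :: "real \<Rightarrow> 'a mat" and b
  assume "\<forall>\<epsilon>. R \<epsilon> \<in> carrier_mat n n \<and> C \<epsilon> \<in> carrier_mat n n \<and> sylvester_op A B (R \<epsilon>) = - C \<epsilon>"
    and "\<forall>\<^sub>F \<epsilon> in at_right 0. frob_norm (R \<epsilon>) \<le> b"
  then have "leading_le 1 (\<lambda>\<epsilon>. frob_norm (R \<epsilon>))
       (\<lambda>\<epsilon>. frob_norm (fst (SylR (ar \<epsilon>) n A B (C \<epsilon>)) - R \<epsilon>)) e"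
    using assms(1) unfolding SylR_accuracy_def by blast
  then show "leading_le 1 (\<lambda>\<epsilon>. frob_norm (R \<epsilon>))
       (\<lambda>\<epsilon>. frob_norm (fst (SylR (ar \<epsilon>) n A B (C \<epsilon>)) - R \<epsilon>)) e'"
    by (rule leading_le_mono) (use assms(2) in auto)
qed

lemma frob_norm_diff_triangle:
  assumes "X \<in> carrier_mat m n" "Y \<in> carrier_mat m n" "Z \<in> carrier_mat m n"
  shows "frob_norm (X - Z) \<le> frob_norm (X - Y) + frob_norm (Y - Z)"
proof -
  have "X - Z = (X - Y) + (Y - Z)" by (rule eq_matI) (use assms in auto)
  then show ?thesis
    using frob_norm_add[of "X - Y" m n "Y - Z"] assms by (simp add: minus_carrier_mat)
qed

lemma frob_norm_le_diff:
  assumes "X \<in> carrier_mat m n" "Y \<in> carrier_mat m n"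
  shows "frob_norm X \<le> frob_norm Y + frob_norm (X - Y)"
proof -
  have "X = Y + (X - Y)" by (rule eq_matI) (use assms in auto)
  then show ?thesis
    using frob_norm_add[of Y m n "X - Y"] assms by (simp add: minus_carrier_mat)
qed

context
  fixes ar :: "real \<Rightarrow> 'a::real_normed_field arith" and \<mu> :: "nat \<Rightarrow> real"
    and r :: "real \<Rightarrow> real" and b :: real
  assumes fp: "\<forall>\<^sub>F \<epsilon> in at_right 0. fp_arithmetic \<epsilon> (ar \<epsilon>)"
    and st: "stable_mm ar \<mu>"
    and r_nonneg: "\<And>\<epsilon>. 0 \<le> r \<epsilon>"
    and r_bounded: "\<forall>\<^sub>F \<epsilon> in at_right 0. r \<epsilon> \<le> b"
begin

lemma madd_family:
  assumes X: "\<And>\<epsilon>. X \<epsilon> \<in> carrier_mat h h" and Y: "\<forall>\<^sub>F \<epsilon> in at_right 0. Y \<epsilon> \<in> carrier_mat h h"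
    and x: "leading_le 0 r (\<lambda>\<epsilon>. frob_norm (X \<epsilon>)) c" and y: "leading_le 0 r (\<lambda>\<epsilon>. frob_norm (Y \<epsilon>)) d"
  shows "leading_le 1 r (\<lambda>\<epsilon>. frob_norm (fst (madd (ar \<epsilon>) (X \<epsilon>) (Y \<epsilon>)) - (X \<epsilon> + Y \<epsilon>))) (c + d)"
proof -
  have "leading_le 1 r (\<lambda>\<epsilon>. \<epsilon> * (frob_norm (X \<epsilon>) + frob_norm (Y \<epsilon>))) (c + d)"
    using leading_le_eps[OF leading_le_add[OF x y]] by simp
  moreover have "\<forall>\<^sub>F \<epsilon> in at_right 0. frob_norm (fst (madd (ar \<epsilon>) (X \<epsilon>) (Y \<epsilon>)) - (X \<epsilon> + Y \<epsilon>))
      \<le> \<epsilon> * (frob_norm (X \<epsilon>) + frob_norm (Y \<epsilon>))"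
    using fp Y eventually_at_right_pos
  proof eventually_elim
    case (elim \<epsilon>)
    have "frob_norm (fst (madd (ar \<epsilon>) (X \<epsilon>) (Y \<epsilon>)) - (X \<epsilon> + Y \<epsilon>)) \<le> \<epsilon> * frob_norm (X \<epsilon> + Y \<epsilon>)"
      by (rule madd_error[OF elim(1) _ X elim(2)]) (use elim in simp)
    also have "\<dots> \<le> \<epsilon> * (frob_norm (X \<epsilon>) + frob_norm (Y \<epsilon>))"
      by (intro mult_left_mono frob_norm_add[OF X elim(2)]) (use elim in simp)
    finally show ?case .
  qed
  ultimately show ?thesis by (rule leading_le_mono) (simp_all add: r_nonneg)
qed

lemma msub_family:
  assumes X: "\<And>\<epsilon>. X \<epsilon> \<in> carrier_mat h h" and Y: "\<forall>\<^sub>F \<epsilon> in at_right 0. Y \<epsilon> \<in> carrier_mat h h"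
    and x: "leading_le 0 r (\<lambda>\<epsilon>. frob_norm (X \<epsilon>)) c" and y: "leading_le 0 r (\<lambda>\<epsilon>. frob_norm (Y \<epsilon>)) d"
  shows "leading_le 1 r (\<lambda>\<epsilon>. frob_norm (fst (msub (ar \<epsilon>) (X \<epsilon>) (Y \<epsilon>)) - (X \<epsilon> - Y \<epsilon>))) (c + d)"
    and "leading_le 0 r (\<lambda>\<epsilon>. frob_norm (fst (msub (ar \<epsilon>) (X \<epsilon>) (Y \<epsilon>)))) (c + d)"
proof -
  have "leading_le 1 r (\<lambda>\<epsilon>. \<epsilon> * (frob_norm (X \<epsilon>) + frob_norm (Y \<epsilon>))) (c + d)"
    using leading_le_eps[OF leading_le_add[OF x y]] by simp
  moreover have "\<forall>\<^sub>F \<epsilon> in at_right 0. frob_norm (fst (msub (ar \<epsilon>) (X \<epsilon>) (Y \<epsilon>)) - (X \<epsilon> - Y \<epsilon>))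
      \<le> \<epsilon> * (frob_norm (X \<epsilon>) + frob_norm (Y \<epsilon>))"
    using fp Y eventually_at_right_pos
  proof eventually_elim
    case (elim \<epsilon>)
    have "frob_norm (fst (msub (ar \<epsilon>) (X \<epsilon>) (Y \<epsilon>)) - (X \<epsilon> - Y \<epsilon>)) \<le> \<epsilon> * frob_norm (X \<epsilon> - Y \<epsilon>)"
      by (rule msub_error[OF elim(1) _ X elim(2)]) (use elim in simp)
    also have "\<dots> \<le> \<epsilon> * (frob_norm (X \<epsilon>) + frob_norm (Y \<epsilon>))"
      by (intro mult_left_mono frob_norm_diff[OF X elim(2)]) (use elim in simp)
    finally show ?case .
  qed
  ultimately show 1: "leading_le 1 r (\<lambda>\<epsilon>. frob_norm (fst (msub (ar \<epsilon>) (X \<epsilon>) (Y \<epsilon>)) - (X \<epsilon> - Y \<epsilon>))) (c + d)"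
    by (rule leading_le_mono) (simp_all add: r_nonneg)
  have "leading_le 0 r (\<lambda>\<epsilon>. frob_norm (X \<epsilon>) + frob_norm (Y \<epsilon>)
      + frob_norm (fst (msub (ar \<epsilon>) (X \<epsilon>) (Y \<epsilon>)) - (X \<epsilon> - Y \<epsilon>))) (c + d + 0)"
    by (intro leading_le_add x y leading_le_drop[OF 1 r_bounded r_nonneg])
  moreover have "\<forall>\<^sub>F \<epsilon> in at_right 0. frob_norm (fst (msub (ar \<epsilon>) (X \<epsilon>) (Y \<epsilon>)))
      \<le> frob_norm (X \<epsilon>) + frob_norm (Y \<epsilon>) + frob_norm (fst (msub (ar \<epsilon>) (X \<epsilon>) (Y \<epsilon>)) - (X \<epsilon> - Y \<epsilon>))"
    using Y
  proof eventually_elim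
    case (elim \<epsilon>)
    have "frob_norm (fst (msub (ar \<epsilon>) (X \<epsilon>) (Y \<epsilon>)))
        \<le> frob_norm (X \<epsilon> - Y \<epsilon>) + frob_norm (fst (msub (ar \<epsilon>) (X \<epsilon>) (Y \<epsilon>)) - (X \<epsilon> - Y \<epsilon>))"
      by (rule frob_norm_le_diff[OF fst_msub_carrier[OF X]]) (use X elim in \<open>auto intro!: minus_carrier_mat\<close>)
    then show ?case using frob_norm_diff[OF X elim, of \<epsilon>] by linarith
  qed
  ultimately show "leading_le 0 r (\<lambda>\<epsilon>. frob_norm (fst (msub (ar \<epsilon>) (X \<epsilon>) (Y \<epsilon>)))) (c + d)"
    by (rule leading_le_mono) (simp_all add: r_nonneg)
qed

text \<open>Stability of the multiplication is uniform only over bounded factors, hence the two bounds.\<close>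

lemma mm_family:
  assumes h: "0 < h" and X: "\<And>\<epsilon>. X \<epsilon> \<in> carrier_mat h h" and Y: "\<And>\<epsilon>. Y \<epsilon> \<in> carrier_mat h h"
    and Xb: "\<forall>\<^sub>F \<epsilon> in at_right 0. frob_norm (X \<epsilon>) \<le> x" and Yb: "\<forall>\<^sub>F \<epsilon> in at_right 0. frob_norm (Y \<epsilon>) \<le> y"
    and XY: "leading_le 0 r (\<lambda>\<epsilon>. frob_norm (X \<epsilon>) * frob_norm (Y \<epsilon>)) c"
  shows "\<forall>\<^sub>F \<epsilon> in at_right 0. fst (mm (ar \<epsilon>) (X \<epsilon>) (Y \<epsilon>)) \<in> carrier_mat h h"
    and "leading_le 1 r (\<lambda>\<epsilon>. frob_norm (fst (mm (ar \<epsilon>) (X \<epsilon>) (Y \<epsilon>)) - X \<epsilon> * Y \<epsilon>)) (\<mu> h * c)"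
    and "leading_le 0 r (\<lambda>\<epsilon>. frob_norm (fst (mm (ar \<epsilon>) (X \<epsilon>) (Y \<epsilon>)))) c"
proof -
  have h1: "1 \<le> h" using h by simp
  have Xb': "\<forall>\<^sub>F \<epsilon> in at_right 0. frob_norm (X \<epsilon>) \<le> max x y"
    using Xb by eventually_elim simp
  have Yb': "\<forall>\<^sub>F \<epsilon> in at_right 0. frob_norm (Y \<epsilon>) \<le> max x y"
    using Yb by eventually_elim simp
  note e = mm_error[OF st h1 r_nonneg r_bounded X Y Xb' Yb' XY]
  show c: "\<forall>\<^sub>F \<epsilon> in at_right 0. fst (mm (ar \<epsilon>) (X \<epsilon>) (Y \<epsilon>)) \<in> carrier_mat h h"
    and 1: "leading_le 1 r (\<lambda>\<epsilon>. frob_norm (fst (mm (ar \<epsilon>) (X \<epsilon>) (Y \<epsilon>)) - X \<epsilon> * Y \<epsilon>)) (\<mu> h * c)"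
    by (fact e)+
  have "leading_le 0 r (\<lambda>\<epsilon>. frob_norm (X \<epsilon>) * frob_norm (Y \<epsilon>)
      + frob_norm (fst (mm (ar \<epsilon>) (X \<epsilon>) (Y \<epsilon>)) - X \<epsilon> * Y \<epsilon>)) (c + 0)"
    by (intro leading_le_add XY leading_le_drop[OF 1 r_bounded r_nonneg])
  moreover have "\<forall>\<^sub>F \<epsilon> in at_right 0. frob_norm (fst (mm (ar \<epsilon>) (X \<epsilon>) (Y \<epsilon>)))
      \<le> frob_norm (X \<epsilon>) * frob_norm (Y \<epsilon>) + frob_norm (fst (mm (ar \<epsilon>) (X \<epsilon>) (Y \<epsilon>)) - X \<epsilon> * Y \<epsilon>)"
    using c
  proof eventually_elim
    case (elim \<epsilon>)
    have "frob_norm (X \<epsilon> * Y \<epsilon>) \<le> frob_norm (X \<epsilon>) * frob_norm (Y \<epsilon>)"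
      by (rule frob_norm_mult) (use X[of \<epsilon>] Y[of \<epsilon>] in auto)
    then show ?case
      using frob_norm_le_diff[OF elim mult_carrier_mat[OF X Y], of \<epsilon> \<epsilon>] by linarith
  qed
  ultimately show "leading_le 0 r (\<lambda>\<epsilon>. frob_norm (fst (mm (ar \<epsilon>) (X \<epsilon>) (Y \<epsilon>)))) c"
    by (rule leading_le_mono) (simp_all add: r_nonneg)
qed

lemma mm_left:
  assumes h: "0 < h" and P: "P \<in> carrier_mat h h" "frob_norm P \<le> m" and Y: "\<And>\<epsilon>. Y \<epsilon> \<in> carrier_mat h h"
    and y: "leading_le 0 r (\<lambda>\<epsilon>. frob_norm (Y \<epsilon>)) 1"
  shows "\<forall>\<^sub>F \<epsilon> in at_right 0. fst (mm (ar \<epsilon>) P (Y \<epsilon>)) \<in> carrier_mat h h"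
    and "leading_le 1 r (\<lambda>\<epsilon>. frob_norm (fst (mm (ar \<epsilon>) P (Y \<epsilon>)) - P * Y \<epsilon>)) (\<mu> h * m)"
    and "leading_le 0 r (\<lambda>\<epsilon>. frob_norm (fst (mm (ar \<epsilon>) P (Y \<epsilon>)))) m"
proof -
  obtain b' where b': "\<forall>\<^sub>F \<epsilon> in at_right 0. frob_norm (Y \<epsilon>) \<le> b'"
    using leading_le_bounded[OF y r_bounded r_nonneg] .
  have "leading_le 0 r (\<lambda>\<epsilon>. frob_norm P * frob_norm (Y \<epsilon>)) (frob_norm P * 1)"
    by (rule leading_le_scale[OF y]) simp
  then have "leading_le 0 r (\<lambda>\<epsilon>. frob_norm P * frob_norm (Y \<epsilon>)) m"
    by (rule leading_le_mono) (use P r_nonneg in auto)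
  from mm_family[OF h P(1) Y _ b' this, of "frob_norm P"]
  show "\<forall>\<^sub>F \<epsilon> in at_right 0. fst (mm (ar \<epsilon>) P (Y \<epsilon>)) \<in> carrier_mat h h"
    and "leading_le 1 r (\<lambda>\<epsilon>. frob_norm (fst (mm (ar \<epsilon>) P (Y \<epsilon>)) - P * Y \<epsilon>)) (\<mu> h * m)"
    and "leading_le 0 r (\<lambda>\<epsilon>. frob_norm (fst (mm (ar \<epsilon>) P (Y \<epsilon>)))) m"
    by simp_all
qed

lemma mm_right:
  assumes h: "0 < h" and P: "P \<in> carrier_mat h h" "frob_norm P \<le> m" and Y: "\<And>\<epsilon>. Y \<epsilon> \<in> carrier_mat h h"
    and y: "leading_le 0 r (\<lambda>\<epsilon>. frob_norm (Y \<epsilon>)) 1"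
  shows "\<forall>\<^sub>F \<epsilon> in at_right 0. fst (mm (ar \<epsilon>) (Y \<epsilon>) P) \<in> carrier_mat h h"
    and "leading_le 1 r (\<lambda>\<epsilon>. frob_norm (fst (mm (ar \<epsilon>) (Y \<epsilon>) P) - Y \<epsilon> * P)) (\<mu> h * m)"
    and "leading_le 0 r (\<lambda>\<epsilon>. frob_norm (fst (mm (ar \<epsilon>) (Y \<epsilon>) P))) m"
proof -
  obtain b' where b': "\<forall>\<^sub>F \<epsilon> in at_right 0. frob_norm (Y \<epsilon>) \<le> b'"
    using leading_le_bounded[OF y r_bounded r_nonneg] .
  have "leading_le 0 r (\<lambda>\<epsilon>. frob_norm P * frob_norm (Y \<epsilon>)) (frob_norm P * 1)"
    by (rule leading_le_scale[OF y]) simp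
  then have "leading_le 0 r (\<lambda>\<epsilon>. frob_norm (Y \<epsilon>) * frob_norm P) m"
    by (rule leading_le_mono) (use P r_nonneg in \<open>auto simp: mult.commute\<close>)
  from mm_family[OF h Y P(1) b' _ this, of "frob_norm P"]
  show "\<forall>\<^sub>F \<epsilon> in at_right 0. fst (mm (ar \<epsilon>) (Y \<epsilon>) P) \<in> carrier_mat h h"
    and "leading_le 1 r (\<lambda>\<epsilon>. frob_norm (fst (mm (ar \<epsilon>) (Y \<epsilon>) P) - Y \<epsilon> * P)) (\<mu> h * m)"
    and "leading_le 0 r (\<lambda>\<epsilon>. frob_norm (fst (mm (ar \<epsilon>) (Y \<epsilon>) P))) m"
    by simp_all
qed

text \<open>A recursive call receives \<open>D\<close> in place of the exact right-hand side \<open>D'\<close>. The accuracy of the call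
  refers to the exact solution \<open>Z\<close> for \<open>D\<close>; it bounds the residual of the computed \<open>X\<close> with respect to \<open>D\<close>,
  to which the discrepancy between \<open>D\<close> and \<open>D'\<close> does not contribute. The other two conclusions only
  say that \<open>X\<close> agrees with the exact block up to \<open>O(\<epsilon>)\<close>, for use in the later blocks.\<close>

lemma solve_perturbed:
  fixes X :: "real \<Rightarrow> 'a mat"
  assumes T: "triangular_pair (2 ^ k) P Q" and bnd: "sylvester_bounds (2 ^ k) P Q g L"
    and acc: "SylR_accuracy ar (2 ^ k) P Q e" and e: "0 \<le> e"
    and D: "\<And>\<epsilon>. D \<epsilon> \<in> carrier_mat (2 ^ k) (2 ^ k)" and D': "\<And>\<epsilon>. D' \<epsilon> \<in> carrier_mat (2 ^ k) (2 ^ k)"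
    and X': "\<And>\<epsilon>. X' \<epsilon> \<in> carrier_mat (2 ^ k) (2 ^ k)" "\<And>\<epsilon>. sylvester_op P Q (X' \<epsilon>) = - D' \<epsilon>"
      "\<And>\<epsilon>. frob_norm (X' \<epsilon>) \<le> r \<epsilon>"
    and DD': "leading_le 0 r (\<lambda>\<epsilon>. frob_norm (D \<epsilon> - D' \<epsilon>)) 0"
    and X: "\<And>\<epsilon>. X \<epsilon> = fst (SylR (ar \<epsilon>) (2 ^ k) P Q (D \<epsilon>))"
  shows "leading_le 1 r (\<lambda>\<epsilon>. frob_norm (sylvester_op P Q (X \<epsilon>) + D \<epsilon>)) (L * e)"
    and "leading_le 0 r (\<lambda>\<epsilon>. frob_norm (X \<epsilon> - X' \<epsilon>)) 0"
    and "leading_le 0 r (\<lambda>\<epsilon>. frob_norm (X \<epsilon>)) 1"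
proof -
  let ?h = "2 ^ k :: nat"
  have h: "1 \<le> ?h" by simp
  note PQ = triangular_pairD(1,2)[OF T] and gL = sylvester_bounds_pos[OF bnd h]
  have Xc: "X \<epsilon> \<in> carrier_mat ?h ?h" for \<epsilon> unfolding X by (rule fst_SylR_carrier)
  have "\<exists>Z. Z \<in> carrier_mat ?h ?h \<and> sylvester_op P Q Z = - D \<epsilon>" for \<epsilon>
    using sylvester_op_surj[OF T, of "- D \<epsilon>"] D[of \<epsilon>] by (metis uminus_carrier_iff_mat)
  then obtain Z where Z: "\<And>\<epsilon>. Z \<epsilon> \<in> carrier_mat ?h ?h" "\<And>\<epsilon>. sylvester_op P Q (Z \<epsilon>) = - D \<epsilon>"
    by metis
  have ZX: "frob_norm (Z \<epsilon> - X' \<epsilon>) \<le> g * frob_norm (D \<epsilon> - D' \<epsilon>)" for \<epsilon>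
  proof -
    have "sylvester_op P Q (Z \<epsilon> - X' \<epsilon>) = - (D \<epsilon> - D' \<epsilon>)"
      unfolding sylvester_op_diff[OF PQ Z(1) X'(1)] Z(2) X'(2)
      by (rule eq_matI) (use D[of \<epsilon>] D'[of \<epsilon>] in auto)
    then show ?thesis
      using sylvester_boundsD(1)[OF bnd minus_carrier_mat[OF X'(1)], of "Z \<epsilon>" \<epsilon>] by simp
  qed
  have "leading_le 0 r (\<lambda>\<epsilon>. g * frob_norm (D \<epsilon> - D' \<epsilon>)) (g * 0)"
    by (rule leading_le_scale[OF DD']) (use gL in simp)
  then have ZX0: "leading_le 0 r (\<lambda>\<epsilon>. frob_norm (Z \<epsilon> - X' \<epsilon>)) 0"
    by (rule leading_le_mono) (simp_all add: r_nonneg ZX)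
  have X'r: "leading_le 0 r (\<lambda>\<epsilon>. frob_norm (X' \<epsilon>)) 1"
    by (rule leading_le_exact) (simp add: X'(3))
  have Z1: "leading_le 0 r (\<lambda>\<epsilon>. frob_norm (Z \<epsilon>)) 1"
    by (rule leading_le_mono[OF leading_le_add[OF X'r ZX0]])
      (simp_all add: r_nonneg frob_norm_le_diff[OF Z(1) X'(1)])
  obtain b' where "\<forall>\<^sub>F \<epsilon> in at_right 0. frob_norm (Z \<epsilon>) \<le> b'"
    using leading_le_bounded[OF Z1 r_bounded r_nonneg] .
  then have "leading_le 1 (\<lambda>\<epsilon>. frob_norm (Z \<epsilon>)) (\<lambda>\<epsilon>. frob_norm (X \<epsilon> - Z \<epsilon>)) e"
    using acc Z D unfolding SylR_accuracy_def X by blast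
  from leading_le_trans[OF this Z1 e]
  have XZ: "leading_le 1 r (\<lambda>\<epsilon>. frob_norm (X \<epsilon> - Z \<epsilon>)) e" by simp
  have "frob_norm (sylvester_op P Q (X \<epsilon>) + D \<epsilon>) \<le> L * frob_norm (X \<epsilon> - Z \<epsilon>)" for \<epsilon>
  proof -
    have "sylvester_op P Q (X \<epsilon>) + D \<epsilon> = sylvester_op P Q (X \<epsilon> - Z \<epsilon>)"
      unfolding sylvester_op_diff[OF PQ Xc Z(1)] Z(2)
      by (rule eq_matI) (use D[of \<epsilon>] in auto)
    then show ?thesis using sylvester_boundsD(2)[OF bnd minus_carrier_mat[OF Z(1)], of "X \<epsilon>" \<epsilon>] by simp
  qed
  then show "leading_le 1 r (\<lambda>\<epsilon>. frob_norm (sylvester_op P Q (X \<epsilon>) + D \<epsilon>)) (L * e)"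
    by (intro leading_le_mono[OF leading_le_scale[OF XZ, of L]]) (use gL r_nonneg in auto)
  show XX': "leading_le 0 r (\<lambda>\<epsilon>. frob_norm (X \<epsilon> - X' \<epsilon>)) 0"
    by (rule leading_le_mono[OF leading_le_add[OF leading_le_drop[OF XZ r_bounded r_nonneg] ZX0]])
      (simp_all add: r_nonneg frob_norm_diff_triangle[OF Xc Z(1) X'(1)])
  show "leading_le 0 r (\<lambda>\<epsilon>. frob_norm (X \<epsilon>)) 1"
    by (rule leading_le_mono[OF leading_le_add[OF X'r XX']])
      (simp_all add: r_nonneg frob_norm_le_diff[OF Xc X'(1)])
qed

end

lemma split_block_four_block:
  assumes c: "P \<in> carrier_mat h h" "Q \<in> carrier_mat h h" "S \<in> carrier_mat h h" "T \<in> carrier_mat h h"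
  shows "split_block (four_block_mat P Q S T) h h = (P, Q, S, T)"
proof -
  obtain P' Q' S' T' where s: "split_block (four_block_mat P Q S T) h h = (P', Q', S', T')"
    by (metis prod_cases4)
  note sb = split_block[OF s, of h h]
  have "P = P'" "Q = Q'" "S = S'" "T = T'"
    using four_block_mat_eqD[OF sb(5) c sb(1-4)] c by auto
  then show ?thesis using s by simp
qed

text \<open>These identities are kept for arbitrary matrices because an entrywise proof about products would
  expand them into scalar products.\<close>

lemma
  fixes U :: "'a::real_normed_field mat"
  assumes "U \<in> carrier_mat m n" "V \<in> carrier_mat m n" "W \<in> carrier_mat m n"
  shows mat_add_diff_add: "(U + V) - (U + W) = V - W"
    and mat_diff_diff_diff: "(U - V) - (U - W) = - (V - W)"
    and mat_uminus_diff: "- U - V = - (U + V)"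
    and mat_uminus_add: "- U + V = - (U - V)"
    and mat_uminus_add_diff: "- U + V - W = - (U - V + W)"
  by (rule eq_matI; use assms in auto)+

lemma
  fixes U :: "'a::real_normed_field mat"
  assumes "U \<in> carrier_mat m n" "V \<in> carrier_mat m n" "W \<in> carrier_mat m n"
    "Y \<in> carrier_mat m n" "Z \<in> carrier_mat m n"
  shows mat_diff_add_diff: "(U - V + W) - (U - Y + Z) = (W - Z) - (V - Y)"
    and mat_residual11: "(U + V - W) + Y = ((U - W) + Z) - (Z - (Y + V))"
    and mat_residual22: "(U - (V + W)) + Y = ((U - W) + Z) - (Z - (Y - V))"
  by (rule eq_matI; use assms in auto)+

lemma
  fixes U :: "'a::real_normed_field mat"
  assumes "U \<in> carrier_mat m n" "V \<in> carrier_mat m n" "W \<in> carrier_mat m n"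
    "X \<in> carrier_mat m n" "Y \<in> carrier_mat m n" "Z \<in> carrier_mat m n"
  shows mat_rounding12: "U + V - (W - X + Y) = (U - (W - Z)) - ((Z - X) - (V - Y))"
    and mat_residual12: "(U + V - (W + X)) + Y = ((U - X) + Z) - (Z - (Y - W + V))"
  by (rule eq_matI; use assms in auto)+

text \<open>The residual \<open>A X - X B + C\<close> of the computed matrix is, in each block, the residual of one recursive
  call minus the rounding error made in forming the right-hand side of that call. Since that right-hand
  side uses the computed earlier blocks, their errors cancel from the residual, and the inverse of the
  whole operator is applied only once. This costs one factor \<open>g * L\<close>; following the error from \<open>X21\<close>
  through \<open>X11\<close> and \<open>X22\<close> to \<open>X12\<close> would cost one factor for each stage.\<close>

lemma (in split_pair) SylR_accuracy_step:
  fixes ar :: "real \<Rightarrow> 'a arith"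
  assumes fp: "\<forall>\<^sub>F \<epsilon> in at_right 0. fp_arithmetic \<epsilon> (ar \<epsilon>)"
    and st: "stable_mm ar \<mu>" and h: "h = 2 ^ k"
    and bnd: "sylvester_bounds (h + h) A B g L" and e: "0 \<le> e"
    and acc: "SylR_accuracy ar h A11 B11 e" "SylR_accuracy ar h A11 B22 e"
      "SylR_accuracy ar h A22 B11 e" "SylR_accuracy ar h A22 B22 e"
  shows "SylR_accuracy ar (h + h) A B (4 * (g * L) * e + 13 * (real h * \<mu> h) * (g * L))"
  unfolding SylR_accuracy_def
proof (intro allI impI)
  fix R C :: "real \<Rightarrow> 'a mat" and b
  assume "\<forall>\<epsilon>. R \<epsilon> \<in> carrier_mat (h + h) (h + h) \<and> C \<epsilon> \<in> carrier_mat (h + h) (h + h) \<and>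
      sylvester_op A B (R \<epsilon>) = - C \<epsilon>"
  then have R: "R \<epsilon> \<in> carrier_mat (h + h) (h + h)" and C: "C \<epsilon> \<in> carrier_mat (h + h) (h + h)"
    and eq: "sylvester_op A B (R \<epsilon>) = - C \<epsilon>" for \<epsilon> by auto
  assume Rb: "\<forall>\<^sub>F \<epsilon> in at_right 0. frob_norm (R \<epsilon>) \<le> b"
  define r where "r = (\<lambda>\<epsilon>. frob_norm (R \<epsilon>))"
  have r0: "0 \<le> r \<epsilon>" for \<epsilon> by (simp add: r_def)
  have rb: "\<forall>\<^sub>F \<epsilon> in at_right 0. r \<epsilon> \<le> b" using Rb by (simp add: r_def)
  have gL: "0 < g" "0 < L" "1 \<le> g * L" using sylvester_bounds_pos[OF bnd] h_pos by auto
  have \<mu>: "1 \<le> \<mu> h" using st by (simp add: stable_mm_def)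
  define m where "m = real h * L"
  have m: "0 \<le> m" "L \<le> m" "m \<le> \<mu> h * m"
    using h_pos gL \<mu> by (auto simp: m_def)
  have A12: "frob_norm A12 \<le> m" and B12: "frob_norm B12 \<le> m"
    using off_diagonal_bound[OF bnd] by (auto simp: m_def)
  note madd = madd_family[OF fp st r0 rb] and msub = msub_family[OF fp st r0 rb]
    and left = mm_left[OF fp st r0 rb h_pos carriers(2) A12]
    and right = mm_right[OF fp st r0 rb h_pos carriers(5) B12]
    and solve = solve_perturbed[OF fp st r0 rb, of k, folded h, OF _ _ _ e]
  note bb = bounds_blocks[OF bnd]

  define R11 where "R11 = (\<lambda>\<epsilon>. fst (split_block (R \<epsilon>) h h))"
  define R12 where "R12 = (\<lambda>\<epsilon>. fst (snd (split_block (R \<epsilon>) h h)))"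
  define R21 where "R21 = (\<lambda>\<epsilon>. fst (snd (snd (split_block (R \<epsilon>) h h))))"
  define R22 where "R22 = (\<lambda>\<epsilon>. snd (snd (snd (split_block (R \<epsilon>) h h))))"
  have "split_block (R \<epsilon>) h h = (R11 \<epsilon>, R12 \<epsilon>, R21 \<epsilon>, R22 \<epsilon>)" for \<epsilon>
    by (simp add: R11_def R12_def R21_def R22_def)
  note sR = split_block[OF this, where ?sr2.0 = h and ?sc2.0 = h, OF carrier_matD[OF R]]
  define C11 where "C11 = (\<lambda>\<epsilon>. fst (split_block (C \<epsilon>) h h))"
  define C12 where "C12 = (\<lambda>\<epsilon>. fst (snd (split_block (C \<epsilon>) h h)))"
  define C21 where "C21 = (\<lambda>\<epsilon>. fst (snd (snd (split_block (C \<epsilon>) h h))))"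
  define C22 where "C22 = (\<lambda>\<epsilon>. snd (snd (snd (split_block (C \<epsilon>) h h))))"
  have spC: "split_block (C \<epsilon>) h h = (C11 \<epsilon>, C12 \<epsilon>, C21 \<epsilon>, C22 \<epsilon>)" for \<epsilon>
    by (simp add: C11_def C12_def C21_def C22_def)
  note sC = split_block[OF this, where ?sr2.0 = h and ?sc2.0 = h, OF carrier_matD[OF C]]
  have mC: "- C \<epsilon> = four_block_mat (- C11 \<epsilon>) (- C12 \<epsilon>) (- C21 \<epsilon>) (- C22 \<epsilon>)" for \<epsilon>
    unfolding sC(5)[of \<epsilon>] by (rule eq_matI) (use sC(1-4)[of \<epsilon>] in auto)
  have umC: "- C11 \<epsilon> \<in> carrier_mat h h" "- C12 \<epsilon> \<in> carrier_mat h h"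
    "- C21 \<epsilon> \<in> carrier_mat h h" "- C22 \<epsilon> \<in> carrier_mat h h" for \<epsilon>
    using sC(1-4)[of \<epsilon>] by auto
  have eqB: "sylvester_op A B (four_block_mat (R11 \<epsilon>) (R12 \<epsilon>) (R21 \<epsilon>) (R22 \<epsilon>)) =
      four_block_mat (- C11 \<epsilon>) (- C12 \<epsilon>) (- C21 \<epsilon>) (- C22 \<epsilon>)" for \<epsilon>
    using eq[of \<epsilon>] mC[of \<epsilon>] sR(5)[of \<epsilon>] by simp
  note eqs = sylvester_op_blocks_eqD[OF sR(1-4) umC eqB]
  note Rprod = mult_carrier_mat[OF carriers(2) sR(3)] mult_carrier_mat[OF sR(3) carriers(5)]
    mult_carrier_mat[OF sR(1) carriers(5)] mult_carrier_mat[OF carriers(2) sR(4)]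
  have eq11: "sylvester_op A11 B11 (R11 \<epsilon>) = - (C11 \<epsilon> + A12 * R21 \<epsilon>)" for \<epsilon>
    unfolding eqs(2) by (rule mat_uminus_diff[OF sC(1) Rprod(1) sC(1)])
  have eq22: "sylvester_op A22 B22 (R22 \<epsilon>) = - (C22 \<epsilon> - R21 \<epsilon> * B12)" for \<epsilon>
    unfolding eqs(3) by (rule mat_uminus_add[OF sC(4) Rprod(2) sC(4)])
  have eq12: "sylvester_op A11 B22 (R12 \<epsilon>) = - (C12 \<epsilon> - R11 \<epsilon> * B12 + A12 * R22 \<epsilon>)" for \<epsilon>
    unfolding eqs(4) by (rule mat_uminus_add_diff[OF sC(2) Rprod(3) Rprod(4)])
  have Rr: "frob_norm (R11 \<epsilon>) \<le> r \<epsilon>" "frob_norm (R12 \<epsilon>) \<le> r \<epsilon>"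
    "frob_norm (R21 \<epsilon>) \<le> r \<epsilon>" "frob_norm (R22 \<epsilon>) \<le> r \<epsilon>" for \<epsilon>
    using frob_norm_block_le[OF sR(1-4)[of \<epsilon>]] by (simp_all add: r_def sR(5)[of \<epsilon>, symmetric])
  have CL: "frob_norm (C \<epsilon>) \<le> L * r \<epsilon>" for \<epsilon>
    using sylvester_boundsD(2)[OF bnd R[of \<epsilon>]] by (simp add: eq r_def)
  have CLb: "frob_norm (C11 \<epsilon>) \<le> L * r \<epsilon>" "frob_norm (C12 \<epsilon>) \<le> L * r \<epsilon>"
    "frob_norm (C22 \<epsilon>) \<le> L * r \<epsilon>" for \<epsilon>
    using frob_norm_block_le[OF sC(1-4)[of \<epsilon>]] CL[of \<epsilon>] by (simp_all add: sC(5)[of \<epsilon>, symmetric])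
  have Cr: "leading_le 0 r (\<lambda>\<epsilon>. frob_norm (C11 \<epsilon>)) L" "leading_le 0 r (\<lambda>\<epsilon>. frob_norm (C12 \<epsilon>)) L"
    "leading_le 0 r (\<lambda>\<epsilon>. frob_norm (C22 \<epsilon>)) L"
    by (rule leading_le_exact, rule CLb)+

  define X21 where "X21 = (\<lambda>\<epsilon>. fst (SylR (ar \<epsilon>) h A22 B11 (C21 \<epsilon>)))"
  define P1 where "P1 = (\<lambda>\<epsilon>. fst (mm (ar \<epsilon>) A12 (X21 \<epsilon>)))"
  define D11 where "D11 = (\<lambda>\<epsilon>. fst (madd (ar \<epsilon>) (C11 \<epsilon>) (P1 \<epsilon>)))"
  define X11 where "X11 = (\<lambda>\<epsilon>. fst (SylR (ar \<epsilon>) h A11 B11 (D11 \<epsilon>)))"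
  define P2 where "P2 = (\<lambda>\<epsilon>. fst (mm (ar \<epsilon>) (X21 \<epsilon>) B12))"
  define D22 where "D22 = (\<lambda>\<epsilon>. fst (msub (ar \<epsilon>) (C22 \<epsilon>) (P2 \<epsilon>)))"
  define X22 where "X22 = (\<lambda>\<epsilon>. fst (SylR (ar \<epsilon>) h A22 B22 (D22 \<epsilon>)))"
  define P3 where "P3 = (\<lambda>\<epsilon>. fst (mm (ar \<epsilon>) (X11 \<epsilon>) B12))"
  define P4 where "P4 = (\<lambda>\<epsilon>. fst (mm (ar \<epsilon>) A12 (X22 \<epsilon>)))"
  define S where "S = (\<lambda>\<epsilon>. fst (msub (ar \<epsilon>) (C12 \<epsilon>) (P3 \<epsilon>)))"
  define D12 where "D12 = (\<lambda>\<epsilon>. fst (madd (ar \<epsilon>) (S \<epsilon>) (P4 \<epsilon>)))"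
  define X12 where "X12 = (\<lambda>\<epsilon>. fst (SylR (ar \<epsilon>) h A11 B22 (D12 \<epsilon>)))"
  define X where "X = (\<lambda>\<epsilon>. four_block_mat (X11 \<epsilon>) (X12 \<epsilon>) (X21 \<epsilon>) (X22 \<epsilon>))"
  have X: "fst (SylR (ar \<epsilon>) (h + h) A B (C \<epsilon>)) = X \<epsilon>" for \<epsilon>
    using SylR_blocks[OF h_pos split_block_four_block[OF carriers(1,2) _ carriers(3)]
        split_block_four_block[OF carriers(4,5) _ carriers(6)] spC, where F = "ar \<epsilon>"]
    by (simp add: X_def X12_def D12_def S_def P4_def P3_def X22_def D22_def P2_def X11_def D11_def P1_def X21_def)
  have Xc: "X11 \<epsilon> \<in> carrier_mat h h" "X12 \<epsilon> \<in> carrier_mat h h"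
    "X21 \<epsilon> \<in> carrier_mat h h" "X22 \<epsilon> \<in> carrier_mat h h" for \<epsilon>
    unfolding X11_def X12_def X21_def X22_def h by (rule fst_SylR_carrier)+
  have Xc': "X \<epsilon> \<in> carrier_mat (h + h) (h + h)" for \<epsilon>
    unfolding X_def by (rule four_block_carrier_mat) (rule Xc)+
  have Dc: "D11 \<epsilon> \<in> carrier_mat h h" "D22 \<epsilon> \<in> carrier_mat h h"
    "S \<epsilon> \<in> carrier_mat h h" "D12 \<epsilon> \<in> carrier_mat h h" for \<epsilon>
    using sC(1-4) unfolding D11_def D22_def S_def D12_def
    by (auto intro!: fst_madd_carrier fst_msub_carrier)
  have prod: "A12 * X21 \<epsilon> \<in> carrier_mat h h" "X21 \<epsilon> * B12 \<in> carrier_mat h h"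
    "X11 \<epsilon> * B12 \<in> carrier_mat h h" "A12 * X22 \<epsilon> \<in> carrier_mat h h"
    "A12 * R21 \<epsilon> \<in> carrier_mat h h" "R21 \<epsilon> * B12 \<in> carrier_mat h h"
    "R11 \<epsilon> * B12 \<in> carrier_mat h h" "A12 * R22 \<epsilon> \<in> carrier_mat h h" for \<epsilon>
    by (rule mult_carrier_mat[OF carriers(2) Xc(3)] mult_carrier_mat[OF Xc(3) carriers(5)]
        mult_carrier_mat[OF Xc(1) carriers(5)] mult_carrier_mat[OF carriers(2) Xc(4)]
        Rprod)+
  \<comment> \<open>Right-hand sides of the small equations: \<open>E\<close> from computed, \<open>G\<close> from exact earlier blocks\<close>
  have E11: "C11 \<epsilon> + A12 * X21 \<epsilon> \<in> carrier_mat h h" and E22: "C22 \<epsilon> - X21 \<epsilon> * B12 \<in> carrier_mat h h"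
    and E12: "C12 \<epsilon> - X11 \<epsilon> * B12 + A12 * X22 \<epsilon> \<in> carrier_mat h h"
    and G11: "C11 \<epsilon> + A12 * R21 \<epsilon> \<in> carrier_mat h h" and G22: "C22 \<epsilon> - R21 \<epsilon> * B12 \<in> carrier_mat h h"
    and G12: "C12 \<epsilon> - R11 \<epsilon> * B12 + A12 * R22 \<epsilon> \<in> carrier_mat h h" for \<epsilon>
    by (intro add_carrier_mat minus_carrier_mat prod)+
  have A12m: "frob_norm (A12 * Y - A12 * Z) \<le> m * frob_norm (Y - Z)"
    if "Y \<in> carrier_mat h h" "Z \<in> carrier_mat h h" for Y Z
  proof -
    have "A12 * Y - A12 * Z = A12 * (Y - Z)" by (rule mult_minus_distrib_mat[symmetric]) (use that in auto)
    then have "frob_norm (A12 * Y - A12 * Z) \<le> frob_norm A12 * frob_norm (Y - Z)"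
      using frob_norm_mult[of A12 "Y - Z"] that by simp
    also have "\<dots> \<le> m * frob_norm (Y - Z)" by (rule mult_right_mono[OF A12]) simp
    finally show ?thesis .
  qed
  have B12m: "frob_norm (Y * B12 - Z * B12) \<le> m * frob_norm (Y - Z)"
    if "Y \<in> carrier_mat h h" "Z \<in> carrier_mat h h" for Y Z
  proof -
    have "Y * B12 - Z * B12 = (Y - Z) * B12" by (rule minus_mult_distrib_mat[symmetric]) (use that in auto)
    then have "frob_norm (Y * B12 - Z * B12) \<le> frob_norm (Y - Z) * frob_norm B12"
      using frob_norm_mult[of "Y - Z" B12] that by simp
    also have "\<dots> \<le> frob_norm (Y - Z) * m" by (rule mult_left_mono[OF B12]) simp
    finally show ?thesis by (simp add: mult.commute)
  qed
  have "leading_le 0 r (\<lambda>\<epsilon>. frob_norm (C21 \<epsilon> - C21 \<epsilon>)) 0"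
    by (rule leading_le_exact) (use sC(3) in \<open>simp add: minus_r_inv_mat[OF sC(3)]\<close>)
  note s21 = solve[OF diag_blocks(3) bb(3) acc(3) sC(3) sC(3) sR(3) eqs(1) Rr(3) this X21_def[THEN fun_cong]]
  note P1 = left[OF Xc(3) s21(3), folded P1_def[THEN fun_cong]]
    and P2 = right[OF Xc(3) s21(3), folded P2_def[THEN fun_cong]]

  have rho11: "leading_le 1 r (\<lambda>\<epsilon>. frob_norm (D11 \<epsilon> - (C11 \<epsilon> + A12 * X21 \<epsilon>))) (L + m + \<mu> h * m)"
  proof (rule leading_le_mono[OF leading_le_add[OF madd[OF sC(1) P1(1) Cr(1) P1(3), folded D11_def[THEN fun_cong]] P1(2)]])
    show "\<forall>\<^sub>F \<epsilon> in at_right 0. frob_norm (D11 \<epsilon> - (C11 \<epsilon> + A12 * X21 \<epsilon>))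
        \<le> frob_norm (D11 \<epsilon> - (C11 \<epsilon> + P1 \<epsilon>)) + frob_norm (P1 \<epsilon> - A12 * X21 \<epsilon>)"
      using P1(1)
    proof eventually_elim
      case (elim \<epsilon>)
      have "C11 \<epsilon> + P1 \<epsilon> - (C11 \<epsilon> + A12 * X21 \<epsilon>) = P1 \<epsilon> - A12 * X21 \<epsilon>"
        by (rule mat_add_diff_add[OF sC(1) elim prod(1)])
      then show ?case
        using frob_norm_diff_triangle[OF Dc(1)[of \<epsilon>] add_carrier_mat[OF elim, of "C11 \<epsilon>"] E11[of \<epsilon>]]
        by simp
    qed
  qed (simp_all add: r0)
  have "leading_le 0 r (\<lambda>\<epsilon>. frob_norm (D11 \<epsilon> - (C11 \<epsilon> + A12 * R21 \<epsilon>))) 0"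
  proof (rule leading_le_mono[OF leading_le_add[OF leading_le_drop[OF rho11 rb r0] leading_le_scale[OF s21(2) m(1)]]])
    show "\<forall>\<^sub>F \<epsilon> in at_right 0. frob_norm (D11 \<epsilon> - (C11 \<epsilon> + A12 * R21 \<epsilon>))
        \<le> frob_norm (D11 \<epsilon> - (C11 \<epsilon> + A12 * X21 \<epsilon>)) + m * frob_norm (X21 \<epsilon> - R21 \<epsilon>)"
    proof (rule always_eventually, rule allI)
      fix \<epsilon>
      have "C11 \<epsilon> + A12 * X21 \<epsilon> - (C11 \<epsilon> + A12 * R21 \<epsilon>) = A12 * X21 \<epsilon> - A12 * R21 \<epsilon>"
        by (rule mat_add_diff_add[OF sC(1) prod(1,5)])
      then show "frob_norm (D11 \<epsilon> - (C11 \<epsilon> + A12 * R21 \<epsilon>))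
        \<le> frob_norm (D11 \<epsilon> - (C11 \<epsilon> + A12 * X21 \<epsilon>)) + m * frob_norm (X21 \<epsilon> - R21 \<epsilon>)"
        using frob_norm_diff_triangle[OF Dc(1)[of \<epsilon>] E11[of \<epsilon>] G11[of \<epsilon>]]
          A12m[OF Xc(3)[of \<epsilon>] sR(3)[of \<epsilon>]] by simp
    qed
  qed (simp_all add: r0)
  note s11 = solve[OF diag_blocks(1) bb(1) acc(1) Dc(1) G11 sR(1) eq11 Rr(1) this
      X11_def[THEN fun_cong]]

  have rho22: "leading_le 1 r (\<lambda>\<epsilon>. frob_norm (D22 \<epsilon> - (C22 \<epsilon> - X21 \<epsilon> * B12))) (L + m + \<mu> h * m)"
  proof (rule leading_le_mono[OF leading_le_add[OF msub(1)[OF sC(4) P2(1) Cr(3) P2(3), folded D22_def[THEN fun_cong]] P2(2)]])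
    show "\<forall>\<^sub>F \<epsilon> in at_right 0. frob_norm (D22 \<epsilon> - (C22 \<epsilon> - X21 \<epsilon> * B12))
        \<le> frob_norm (D22 \<epsilon> - (C22 \<epsilon> - P2 \<epsilon>)) + frob_norm (P2 \<epsilon> - X21 \<epsilon> * B12)"
      using P2(1)
    proof eventually_elim
      case (elim \<epsilon>)
      have "C22 \<epsilon> - P2 \<epsilon> - (C22 \<epsilon> - X21 \<epsilon> * B12) = - (P2 \<epsilon> - X21 \<epsilon> * B12)"
        by (rule mat_diff_diff_diff[OF sC(4) elim prod(2)])
      then show ?case
        using frob_norm_diff_triangle[OF Dc(2)[of \<epsilon>] minus_carrier_mat[OF elim, of "C22 \<epsilon>"] E22[of \<epsilon>]]
        by simp
    qed
  qed (simp_all add: r0)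
  have "leading_le 0 r (\<lambda>\<epsilon>. frob_norm (D22 \<epsilon> - (C22 \<epsilon> - R21 \<epsilon> * B12))) 0"
  proof (rule leading_le_mono[OF leading_le_add[OF leading_le_drop[OF rho22 rb r0] leading_le_scale[OF s21(2) m(1)]]])
    show "\<forall>\<^sub>F \<epsilon> in at_right 0. frob_norm (D22 \<epsilon> - (C22 \<epsilon> - R21 \<epsilon> * B12))
        \<le> frob_norm (D22 \<epsilon> - (C22 \<epsilon> - X21 \<epsilon> * B12)) + m * frob_norm (X21 \<epsilon> - R21 \<epsilon>)"
    proof (rule always_eventually, rule allI)
      fix \<epsilon>
      have "C22 \<epsilon> - X21 \<epsilon> * B12 - (C22 \<epsilon> - R21 \<epsilon> * B12) = - (X21 \<epsilon> * B12 - R21 \<epsilon> * B12)"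
        by (rule mat_diff_diff_diff[OF sC(4) prod(2,6)])
      then show "frob_norm (D22 \<epsilon> - (C22 \<epsilon> - R21 \<epsilon> * B12))
        \<le> frob_norm (D22 \<epsilon> - (C22 \<epsilon> - X21 \<epsilon> * B12)) + m * frob_norm (X21 \<epsilon> - R21 \<epsilon>)"
        using frob_norm_diff_triangle[OF Dc(2)[of \<epsilon>] E22[of \<epsilon>] G22[of \<epsilon>]]
          B12m[OF Xc(3)[of \<epsilon>] sR(3)[of \<epsilon>]] by simp
    qed
  qed (simp_all add: r0)
  note s22 = solve[OF diag_blocks(4) bb(4) acc(4) Dc(2) G22 sR(4) eq22 Rr(4) this
      X22_def[THEN fun_cong]]

  note P3 = right[OF Xc(1) s11(3), folded P3_def[THEN fun_cong]]
    and P4 = left[OF Xc(4) s22(3), folded P4_def[THEN fun_cong]]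
  note S = msub[OF sC(2) P3(1) Cr(2) P3(3), folded S_def[THEN fun_cong]]
  note D12 = madd[OF Dc(3) P4(1) S(2) P4(3), folded D12_def[THEN fun_cong]]
  let ?E12 = "\<lambda>\<epsilon>. C12 \<epsilon> - X11 \<epsilon> * B12 + A12 * X22 \<epsilon>"
  have rho12: "leading_le 1 r (\<lambda>\<epsilon>. frob_norm (D12 \<epsilon> - ?E12 \<epsilon>)) (2 * L + 3 * m + 2 * (\<mu> h * m))"
  proof (rule leading_le_mono[OF leading_le_add[OF leading_le_add[OF D12 S(1)] leading_le_add[OF P3(2) P4(2)]]])
    show "\<forall>\<^sub>F \<epsilon> in at_right 0. frob_norm (D12 \<epsilon> - ?E12 \<epsilon>)
        \<le> frob_norm (D12 \<epsilon> - (S \<epsilon> + P4 \<epsilon>)) + frob_norm (S \<epsilon> - (C12 \<epsilon> - P3 \<epsilon>))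
          + (frob_norm (P3 \<epsilon> - X11 \<epsilon> * B12) + frob_norm (P4 \<epsilon> - A12 * X22 \<epsilon>))"
      using P3(1) P4(1)
    proof eventually_elim
      case (elim \<epsilon>)
      have 1: "S \<epsilon> + P4 \<epsilon> - ?E12 \<epsilon> = (S \<epsilon> - (C12 \<epsilon> - P3 \<epsilon>)) - ((P3 \<epsilon> - X11 \<epsilon> * B12) - (P4 \<epsilon> - A12 * X22 \<epsilon>))"
        by (rule mat_rounding12[OF Dc(3) elim(2) sC(2) prod(3,4) elim(1)])
      have c: "S \<epsilon> - (C12 \<epsilon> - P3 \<epsilon>) \<in> carrier_mat h h" "P3 \<epsilon> - X11 \<epsilon> * B12 \<in> carrier_mat h h"
        "P4 \<epsilon> - A12 * X22 \<epsilon> \<in> carrier_mat h h"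
        by (intro minus_carrier_mat elim prod)+
      show ?case
        using frob_norm_diff_triangle[OF Dc(4)[of \<epsilon>] add_carrier_mat[OF elim(2), of "S \<epsilon>"] E12[of \<epsilon>]]
          frob_norm_diff[OF c(1) minus_carrier_mat[OF c(3), of "P3 \<epsilon> - X11 \<epsilon> * B12"]]
          frob_norm_diff[OF c(2,3)]
        unfolding 1 by linarith
    qed
  qed (simp_all add: r0)
  have "leading_le 0 r (\<lambda>\<epsilon>. frob_norm (D12 \<epsilon> - (C12 \<epsilon> - R11 \<epsilon> * B12 + A12 * R22 \<epsilon>))) 0"
  proof (rule leading_le_mono[OF leading_le_add[OF leading_le_drop[OF rho12 rb r0]
          leading_le_add[OF leading_le_scale[OF s11(2) m(1)] leading_le_scale[OF s22(2) m(1)]]]])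
    show "\<forall>\<^sub>F \<epsilon> in at_right 0. frob_norm (D12 \<epsilon> - (C12 \<epsilon> - R11 \<epsilon> * B12 + A12 * R22 \<epsilon>))
        \<le> frob_norm (D12 \<epsilon> - ?E12 \<epsilon>) + (m * frob_norm (X11 \<epsilon> - R11 \<epsilon>) + m * frob_norm (X22 \<epsilon> - R22 \<epsilon>))"
    proof (rule always_eventually, rule allI)
      fix \<epsilon>
      have 1: "?E12 \<epsilon> - (C12 \<epsilon> - R11 \<epsilon> * B12 + A12 * R22 \<epsilon>)
          = (A12 * X22 \<epsilon> - A12 * R22 \<epsilon>) - (X11 \<epsilon> * B12 - R11 \<epsilon> * B12)"
        by (rule mat_diff_add_diff[OF sC(2) prod(3,4,7,8)])
      show "frob_norm (D12 \<epsilon> - (C12 \<epsilon> - R11 \<epsilon> * B12 + A12 * R22 \<epsilon>))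
        \<le> frob_norm (D12 \<epsilon> - ?E12 \<epsilon>) + (m * frob_norm (X11 \<epsilon> - R11 \<epsilon>) + m * frob_norm (X22 \<epsilon> - R22 \<epsilon>))"
        using frob_norm_diff_triangle[OF Dc(4)[of \<epsilon>] E12[of \<epsilon>] G12[of \<epsilon>]]
          frob_norm_diff[OF minus_carrier_mat[OF prod(8)[of \<epsilon>], of "A12 * X22 \<epsilon>"]
            minus_carrier_mat[OF prod(7)[of \<epsilon>], of "X11 \<epsilon> * B12"]]
          A12m[OF Xc(4)[of \<epsilon>] sR(4)[of \<epsilon>]] B12m[OF Xc(1)[of \<epsilon>] sR(1)[of \<epsilon>]]
        unfolding 1 by linarith
    qed
  qed (simp_all add: r0)
  note s12 = solve[OF diag_blocks(2) bb(2) acc(2) Dc(4) G12 sR(2) eq12 Rr(2) this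
      X12_def[THEN fun_cong]]

  \<comment> \<open>The error solves a Sylvester equation whose right-hand side is the residual.\<close>
  let ?N21 = "\<lambda>\<epsilon>. frob_norm (sylvester_op A22 B11 (X21 \<epsilon>) + C21 \<epsilon>)"
  let ?N11 = "\<lambda>\<epsilon>. frob_norm (sylvester_op A11 B11 (X11 \<epsilon>) + D11 \<epsilon>)"
  let ?N22 = "\<lambda>\<epsilon>. frob_norm (sylvester_op A22 B22 (X22 \<epsilon>) + D22 \<epsilon>)"
  let ?N12 = "\<lambda>\<epsilon>. frob_norm (sylvester_op A11 B22 (X12 \<epsilon>) + D12 \<epsilon>)"
  let ?\<rho>11 = "\<lambda>\<epsilon>. D11 \<epsilon> - (C11 \<epsilon> + A12 * X21 \<epsilon>)"
  let ?\<rho>22 = "\<lambda>\<epsilon>. D22 \<epsilon> - (C22 \<epsilon> - X21 \<epsilon> * B12)"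
  let ?\<rho>12 = "\<lambda>\<epsilon>. D12 \<epsilon> - ?E12 \<epsilon>"
  let ?N = "\<lambda>\<epsilon>. (?N21 \<epsilon> + (?N11 \<epsilon> + frob_norm (?\<rho>11 \<epsilon>)))
      + ((?N22 \<epsilon> + frob_norm (?\<rho>22 \<epsilon>)) + (?N12 \<epsilon> + frob_norm (?\<rho>12 \<epsilon>)))"
  have err: "frob_norm (X \<epsilon> - R \<epsilon>) \<le> g * ?N \<epsilon>" for \<epsilon>
  proof -
    let ?F11 = "(sylvester_op A11 B11 (X11 \<epsilon>) + D11 \<epsilon>) - ?\<rho>11 \<epsilon>"
    let ?F12 = "(sylvester_op A11 B22 (X12 \<epsilon>) + D12 \<epsilon>) - ?\<rho>12 \<epsilon>"
    let ?F21 = "sylvester_op A22 B11 (X21 \<epsilon>) + C21 \<epsilon>"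
    let ?F22 = "(sylvester_op A22 B22 (X22 \<epsilon>) + D22 \<epsilon>) - ?\<rho>22 \<epsilon>"
    note p = mult_carrier_mat[OF carriers(1) Xc(1)] prod(1) mult_carrier_mat[OF Xc(1) carriers(4)]
      mult_carrier_mat[OF carriers(1) Xc(2)] prod(4) prod(3) mult_carrier_mat[OF Xc(2) carriers(6)]
      mult_carrier_mat[OF carriers(3) Xc(4)] prod(2) mult_carrier_mat[OF Xc(4) carriers(6)]
      mult_carrier_mat[OF Xc(3) carriers(4)]
    have AB: "A \<in> carrier_mat (h + h) (h + h)" "B \<in> carrier_mat (h + h) (h + h)"
      using triangular_pairD(1,2)[OF pair] .
    have rc: "?\<rho>11 \<epsilon> \<in> carrier_mat h h" "?\<rho>22 \<epsilon> \<in> carrier_mat h h" "?\<rho>12 \<epsilon> \<in> carrier_mat h h"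
      by (intro minus_carrier_mat add_carrier_mat prod)+
    have Dsum: "sylvester_op A11 B11 (X11 \<epsilon>) + D11 \<epsilon> \<in> carrier_mat h h"
      "sylvester_op A22 B22 (X22 \<epsilon>) + D22 \<epsilon> \<in> carrier_mat h h"
      "sylvester_op A11 B22 (X12 \<epsilon>) + D12 \<epsilon> \<in> carrier_mat h h"
      by (intro add_carrier_mat Dc)+
    have Fc: "?F11 \<in> carrier_mat h h" "?F12 \<in> carrier_mat h h" "?F21 \<in> carrier_mat h h" "?F22 \<in> carrier_mat h h"
      by (intro minus_carrier_mat rc add_carrier_mat sC(3))+
    have "sylvester_op A B (X \<epsilon> - R \<epsilon>) = sylvester_op A B (X \<epsilon>) + C \<epsilon>"
      unfolding sylvester_op_diff[OF AB Xc' R] eq by (rule eq_matI) (use C[of \<epsilon>] in auto)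
    also have "\<dots> = four_block_mat ?F11 ?F12 ?F21 ?F22"
      unfolding X_def sylvester_op_blocks[OF Xc] sC(5)[of \<epsilon>]
    proof (subst add_four_block_mat[of _ h h _ h _ h])
      show "four_block_mat (A11 * X11 \<epsilon> + A12 * X21 \<epsilon> - X11 \<epsilon> * B11 + C11 \<epsilon>)
          (A11 * X12 \<epsilon> + A12 * X22 \<epsilon> - (X11 \<epsilon> * B12 + X12 \<epsilon> * B22) + C12 \<epsilon>)
          (A22 * X21 \<epsilon> - X21 \<epsilon> * B11 + C21 \<epsilon>) (A22 * X22 \<epsilon> - (X21 \<epsilon> * B12 + X22 \<epsilon> * B22) + C22 \<epsilon>)
          = four_block_mat ?F11 ?F12 ?F21 ?F22"
        by (rule cong_four_block_mat[OF mat_residual11[OF p(1,2,3) sC(1) Dc(1)]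
              mat_residual12[OF p(4,5,6,7) sC(2) Dc(4)] refl mat_residual22[OF p(8,9,10) sC(4) Dc(2)]])
    qed (intro minus_carrier_mat add_carrier_mat p sC)+
    finally have "frob_norm (sylvester_op A B (X \<epsilon> - R \<epsilon>)) \<le> frob_norm ?F11 + frob_norm ?F12 + frob_norm ?F21 + frob_norm ?F22"
      using frob_norm_four_block_le[OF Fc] by simp
    also have "\<dots> \<le> ?N \<epsilon>"
      using frob_norm_diff[OF Dsum(1) rc(1)] frob_norm_diff[OF Dsum(2) rc(2)] frob_norm_diff[OF Dsum(3) rc(3)]
      by linarith
    finally have "g * frob_norm (sylvester_op A B (X \<epsilon> - R \<epsilon>)) \<le> g * ?N \<epsilon>"
      using gL by (intro mult_left_mono) auto
    then show ?thesis
      using sylvester_boundsD(1)[OF bnd minus_carrier_mat[OF R[of \<epsilon>], of "X \<epsilon>"]] by linarith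
  qed
  have "leading_le 1 r ?N ((L * e + (L * e + (L + m + \<mu> h * m)))
      + ((L * e + (L + m + \<mu> h * m)) + (L * e + (2 * L + 3 * m + 2 * (\<mu> h * m)))))"
    by (intro leading_le_add s21(1) s11(1) s22(1) s12(1) rho11 rho22 rho12)
  from leading_le_scale[OF this, of g] gL
  have "leading_le 1 r (\<lambda>\<epsilon>. g * ?N \<epsilon>) (g * ((L * e + (L * e + (L + m + \<mu> h * m)))
      + ((L * e + (L + m + \<mu> h * m)) + (L * e + (2 * L + 3 * m + 2 * (\<mu> h * m))))))" by simp
  then have "leading_le 1 r (\<lambda>\<epsilon>. frob_norm (X \<epsilon> - R \<epsilon>)) (4 * (g * L) * e + 13 * (real h * \<mu> h) * (g * L))"
  proof (rule leading_le_mono)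
    have "(L * e + (L * e + (L + m + \<mu> h * m)))
      + ((L * e + (L + m + \<mu> h * m)) + (L * e + (2 * L + 3 * m + 2 * (\<mu> h * m)))) \<le> 4 * L * e + 13 * (\<mu> h * m)"
      using m by linarith
    then have "g * ((L * e + (L * e + (L + m + \<mu> h * m)))
      + ((L * e + (L + m + \<mu> h * m)) + (L * e + (2 * L + 3 * m + 2 * (\<mu> h * m))))) \<le> g * (4 * L * e + 13 * (\<mu> h * m))"
      using gL by (intro mult_left_mono) auto
    then show "g * ((L * e + (L * e + (L + m + \<mu> h * m)))
      + ((L * e + (L + m + \<mu> h * m)) + (L * e + (2 * L + 3 * m + 2 * (\<mu> h * m)))))
      \<le> 4 * (g * L) * e + 13 * (real h * \<mu> h) * (g * L)"
      by (simp add: m_def algebra_simps)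
  qed (simp_all add: err r0)
  then show "leading_le 1 (\<lambda>\<epsilon>. frob_norm (R \<epsilon>))
      (\<lambda>\<epsilon>. frob_norm (fst (SylR (ar \<epsilon>) (h + h) A B (C \<epsilon>)) - R \<epsilon>))
      (4 * (g * L) * e + 13 * (real h * \<mu> h) * (g * L))"
    by (simp add: X r_def)
qed

text \<open>The subtraction of the diagonal entries has a small relative error even if they nearly cancel, so
  the base case is free of any condition number.\<close>

lemma SylR_accuracy_1:
  fixes ar :: "real \<Rightarrow> 'a::real_normed_field arith"
  assumes fp: "\<forall>\<^sub>F \<epsilon> in at_right 0. fp_arithmetic \<epsilon> (ar \<epsilon>)" and T: "triangular_pair 1 A B"
  shows "SylR_accuracy ar 1 A B 4"
  unfolding SylR_accuracy_def
proof (intro allI impI)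
  fix R C :: "real \<Rightarrow> 'a mat" and b
  assume "\<forall>\<epsilon>. R \<epsilon> \<in> carrier_mat 1 1 \<and> C \<epsilon> \<in> carrier_mat 1 1 \<and> sylvester_op A B (R \<epsilon>) = - C \<epsilon>"
  then have R: "R \<epsilon> \<in> carrier_mat 1 1" and C: "C \<epsilon> \<in> carrier_mat 1 1"
    and eq: "sylvester_op A B (R \<epsilon>) = - C \<epsilon>" for \<epsilon> by auto
  note AB = triangular_pairD(1,2)[OF T]
  define a where "a = A $$ (0, 0) - B $$ (0, 0)"
  have a: "a \<noteq> 0" using triangular_pairD(5)[OF T, of 0 0] by (simp add: a_def)
  have x: "a * R \<epsilon> $$ (0, 0) = - C \<epsilon> $$ (0, 0)" for \<epsilon>
  proof -
    have "sylvester_op A B (R \<epsilon>) $$ (0, 0) = - (C \<epsilon> $$ (0, 0))" using eq[of \<epsilon>] C[of \<epsilon>] by simp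
    moreover have "sylvester_op A B (R \<epsilon>) $$ (0, 0) = A $$ (0, 0) * R \<epsilon> $$ (0, 0) - R \<epsilon> $$ (0, 0) * B $$ (0, 0)"
      using AB R[of \<epsilon>] by (simp add: scalar_prod_def)
    ultimately show ?thesis by (simp add: a_def algebra_simps)
  qed
  have f1: "frob_norm X = norm (X $$ (0, 0))" if "X \<in> carrier_mat 1 1" for X :: "'a mat"
    using that by (simp add: frob_norm_def)
  have "\<forall>\<^sub>F \<epsilon> in at_right 0. frob_norm (fst (SylR (ar \<epsilon>) 1 A B (C \<epsilon>)) - R \<epsilon>)
      \<le> 4 * \<epsilon> ^ 1 * frob_norm (R \<epsilon>) + 0 * \<epsilon> ^ Suc 1"
    using fp eventually_at_right_pos
  proof eventually_elim
    case (elim \<epsilon>)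
    let ?F = "ar \<epsilon>" and ?x = "R \<epsilon> $$ (0, 0)" and ?c = "C \<epsilon> $$ (0, 0)"
    let ?d = "fsub ?F (A $$ (0, 0)) (B $$ (0, 0))"
    obtain \<delta>1 where d1: "norm \<delta>1 \<le> \<epsilon>" "?d = a * (1 + \<delta>1)"
      using elim(1) unfolding fp_arithmetic_def a_def by blast
    have "1 - norm \<delta>1 \<le> norm (1 + \<delta>1)" by (metis add.commute norm_diff_ineq norm_one)
    then have half: "1 / 2 \<le> norm (1 + \<delta>1)" using d1 elim(2) by linarith
    then have ne: "1 + \<delta>1 \<noteq> 0" by auto
    then have "?d \<noteq> 0" using a d1(2) by simp
    then obtain \<delta>2 where d2: "norm \<delta>2 \<le> \<epsilon>" "fdiv ?F (- ?c) ?d = (- ?c / ?d) * (1 + \<delta>2)"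
      using elim(1) unfolding fp_arithmetic_def by blast
    have "- ?c / ?d = (a * ?x) / (a * (1 + \<delta>1))" by (simp only: x d1(2))
    then have quot: "- ?c / ?d = ?x / (1 + \<delta>1)" using a by simp
    have "fdiv ?F (- ?c) ?d - ?x = ?x * ((\<delta>2 - \<delta>1) / (1 + \<delta>1))"
      unfolding d2(2) quot using ne by (simp add: field_simps)
    then have "norm (fdiv ?F (- ?c) ?d - ?x) = norm ?x * (norm (\<delta>2 - \<delta>1) / norm (1 + \<delta>1))"
      by (simp add: norm_mult norm_divide)
    also have "\<dots> \<le> norm ?x * ((2 * \<epsilon>) / (1 / 2))"
    proof (rule mult_left_mono[OF frac_le])
      show "norm (\<delta>2 - \<delta>1) \<le> 2 * \<epsilon>" using norm_triangle_ineq4[of \<delta>2 \<delta>1] d1 d2 by linarith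
    qed (use half elim in auto)
    finally have "norm (fdiv ?F (- ?c) ?d - ?x) \<le> 4 * \<epsilon> * norm ?x" by (simp add: algebra_simps)
    moreover have "(fst (SylR ?F 1 A B (C \<epsilon>)) - R \<epsilon>) $$ (0, 0) = fdiv ?F (- ?c) ?d - ?x"
      unfolding fst_SylR_1 using R[of \<epsilon>] by simp
    ultimately show ?case
      using f1[OF minus_carrier_mat[OF R], of "fst (SylR ?F 1 A B (C \<epsilon>))" \<epsilon>] f1[OF R, of \<epsilon>] by simp
  qed
  then show "leading_le 1 (\<lambda>\<epsilon>. frob_norm (R \<epsilon>)) (\<lambda>\<epsilon>. frob_norm (fst (SylR (ar \<epsilon>) 1 A B (C \<epsilon>)) - R \<epsilon>)) 4"
    by (rule leading_leI)
qed

text \<open>The step leads from \<open>e\<close> to \<open>4 \<kappa> e + 13 h \<mu>(h) \<kappa>\<close> with \<open>\<kappa> = g * L \<ge> 1\<close>. As \<open>h \<le> 6\<^sup>k\<close> and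
  \<open>4 \<cdot> 7 + 13 \<le> 7 \<cdot> 6\<close>, the surplus of 6 over 4 absorbs the rounding term. The ratio 6 is the largest
  that the claim permits, as \<open>6\<^sup>k\<close> is the power \<open>1 + log\<^sub>2 3\<close> of \<open>2\<^sup>k\<close>.\<close>

theorem SylR_accuracy_bound:
  fixes ar :: "real \<Rightarrow> 'a::real_normed_field arith"
  assumes fp: "\<forall>\<^sub>F \<epsilon> in at_right 0. fp_arithmetic \<epsilon> (ar \<epsilon>)" and st: "stable_mm ar \<mu>"
    and "triangular_pair (2 ^ k) A B" "sylvester_bounds (2 ^ k) A B g L"
  shows "SylR_accuracy ar (2 ^ k) A B (7 * 6 ^ k * \<mu> (2 ^ k div 2) * (g * L) ^ (k + 1))"
  using assms(3-)
proof (induction k arbitrary: A B)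
  case 0
  have gL: "1 \<le> g * L" using sylvester_bounds_pos(3)[OF 0(2)] by simp
  have \<mu>: "1 \<le> \<mu> (2 ^ 0 div 2)" using st unfolding stable_mm_def by blast
  have "4 \<le> 7 * (\<mu> (2 ^ 0 div 2) * (g * L))"
    using mult_mono[OF \<mu> gL] \<mu> by simp
  moreover have "SylR_accuracy ar (2 ^ 0) A B 4" using SylR_accuracy_1[OF fp] 0(1) by simp
  ultimately show ?case by (elim SylR_accuracy_mono) (simp add: mult.assoc)
next
  case (Suc k)
  let ?h = "2 ^ k :: nat"
  have hh: "(2::nat) ^ Suc k = ?h + ?h" and h: "0 < ?h" by simp_all
  obtain A11 A12 A21 A22 where sA: "split_block A ?h ?h = (A11, A12, A21, A22)" by (metis prod_cases4)
  obtain B11 B12 B21 B22 where sB: "split_block B ?h ?h = (B11, B12, B21, B22)" by (metis prod_cases4)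
  note split = triangular_pair_split[OF Suc.prems(1)[unfolded hh] h sA sB]
  interpret split_pair ?h A11 A12 A22 B11 B12 B22 by (fact split(1))
  note bnd = Suc.prems(2)[unfolded hh split(2,3)]
  have "1 \<le> ?h + ?h" using h by linarith
  note \<kappa> = sylvester_bounds_pos(3)[OF bnd this]
  have \<mu>1: "1 \<le> \<mu> ?h" and "mono \<mu>" using st unfolding stable_mm_def by blast+
  note \<mu> = \<mu>1 monoD[OF \<open>mono \<mu>\<close>, OF div_le_dividend[of ?h 2]]
  define e where "e = 7 * 6 ^ k * \<mu> ?h * (g * L) ^ (k + 1)"
  have "7 * 6 ^ k * \<mu> (?h div 2) * (g * L) ^ (k + 1) \<le> e"
    unfolding e_def using \<mu> \<kappa> by (intro mult_right_mono mult_left_mono) auto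
  note IH = SylR_accuracy_mono[OF Suc.IH this]
  note b = bounds_blocks[OF bnd]
  have "0 \<le> e" unfolding e_def using \<mu> \<kappa> by simp
  from SylR_accuracy_step[OF fp st refl bnd this IH[OF diag_blocks(1) b(1)] IH[OF diag_blocks(2) b(2)]
      IH[OF diag_blocks(3) b(3)] IH[OF diag_blocks(4) b(4)]]
  have "SylR_accuracy ar (?h + ?h) A B (4 * (g * L) * e + 13 * (real ?h * \<mu> ?h) * (g * L))"
    unfolding split(2,3) .
  moreover have "4 * (g * L) * e + 13 * (real ?h * \<mu> ?h) * (g * L)
      \<le> 7 * 6 ^ Suc k * \<mu> ((?h + ?h) div 2) * (g * L) ^ (Suc k + 1)"
  proof -
    have "real ?h \<le> 6 ^ k" by (simp add: power_mono)
    moreover have "g * L \<le> (g * L) ^ (k + 2)" using \<kappa> power_increasing[of 1 "k + 2" "g * L"] by simp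
    ultimately have "real ?h * \<mu> ?h * (g * L) \<le> 6 ^ k * \<mu> ?h * (g * L) ^ (k + 2)"
      using \<mu> \<kappa> by (intro mult_mono) auto
    moreover have "0 \<le> real ?h * \<mu> ?h * (g * L)" using \<mu> \<kappa> by simp
    moreover have "4 * (g * L) * e = 28 * (6 ^ k * \<mu> ?h * (g * L) ^ (k + 2))"
      by (simp add: e_def)
    moreover have "7 * 6 ^ Suc k * \<mu> ((?h + ?h) div 2) * (g * L) ^ (Suc k + 1)
        = 42 * (6 ^ k * \<mu> ?h * (g * L) ^ (k + 2))"
    proof -
      have "(?h + ?h) div 2 = ?h" by simp
      then show ?thesis by (simp add: mult.assoc)
    qed
    ultimately show ?thesis by linarith
  qed
  ultimately show ?case unfolding hh by (rule SylR_accuracy_mono)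
qed

corollary SylR_error_bound:
  fixes ar :: "real \<Rightarrow> 'a::real_normed_field arith"
  assumes fp: "\<forall>\<^sub>F \<epsilon> in at_right 0. fp_arithmetic \<epsilon> (ar \<epsilon>)" and st: "stable_mm ar \<mu>"
    and T: "triangular_pair (2 ^ k) A B" and b: "sylvester_bounds (2 ^ k) A B g L"
    and R: "R \<in> carrier_mat (2 ^ k) (2 ^ k)" and C: "C \<in> carrier_mat (2 ^ k) (2 ^ k)"
    and eq: "sylvester_op A B R = - C"
  shows "\<exists>K. \<forall>\<^sub>F \<epsilon> in at_right 0. frob_norm (fst (SylR (ar \<epsilon>) (2 ^ k) A B C) - R)
    \<le> 7 * 6 ^ k * \<mu> (2 ^ k div 2) * (g * L) ^ (k + 1) * \<epsilon> * frob_norm R + K * \<epsilon>\<^sup>2"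
proof -
  have "leading_le 1 (\<lambda>_. frob_norm R) (\<lambda>\<epsilon>. frob_norm (fst (SylR (ar \<epsilon>) (2 ^ k) A B C) - R))
      (7 * 6 ^ k * \<mu> (2 ^ k div 2) * (g * L) ^ (k + 1))"
    by (rule SylR_accuracy_bound[OF fp st T b, unfolded SylR_accuracy_def, rule_format, of "\<lambda>_. R" "\<lambda>_. C" "frob_norm R"])
      (use R C eq in auto)
  then show ?thesis by (simp add: leading_le_def power2_eq_square)
qed

section \<open>From two-sided bounds to sep and the condition number\<close>

lemma is_sylvester_solution_iff:
  assumes "A \<in> carrier_mat n n" "B \<in> carrier_mat n n"
  shows "is_sylvester_solution A B C R \<longleftrightarrow> R \<in> carrier_mat n n \<and> sylvester_op A B R = - C"
  unfolding is_sylvester_solution_def carrier_matD(1)[OF assms(1)] carrier_matD(1)[OF assms(2)] ..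

lemma is_sylvester_solution_sylvester_solution:
  assumes T: "triangular_pair n A B" and C: "C \<in> carrier_mat n n"
  shows "is_sylvester_solution A B C (sylvester_solution A B C)"
proof -
  note AB = triangular_pairD(1,2)[OF T]
  have "- C \<in> carrier_mat n n" using C by simp
  from sylvester_op_surj[OF T this]
  obtain R where R: "R \<in> carrier_mat n n" "sylvester_op A B R = - C" .
  have "is_sylvester_solution A B C R" unfolding is_sylvester_solution_iff[OF AB] using R by blast
  moreover have "R' = R" if "is_sylvester_solution A B C R'" for R'
  proof -
    have R': "R' \<in> carrier_mat n n" "sylvester_op A B R' = - C"
      using that unfolding is_sylvester_solution_iff[OF AB] by blast+
    show ?thesis by (rule sylvester_op_inj[OF T R'(1) R(1) trans[OF R'(2) R(2)[symmetric]]])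
  qed
  ultimately show ?thesis unfolding sylvester_solution_def by (rule theI)
qed

lemma powr_6_power: "real (2 ^ k) powr (1 + log 2 3) = 6 ^ k"
proof -
  have "real (2 ^ k) = 2 powr real k" by (simp add: powr_realpow)
  then have "real (2 ^ k) powr log 2 3 = (2 powr log 2 3) powr real k"
    by (simp only: powr_powr mult.commute)
  also have "\<dots> = 3 ^ k" by (simp add: powr_realpow)
  finally show ?thesis by (simp add: powr_add power_mult_distrib[symmetric])
qed

lemma powr_log_power: "0 < x \<Longrightarrow> x powr (1 + log 2 (real (2 ^ k))) = x ^ (k + 1)"
  using powr_realpow[of x "k + 1"] by (simp add: log_nat_power add.commute)

theorem mainTheorem4:
  fixes \<omega> \<eta> :: real
  assumes "\<omega> + \<eta> > 2"
  shows
    "(\<forall>c. \<exists>K. \<forall>F :: 'a::real_normed_field arith. mm_cost_bound F c (\<omega> + \<eta>) \<longrightarrow>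
        (\<forall>n. \<forall>(A, B, C) \<in> sylvester_inputs n.
           real (snd (SylR F n A B C)) \<le> K * real n powr (\<omega> + \<eta>)))
     \<and>
     (\<exists>K. \<forall>(ar :: real \<Rightarrow> 'a arith) \<mu>.
        (\<forall>\<^sub>F \<epsilon> in at_right 0. fp_arithmetic \<epsilon> (ar \<epsilon>)) \<longrightarrow> stable_mm ar \<mu> \<longrightarrow>
        (\<forall>n. \<forall>(A, B, C) \<in> sylvester_inputs n. \<forall>R. is_sylvester_solution A B C R \<longrightarrow>
           (\<exists>K'. \<forall>\<^sub>F \<epsilon> in at_right 0.
              frob_norm (fst (SylR (ar \<epsilon>) n A B C) - R)
                \<le> K * (real n powr (1 + log 2 3) * \<mu> (n div 2) * \<epsilon> * frob_norm R *
                       ((frob_norm A + frob_norm B) / sep A B) powr (1 + log 2 (real n)))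
                  + K' * \<epsilon>\<^sup>2)))
     \<and>
     (\<forall>(ar :: real \<Rightarrow> 'a arith) \<mu>.
        (\<forall>\<^sub>F \<epsilon> in at_right 0. fp_arithmetic \<epsilon> (ar \<epsilon>)) \<longrightarrow> stable_mm ar \<mu> \<longrightarrow>
        logarithmically_stable sylvester_inputs
          (\<lambda>(A, B, C). sylvester_solution A B C)
          (\<lambda>(A, B, C). cond2 (sylvester_matrix A B))
          (\<lambda>\<epsilon> (A, B, C). fst (SylR (ar \<epsilon>) (dim_row A) A B C)))"
proof (intro conjI)
  have inputs: "\<exists>k. n = 2 ^ k \<and> A \<in> carrier_mat (2 ^ k) (2 ^ k) \<and> B \<in> carrier_mat (2 ^ k) (2 ^ k) \<and>
      C \<in> carrier_mat (2 ^ k) (2 ^ k) \<and> triangular_pair (2 ^ k) A B"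
    if "(A, B, C) \<in> sylvester_inputs n" for n and A B C :: "'a mat"
    using that triangular_pair_inputs[OF that] unfolding sylvester_inputs_def by auto
  show "\<forall>c. \<exists>K. \<forall>F :: 'a arith. mm_cost_bound F c (\<omega> + \<eta>) \<longrightarrow>
        (\<forall>n. \<forall>(A, B, C) \<in> sylvester_inputs n.
           real (snd (SylR F n A B C)) \<le> K * real n powr (\<omega> + \<eta>))"
  proof (rule allI, intro exI allI impI ballI, clarify)
    fix c n and F :: "'a arith" and A B C :: "'a mat"
    assume F: "mm_cost_bound F c (\<omega> + \<eta>)" and "(A, B, C) \<in> sylvester_inputs n"
    then obtain k where k: "n = 2 ^ k" "A \<in> carrier_mat (2 ^ k) (2 ^ k)" "B \<in> carrier_mat (2 ^ k) (2 ^ k)"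
        "C \<in> carrier_mat (2 ^ k) (2 ^ k)"
      using inputs by blast
    show "real (snd (SylR F n A B C))
        \<le> max 3 ((4 * \<bar>c\<bar> + 4) / (2 powr (\<omega> + \<eta>) - 4)) * real n powr (\<omega> + \<eta>)"
      unfolding k(1) by (rule SylR_cost[OF F assms _ _ k(2-4)]) auto
  qed
  show "\<exists>K. \<forall>(ar :: real \<Rightarrow> 'a arith) \<mu>.
        (\<forall>\<^sub>F \<epsilon> in at_right 0. fp_arithmetic \<epsilon> (ar \<epsilon>)) \<longrightarrow> stable_mm ar \<mu> \<longrightarrow>
        (\<forall>n. \<forall>(A, B, C) \<in> sylvester_inputs n. \<forall>R. is_sylvester_solution A B C R \<longrightarrow>
           (\<exists>K'. \<forall>\<^sub>F \<epsilon> in at_right 0.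
              frob_norm (fst (SylR (ar \<epsilon>) n A B C) - R)
                \<le> K * (real n powr (1 + log 2 3) * \<mu> (n div 2) * \<epsilon> * frob_norm R *
                       ((frob_norm A + frob_norm B) / sep A B) powr (1 + log 2 (real n)))
                  + K' * \<epsilon>\<^sup>2))"
  proof (rule exI[of _ 7], intro allI impI ballI, clarify)
    fix ar :: "real \<Rightarrow> 'a arith" and \<mu> :: "nat \<Rightarrow> real" and n and A B C R :: "'a mat"
    assume fp: "\<forall>\<^sub>F \<epsilon> in at_right 0. fp_arithmetic \<epsilon> (ar \<epsilon>)" and st: "stable_mm ar \<mu>"
      and "(A, B, C) \<in> sylvester_inputs n" and sol: "is_sylvester_solution A B C R"
    then obtain k where k: "n = 2 ^ k" "A \<in> carrier_mat (2 ^ k) (2 ^ k)" "B \<in> carrier_mat (2 ^ k) (2 ^ k)"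
        "C \<in> carrier_mat (2 ^ k) (2 ^ k)" and T: "triangular_pair (2 ^ k) A B"
      using inputs by blast
    have R: "R \<in> carrier_mat (2 ^ k) (2 ^ k)" "sylvester_op A B R = - C"
      using sol unfolding is_sylvester_solution_iff[OF k(2,3)] by blast+
    have bnd: "sylvester_bounds (2 ^ k) A B (1 / sep A B) (frob_norm A + frob_norm B)"
      by (rule sylvester_bounds_sep[OF T]) simp
    let ?\<kappa> = "(frob_norm A + frob_norm B) / sep A B"
    have \<kappa>: "0 < ?\<kappa>" using sylvester_bounds_pos(3)[OF bnd] by simp
    show "\<exists>K'. \<forall>\<^sub>F \<epsilon> in at_right 0. frob_norm (fst (SylR (ar \<epsilon>) n A B C) - R)
        \<le> 7 * (real n powr (1 + log 2 3) * \<mu> (n div 2) * \<epsilon> * frob_norm R *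
            ?\<kappa> powr (1 + log 2 (real n))) + K' * \<epsilon>\<^sup>2"
      using SylR_error_bound[OF fp st T bnd R(1) k(4) R(2)]
      unfolding k(1) powr_6_power powr_log_power[OF \<kappa>] by (simp add: mult_ac)
  qed
  show "\<forall>(ar :: real \<Rightarrow> 'a arith) \<mu>.
        (\<forall>\<^sub>F \<epsilon> in at_right 0. fp_arithmetic \<epsilon> (ar \<epsilon>)) \<longrightarrow> stable_mm ar \<mu> \<longrightarrow>
        logarithmically_stable sylvester_inputs
          (\<lambda>(A, B, C). sylvester_solution A B C)
          (\<lambda>(A, B, C). cond2 (sylvester_matrix A B))
          (\<lambda>\<epsilon> (A, B, C). fst (SylR (ar \<epsilon>) (dim_row A) A B C))"
  proof (intro allI impI)
    fix ar :: "real \<Rightarrow> 'a arith" and \<mu> :: "nat \<Rightarrow> real"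
    assume fp: "\<forall>\<^sub>F \<epsilon> in at_right 0. fp_arithmetic \<epsilon> (ar \<epsilon>)" and st: "stable_mm ar \<mu>"
    obtain p where p: "\<And>n. 1 \<le> n \<Longrightarrow> \<mu> n \<le> poly p (real n)" and mono: "mono \<mu>" and \<mu>1: "\<And>n. 1 \<le> \<mu> n"
      using st unfolding stable_mm_def by blast
    \<comment> \<open>The power \<open>1 + log\<^sub>2 3\<close> of the size is below its cube.\<close>
    define P where "P = monom 7 3 * p"
    have P: "7 * 6 ^ k * \<mu> (2 ^ k div 2) \<le> poly P (real (2 ^ k))" for k
    proof -
      have "\<mu> (2 ^ k div 2) \<le> \<mu> (2 ^ k)" by (rule monoD[OF mono]) simp
      also have "\<dots> \<le> poly p (real (2 ^ k))" by (rule p) simp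
      finally have "\<mu> (2 ^ k div 2) \<le> poly p (real (2 ^ k))" .
      moreover have "(6::real) ^ k \<le> 8 ^ k" by (rule power_mono) auto
      moreover have "(8::real) ^ k = real (2 ^ k) ^ 3"
      proof -
        have "(8::real) ^ k = (2 ^ 3) ^ k" by simp
        also have "\<dots> = real (2 ^ k) ^ 3"
          by (simp only: of_nat_power of_nat_numeral power_mult[symmetric] mult.commute)
        finally show ?thesis .
      qed
      ultimately have "6 ^ k * \<mu> (2 ^ k div 2) \<le> real (2 ^ k) ^ 3 * poly p (real (2 ^ k))"
        using \<mu>1[of "2 ^ k div 2"] by (intro mult_mono) auto
      then show ?thesis by (simp add: P_def poly_monom)
    qed
    show "logarithmically_stable sylvester_inputs
          (\<lambda>(A, B, C). sylvester_solution A B C)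
          (\<lambda>(A, B, C). cond2 (sylvester_matrix A B))
          (\<lambda>\<epsilon> (A, B, C). fst (SylR (ar \<epsilon>) (dim_row A) A B C))"
      unfolding logarithmically_stable_def
    proof (rule exI[of _ P], rule exI[of _ "[:1, 1:]"], rule exI[of _ "\<lambda>n. 1 + log 2 (real n)"],
        intro conjI allI impI ballI)
      fix n :: nat assume "1 \<le> n"
      then show "1 \<le> 1 + log 2 (real n)" "1 + log 2 (real n) \<le> poly [:1, 1:] (log 2 (real n))" by simp_all
    next
      fix n and x :: "'a mat \<times> 'a mat \<times> 'a mat"
      assume "x \<in> sylvester_inputs n"
        and ne: "frob_norm (case x of (A, B, C) \<Rightarrow> sylvester_solution A B C) \<noteq> 0"
      moreover obtain A B C where x: "x = (A, B, C)" by (cases x)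
      ultimately obtain k where k: "n = 2 ^ k" "A \<in> carrier_mat (2 ^ k) (2 ^ k)" "B \<in> carrier_mat (2 ^ k) (2 ^ k)"
          "C \<in> carrier_mat (2 ^ k) (2 ^ k)" and T: "triangular_pair (2 ^ k) A B"
        using inputs by blast
      let ?R = "sylvester_solution A B C"
      have R: "?R \<in> carrier_mat (2 ^ k) (2 ^ k)" "sylvester_op A B ?R = - C"
        using is_sylvester_solution_sylvester_solution[OF T k(4)]
        unfolding is_sylvester_solution_iff[OF k(2,3)] by blast+
      have nR: "0 < frob_norm ?R" using ne frob_norm_nonneg[of ?R] by (simp add: x less_le)
      note bnd = sylvester_bounds_op_norm2[OF T]
      let ?\<kappa> = "cond2 (sylvester_matrix A B)"
      have \<kappa>: "op_norm2 (the (mat_inverse (sylvester_matrix A B))) * op_norm2 (sylvester_matrix A B) = ?\<kappa>"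
        by (simp add: cond2_def)
      have \<kappa>1: "1 \<le> ?\<kappa>" using sylvester_bounds_pos(3)[OF bnd] by (simp add: \<kappa>)
      obtain K where "\<forall>\<^sub>F \<epsilon> in at_right 0. frob_norm (fst (SylR (ar \<epsilon>) (2 ^ k) A B C) - ?R)
          \<le> 7 * 6 ^ k * \<mu> (2 ^ k div 2) * ?\<kappa> ^ (k + 1) * \<epsilon> * frob_norm ?R + K * \<epsilon>\<^sup>2"
        using SylR_error_bound[OF fp st T bnd R(1) k(4) R(2)] unfolding \<kappa> by blast
      then have ev: "\<forall>\<^sub>F \<epsilon> in at_right 0. frob_norm (fst (SylR (ar \<epsilon>) (2 ^ k) A B C) - ?R) / frob_norm ?R
          \<le> poly P (real (2 ^ k)) * \<epsilon> * ?\<kappa> ^ (k + 1) + (K / frob_norm ?R) * \<epsilon>\<^sup>2"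
        using eventually_at_right_pos
      proof eventually_elim
        case (elim \<epsilon>)
        have "7 * 6 ^ k * \<mu> (2 ^ k div 2) * (?\<kappa> ^ (k + 1) * \<epsilon> * frob_norm ?R)
            \<le> poly P (real (2 ^ k)) * (?\<kappa> ^ (k + 1) * \<epsilon> * frob_norm ?R)"
          using elim \<kappa>1 nR by (intro mult_right_mono[OF P]) auto
        then have "frob_norm (fst (SylR (ar \<epsilon>) (2 ^ k) A B C) - ?R)
            \<le> poly P (real (2 ^ k)) * (?\<kappa> ^ (k + 1) * \<epsilon> * frob_norm ?R) + K * \<epsilon>\<^sup>2"
          using elim(1) by (simp add: mult.assoc)
        then have "frob_norm (fst (SylR (ar \<epsilon>) (2 ^ k) A B C) - ?R) / frob_norm ?R
            \<le> (poly P (real (2 ^ k)) * (?\<kappa> ^ (k + 1) * \<epsilon> * frob_norm ?R) + K * \<epsilon>\<^sup>2) / frob_norm ?R"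
          by (rule divide_right_mono) simp
        also have "\<dots> = poly P (real (2 ^ k)) * \<epsilon> * ?\<kappa> ^ (k + 1) + (K / frob_norm ?R) * \<epsilon>\<^sup>2"
          using nR by (simp add: add_divide_distrib mult_ac)
        finally show ?case .
      qed
      have pw: "?\<kappa> powr (1 + log 2 (real (2 ^ k))) = ?\<kappa> ^ (k + 1)"
        by (rule powr_log_power) (use \<kappa>1 in simp)
      show "\<exists>K. \<forall>\<^sub>F \<epsilon> in at_right 0.
          frob_norm ((case x of (A, B, C) \<Rightarrow> fst (SylR (ar \<epsilon>) (dim_row A) A B C))
            - (case x of (A, B, C) \<Rightarrow> sylvester_solution A B C))
            / frob_norm (case x of (A, B, C) \<Rightarrow> sylvester_solution A B C)
          \<le> poly P (real n) * \<epsilon> * (case x of (A, B, C) \<Rightarrow> cond2 (sylvester_matrix A B)) powr (1 + log 2 (real n))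
            + K * \<epsilon>\<^sup>2"
        unfolding x prod.case k(1) carrier_matD(1)[OF k(2)] pw by (rule exI, rule ev)
    qed
  qed
qed

end
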